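(* Let $\alpha\in\{-1,0,1\}$, let $g:\mathbb T\to\mathbb R$ be of bounded variation, and let $u$ be the (real-valued) solution of the Kawahara equation $$\partial_t u+\partial_x^5u+\alpha\,\partial_x^3u+u\,\partial_xu=0,\qquad x\in\mathbb T=\mathbb R/(2\pi\mathbb Z),\qquad u(x,0)=g(x).$$ Suppose that $$\sigma_0:=\sup\{\sigma\in\mathbb R: g\in H^\sigma(\mathbb T)\}<\frac{17}{32}.$$ Then for almost all $t\in\mathbb R\setminus\pi\mathbb Q$ the graph of $x\mapsto u(x,t)$ has upper Minkowski dimension $D\in\left[\frac{33}{16}-2\sigma_0,\ \frac{31}{16}\right]$. Moreover, for almost all $t\in\mathbb R\setminus\pi\mathbb Q$, the graph of $x\mapsto|u(x,t)|^2$ has upper Minkowski dimension at most $\frac{31}{16}$.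
   Context: $H^\sigma(\mathbb T)$ is the Sobolev space with norm $\|f\|_{H^\sigma}=\big(\sum_{k\in\mathbb Z}\langle k\rangle^{2\sigma}|\widehat f(k)|^2\big)^{1/2}$, where $\langle k\rangle=(1+|k|^2)^{1/2}$ and $\widehat f(k)=\frac1{2\pi}\int_0^{2\pi}e^{-ikx}f(x)\,dx$. (Since $g$ is of bounded variation, $\sigma_0\ge 1/2$ automatically.) The upper Minkowski dimension (fractal dimension) of a set $S\subset\mathbb R^n$ is $\limsup_{\epsilon\to0}\frac{\log N(S,\epsilon)}{\log(1/\epsilon)}$, where $N(S,\epsilon)$ is the minimum number of balls of radius $\epsilon$ required to cover $S$. "Almost all" is with respect to Lebesgue measure. Solution: for $g\in L^2(\mathbb T)$ the solution for $t\ge0$ is the global solution $u\in C([0,\infty);L^2(\mathbb T))$ furnished by the known well-posedness theory: for smooth real data $g_n\to g$ in $L^2(\mathbb T)$, the corresponding smooth global solutions converge to $u$ in $C([0,T];L^2(\mathbb T))$ for every $T>0$, and $u$ solves the equation in the sense of distributions. For $t<0$ it is defined through the symmetry $(x,t)\mapsto(-x,-t)$ of the equation. The graph is that of the continuous representative of $u(\cdot,t)$ (respectively of $|u(\cdot,t)|^2$). *)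

theory Defs
  imports "HOL-Analysis.Analysis"
begin

section \<open>Functions on the torus\<close>

text \<open>Functions on the torus are represented by \<open>2 * pi\<close>-periodic functions on the real line, and
  elements of \<open>L\<^sup>2\<close> by arbitrary representatives; accordingly, equality in \<open>L\<^sup>2\<close> is equality
  almost everywhere.\<close>

definition torus_fun :: "(real \<Rightarrow> 'a) \<Rightarrow> bool" where
  "torus_fun f \<longleftrightarrow> (\<forall>x. f (x + 2 * pi) = f x)"

definition torus_L2 :: "(real \<Rightarrow> real) \<Rightarrow> bool" where
  "torus_L2 f \<longleftrightarrow> torus_fun f \<and> f \<in> borel_measurable lebesgue \<and>
     set_integrable lebesgue {0..2 * pi} (\<lambda>x. (f x)\<^sup>2)"

definition L2_norm_torus :: "(real \<Rightarrow> real) \<Rightarrow> real" where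
  "L2_norm_torus f = sqrt (LINT x:{0..2 * pi}|lebesgue. (f x)\<^sup>2)"

definition torus_smooth :: "(real \<Rightarrow> real) \<Rightarrow> bool" where
  "torus_smooth f \<longleftrightarrow> torus_fun f \<and> (\<forall>k x. (deriv ^^ k) f field_differentiable (at x))"

definition bounded_variation_on :: "(real \<Rightarrow> real) \<Rightarrow> real \<Rightarrow> real \<Rightarrow> bool" where
  "bounded_variation_on f a b \<longleftrightarrow>
     (\<exists>M. \<forall>n. \<forall>p :: nat \<Rightarrow> real.
        (\<forall>i\<le>n. p i \<in> {a..b}) \<and> (\<forall>i<n. p i \<le> p (Suc i)) \<longrightarrow>
        (\<Sum>i<n. \<bar>f (p (Suc i)) - f (p i)\<bar>) \<le> M)"

text \<open>Since periodicity identifies the two endpoints, bounded variation on one closed period is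
  bounded variation on the torus.\<close>

definition torus_BV :: "(real \<Rightarrow> real) \<Rightarrow> bool" where
  "torus_BV f \<longleftrightarrow> torus_fun f \<and> bounded_variation_on f 0 (2 * pi)"

section \<open>Sobolev regularity\<close>

definition fourier_coeff :: "(real \<Rightarrow> real) \<Rightarrow> int \<Rightarrow> complex" where
  "fourier_coeff f k =
     (LINT x:{0..2 * pi}|lebesgue. exp (- \<i> * of_int k * of_real x) * of_real (f x)) / (2 * pi)"

definition japanese_bracket :: "int \<Rightarrow> real" where
  "japanese_bracket k = sqrt (1 + (of_int k)\<^sup>2)"

text \<open>For negative exponents the Sobolev space contains distributions; only its members that are
  integrable functions are needed here.\<close>

definition in_sobolev :: "real \<Rightarrow> (real \<Rightarrow> real) \<Rightarrow> bool" where
  "in_sobolev \<sigma> f \<longleftrightarrow> torus_fun f \<and> set_integrable lebesgue {0..2 * pi} f \<and>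
     (\<lambda>k. japanese_bracket k powr (2 * \<sigma>) * (cmod (fourier_coeff f k))\<^sup>2) summable_on UNIV"

definition sobolev_index :: "(real \<Rightarrow> real) \<Rightarrow> ereal" where
  "sobolev_index f = Sup (ereal ` {\<sigma>. in_sobolev \<sigma> f})"

section \<open>Solutions of the Kawahara equation\<close>

text \<open>\<open>smooth_spacetime I v\<close> says that \<open>v\<close>, read as a function of \<open>(t, x)\<close>, is of class
  \<open>C\<^sup>\<infinity>\<close> on \<open>I \<times> \<real>\<close>: \<open>V j k\<close> is the derivative of order \<open>j\<close> in \<open>t\<close> and \<open>k\<close> in \<open>x\<close>.
  Time derivatives are one-sided at an endpoint belonging to \<open>I\<close>.\<close>

definition smooth_spacetime :: "real set \<Rightarrow> (real \<Rightarrow> real \<Rightarrow> real) \<Rightarrow> bool" where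
  "smooth_spacetime I v \<longleftrightarrow>
     (\<exists>V :: nat \<Rightarrow> nat \<Rightarrow> real \<Rightarrow> real \<Rightarrow> real.
        (\<forall>t\<in>I. \<forall>x. V 0 0 t x = v t x) \<and>
        (\<forall>j k. continuous_on (I \<times> UNIV) (\<lambda>(t, x). V j k t x)) \<and>
        (\<forall>j k. \<forall>t\<in>I. \<forall>x.
           ((\<lambda>s. V j k s x) has_real_derivative V (Suc j) k t x) (at t within I) \<and>
           (V j k t has_real_derivative V j (Suc k) t x) (at x)))"

definition kawahara_smooth_solution ::
    "real \<Rightarrow> (real \<Rightarrow> real) \<Rightarrow> (real \<Rightarrow> real \<Rightarrow> real) \<Rightarrow> bool" where
  "kawahara_smooth_solution \<alpha> h v \<longleftrightarrow>
     smooth_spacetime {0..} v \<and>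
     (\<forall>t\<ge>0. torus_fun (v t)) \<and>
     (\<forall>x. v 0 x = h x) \<and>
     (\<forall>t>0. \<forall>x. deriv (\<lambda>s. v s x) t + (deriv ^^ 5) (v t) x + \<alpha> * (deriv ^^ 3) (v t) x
                  + v t x * deriv (v t) x = 0)"

text \<open>The equation in the sense of distributions on \<open>(0,\<infinity>) \<times> \<T>\<close>, with the nonlinearity written as
  the derivative of \<open>u\<^sup>2 / 2\<close>. The integral is iterated, so that it depends only on the class of
  \<open>u t\<close> in \<open>L\<^sup>2\<close> for each \<open>t\<close>, and joint measurability of the chosen representatives is not
  needed; for \<open>u\<close> continuous in time with values in \<open>L\<^sup>2\<close> the inner integral is continuous
  in \<open>t\<close>.\<close>

definition kawahara_distributional :: "real \<Rightarrow> (real \<Rightarrow> real \<Rightarrow> real) \<Rightarrow> bool" where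
  "kawahara_distributional \<alpha> u \<longleftrightarrow>
     (\<forall>\<phi> :: real \<Rightarrow> real \<Rightarrow> real.
        smooth_spacetime UNIV \<phi> \<and> (\<forall>t. torus_fun (\<phi> t)) \<and>
        (\<exists>a b. 0 < a \<and> a < b \<and> (\<forall>t x. t \<notin> {a..b} \<longrightarrow> \<phi> t x = 0)) \<longrightarrow>
        (LINT t:{0..}|lebesgue. (LINT x:{0..2 * pi}|lebesgue.
            u t x * (deriv (\<lambda>s. \<phi> s x) t + (deriv ^^ 5) (\<phi> t) x + \<alpha> * (deriv ^^ 3) (\<phi> t) x)
            + (u t x)\<^sup>2 / 2 * deriv (\<phi> t) x)) = 0)"

text \<open>The global \<open>L\<^sup>2\<close> solution on \<open>[0,\<infinity>)\<close> furnished by the well-posedness theory: for every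
  approximation of the datum by smooth data, the corresponding smooth global solutions converge
  to \<open>u\<close>, locally uniformly in time, in \<open>L\<^sup>2\<close>.\<close>

definition kawahara_forward_solution ::
    "real \<Rightarrow> (real \<Rightarrow> real) \<Rightarrow> (real \<Rightarrow> real \<Rightarrow> real) \<Rightarrow> bool" where
  "kawahara_forward_solution \<alpha> g u \<longleftrightarrow>
     (\<forall>t\<ge>0. torus_L2 (u t)) \<and>
     (\<forall>t\<ge>0. ((\<lambda>s. L2_norm_torus (\<lambda>x. u s x - u t x)) \<longlongrightarrow> 0) (at t within {0..})) \<and>
     (AE x in lebesgue. u 0 x = g x) \<and>
     (\<forall>h :: nat \<Rightarrow> real \<Rightarrow> real.
        (\<forall>n. torus_smooth (h n)) \<and> (\<lambda>n. L2_norm_torus (\<lambda>x. h n x - g x)) \<longlonglongrightarrow> 0 \<longrightarrow>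
        (\<exists>v. (\<forall>n. kawahara_smooth_solution \<alpha> (h n) (v n)) \<and>
             (\<forall>T>0. uniform_limit {0..T} (\<lambda>n t. L2_norm_torus (\<lambda>x. v n t x - u t x))
                      (\<lambda>_. 0) sequentially))) \<and>
     kawahara_distributional \<alpha> u"

text \<open>Negative times are reduced to positive ones by the symmetry \<open>(x, t) \<mapsto> (-x, -t)\<close>.
  The time variable is the first argument of \<open>u\<close>.\<close>

definition kawahara_solution ::
    "real \<Rightarrow> (real \<Rightarrow> real) \<Rightarrow> (real \<Rightarrow> real \<Rightarrow> real) \<Rightarrow> bool" where
  "kawahara_solution \<alpha> g u \<longleftrightarrow>
     kawahara_forward_solution \<alpha> g u \<and>
     kawahara_forward_solution \<alpha> (\<lambda>x. g (- x)) (\<lambda>t x. u (- t) (- x))"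

section \<open>Graphs and upper Minkowski dimension\<close>

text \<open>A continuous representative of a class of functions modulo null sets is unique, since
  continuous functions that agree almost everywhere are equal.\<close>

definition continuous_representative :: "(real \<Rightarrow> real) \<Rightarrow> (real \<Rightarrow> real) \<Rightarrow> bool" where
  "continuous_representative f w \<longleftrightarrow> continuous_on UNIV w \<and> (AE x in lebesgue. w x = f x)"

definition torus_graph :: "(real \<Rightarrow> real) \<Rightarrow> (real \<times> real) set" where
  "torus_graph f = (\<lambda>x. (x, f x)) ` {0..2 * pi}"

definition covering_number :: "'a::metric_space set \<Rightarrow> real \<Rightarrow> nat" where
  "covering_number S \<epsilon> = (LEAST n. \<exists>C. finite C \<and> card C = n \<and> S \<subseteq> (\<Union>c\<in>C. ball c \<epsilon>))"

text \<open>An unbounded set has no finite cover by balls of a fixed radius.\<close>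

definition upper_minkowski_dim :: "'a::euclidean_space set \<Rightarrow> ereal" where
  "upper_minkowski_dim S =
     (if bounded S
      then Limsup (at_right 0) (\<lambda>\<epsilon>. ereal (ln (real (covering_number S \<epsilon>)) / ln (1 / \<epsilon>)))
      else \<infinity>)"

end

theory Submission
  imports Defs
begin

text \<open>
  Let \<open>\<Omega> k = k\<^sup>5 - \<alpha> k\<^sup>3 + c k\<close>, where \<open>c\<close> is the mean of \<open>g\<close>. In the profile
  \<open>exp (i t \<Omega> k) u\<^sub>k(t)\<close> the modes \<open>j\<close> and \<open>l\<close> interact with the phase
  \<open>(j + l) j l (5 (j\<^sup>2 + j l + l\<^sup>2) - 3 \<alpha>)\<close>, which is so large that a single integration by parts
  in time, using nothing but the \<open>L\<^sup>2\<close> bound, shows that \<open>u\<^sub>k(t)\<close> differs from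
  \<open>exp (- i t \<Omega> k) g\<^sub>k\<close> by \<open>O(\<bar>k\<bar>\<^bsup>-3/2\<^esup>)\<close>.

  For the linear evolution, four Weyl differencing steps bound the sums of \<open>exp (i (- t \<Omega> k + k x))\<close>
  over intervals of length \<open>N\<close> by a majorant that is independent of \<open>x\<close> and of the interval. The
  integral of the majorant in \<open>t\<close> is explicit, so for almost all \<open>t\<close> these sums are
  \<open>O(N\<^bsup>15/16\<^esup> log N)\<close> along dyadic \<open>N\<close>, without any Diophantine input. Paired with the measure
  \<open>dg\<close> this bounds the dyadic blocks of \<open>u(t)\<close> by \<open>2\<^bsup>-j/16\<^esup>\<close> up to a factor \<open>j + 1\<close>, so that \<open>u(t)\<close> is
  Hoelder continuous with every exponent \<open>\<theta> < 1/16\<close>; this gives the upper bounds.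

  Conversely, if the graph had dimension less than \<open>d\<close>, then the translation modulus of \<open>u(t)\<close>
  in \<open>L\<^sup>1\<close> would be \<open>O(h\<^bsup>2-d\<^esup>)\<close>, hence its square in \<open>L\<^sup>2\<close> would be \<open>O(h\<^bsup>2-d+\<theta>\<^esup>)\<close>, and Bessel's
  inequality would put \<open>u(t)\<close>, hence \<open>g\<close>, into \<open>H\<^sup>\<sigma>\<close> for all \<open>2 \<sigma> < 33/16 - d\<close>.
\<close>

section \<open>Trigonometric approximation and Fourier coefficients\<close>

text \<open>The normal form is carried out on smooth approximations, where convolutions and time
  derivatives are classical. Its constant depends only on the time and on a bound for the
  \<open>L\<^sup>2\<close> norm, and Fourier coefficients are continuous in
  \<open>L\<^sup>2\<close>, so the estimate survives the limit to rough data. Non-resonance is a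
  matter of integrality: X = j^2 + j l + l^2 is at least 1 unless both modes vanish, and 5 X - 3
  \<alpha> >= 2 X for X >= 1 and \<alpha> <= 1. The true resonances contain a zero mode. As input it
  multiplies a single coefficient by the constant mean, which is why the mean enters the phase; as
  output it is killed by the derivative in the nonlinearity.

  The majorant of the 16th power of a quintic Weyl sum has time average N^15 up to a logarithm, one
  power of N below the trivial bound. This single power is the 1/16 in both dimension bounds: once
  as the Hoelder exponent, once as the extra smallness of the \<open>L\<^sup>2\<close> modulus. The
  assumption on the Sobolev index says that the lower bound 33/16 - 2 r exceeds 1 at the index r.
  Hence a hypothetical smaller dimension exponent d may be taken >= 1, as required by a boundary
  strip of width h that contributes O(h) to the \<open>L\<^sup>1\<close> modulus.\<close>

inductive trig_poly :: "(real \<Rightarrow> complex) \<Rightarrow> bool" where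
  trig_poly_monom: "trig_poly (\<lambda>x. c * cis (of_int k * x))"
| trig_poly_add: "trig_poly p \<Longrightarrow> trig_poly q \<Longrightarrow> trig_poly (\<lambda>x. p x + q x)"

lemma trig_poly_mult:
  assumes "trig_poly p" "trig_poly q"
  shows "trig_poly (\<lambda>x. p x * q x)"
  using assms(1)
proof induction
  case (trig_poly_monom c k)
  show ?case using assms(2)
  proof induction
    case (trig_poly_monom c' k')
    have "c * cis (of_int k * x) * (c' * cis (of_int k' * x)) = (c * c') * cis (of_int (k + k') * x)" for x
      by (simp add: cis_mult algebra_simps)
    thus ?case by (simp only: trig_poly.trig_poly_monom)
  next
    case (trig_poly_add p q)
    thus ?case by (simp only: distrib_left trig_poly.trig_poly_add)
  qed
next
  case (trig_poly_add p q)
  thus ?case by (simp only: distrib_right trig_poly.trig_poly_add)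
qed

text \<open>On the circle a real polynomial of the plane is a polynomial in cosine and sine. A
  linear functional \<open>f\<close> is determined by \<open>f 1\<close> and \<open>f \<i>\<close>,
  and Euler's formula turns it into the frequencies 1 and -1; products are covered by
  \<open>trig_poly_mult\<close>.\<close>

lemma trig_poly_real_polynomial_function:
  assumes "real_polynomial_function q"
  shows "trig_poly (\<lambda>x. of_real (q (cis x)))"
  using assms
proof induction
  case (linear f)
  have "of_real (f (cis x)) = (of_real (f 1) - \<i> * of_real (f \<i>)) / 2 * cis (of_int 1 * x)
      + (of_real (f 1) + \<i> * of_real (f \<i>)) / 2 * cis (of_int (- 1) * x)" for x
  proof -
    have "cis x = cos x *\<^sub>R 1 + sin x *\<^sub>R \<i>" by (simp add: complex_eq_iff)
    hence "f (cis x) = cos x * f 1 + sin x * f \<i>"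
      using linear by (simp add: linear_simps)
    thus ?thesis by (simp add: complex_eq_iff field_simps)
  qed
  thus ?case by (simp only: trig_poly.intros)
next
  case (const c)
  have "trig_poly (\<lambda>x. of_real c * cis (of_int 0 * x))" by (rule trig_poly_monom)
  thus ?case by simp
next
  case (add f g)
  thus ?case by (simp add: trig_poly.trig_poly_add)
next
  case (mult f g)
  thus ?case by (simp add: trig_poly_mult)
qed

lemma trig_poly_continuous: "trig_poly p \<Longrightarrow> continuous_on A p"
  by (induction rule: trig_poly.induct) (intro continuous_intros; assumption)+

text \<open>Equality of the endpoint values lets \<phi> descend to a continuous function on the unit
  circle, where the Stone-Weierstrass theorem applies.\<close>

lemma trig_approximation:
  fixes \<phi> :: "real \<Rightarrow> real"
  assumes \<phi>: "continuous_on {0..2 * pi} \<phi>" "\<phi> 0 = \<phi> (2 * pi)" and e: "e > 0"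
  obtains p :: "real \<Rightarrow> real" where "trig_poly (\<lambda>x. of_real (p x))"
    "\<And>x. x \<in> {0..2 * pi} \<Longrightarrow> \<bar>\<phi> x - p x\<bar> < e"
proof -
  let ?T = "{0..2 * pi}" and ?S = "sphere (0 :: complex) 1"
  define F where "F z = \<phi> (Arg2pi z)" for z
  have Fcis: "F (cis x) = \<phi> x" if x: "x \<in> ?T" for x
  proof (cases "x = 2 * pi")
    case True
    have "Arg2pi 1 = 0" by (rule Arg2pi_unique[of 1]) auto
    thus ?thesis using True \<phi>(2) by (simp add: F_def)
  next
    case False
    have "Arg2pi (cis x) = x"
      using x False by (intro Arg2pi_unique[of 1]) (auto simp: cis_conv_exp)
    thus ?thesis by (simp add: F_def)
  qed
  have surj: "z \<in> cis ` ?T" if "z \<in> ?S" for z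
  proof -
    have "z = cis (Arg2pi z)" using that complex_norm_eq_1_exp[of z] by (simp add: cis_conv_exp)
    moreover have "Arg2pi z \<in> ?T" using Arg2pi_ge_0[of z] Arg2pi_lt_2pi[of z] by auto
    ultimately show ?thesis by blast
  qed
  \<comment> \<open>\<open>Arg2pi\<close> jumps on the positive real axis, so continuity is checked
    through preimages: that of a closed set is the \<open>cis\<close> image of a compact part of the
    period, hence closed.\<close>
  have "continuous_on ?S F"
    unfolding continuous_on_closed_vimage[OF closed_sphere]
  proof (intro allI impI)
    fix B :: "real set" assume B: "closed B"
    have "F -` B \<inter> ?S = cis ` (\<phi> -` B \<inter> ?T)"
    proof (intro equalityI subsetI)
      fix z assume z: "z \<in> F -` B \<inter> ?S"
      then obtain x where "x \<in> ?T" "z = cis x" using surj by blast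
      thus "z \<in> cis ` (\<phi> -` B \<inter> ?T)" using z Fcis by auto
    next
      fix z assume "z \<in> cis ` (\<phi> -` B \<inter> ?T)"
      thus "z \<in> F -` B \<inter> ?S" using Fcis by auto
    qed
    moreover have "closed (\<phi> -` B \<inter> ?T)"
      using \<phi>(1) B by (simp add: continuous_on_closed_vimage)
    hence "compact (\<phi> -` B \<inter> ?T)"
      using bounded_subset[OF bounded_closed_interval[of 0 "2 * pi"], of "\<phi> -` B \<inter> ?T"]
      by (simp add: compact_eq_bounded_closed)
    hence "compact (cis ` (\<phi> -` B \<inter> ?T))"
      by (intro compact_continuous_image continuous_intros)
    ultimately show "closed (F -` B \<inter> ?S)" by (simp add: compact_imp_closed)
  qed
  then obtain g where g: "real_polynomial_function g" "\<And>z. z \<in> ?S \<Longrightarrow> \<bar>F z - g z\<bar> < e"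
    using Stone_Weierstrass_real_polynomial_function[OF compact_sphere _ e] by blast
  show thesis
  proof (rule that[of "\<lambda>x. g (cis x)"])
    show "trig_poly (\<lambda>x. of_real (g (cis x)))"
      using g(1) by (rule trig_poly_real_polynomial_function)
    show "\<bar>\<phi> x - g (cis x)\<bar> < e" if "x \<in> ?T" for x
      using g(2)[of "cis x"] Fcis[OF that] by simp
  qed
qed

lemma has_vector_derivative_cis_mult:
  "((\<lambda>x. cis (a * x)) has_vector_derivative \<i> * of_real a * cis (a * x)) (at x within S)"
proof -
  have "((\<lambda>z. exp (\<i> * of_real a * z)) has_field_derivative
      \<i> * of_real a * exp (\<i> * of_real a * of_real x)) (at (of_real x))"
    by (auto intro!: derivative_eq_intros)
  from has_vector_derivative_real_field[OF this] show ?thesis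
    by (simp add: cis_conv_exp mult_ac)
qed

lemma trig_poly_derivatives:
  assumes "trig_poly p"
  shows "\<exists>D. D 0 = p \<and> (\<forall>n x. (D n has_vector_derivative D (Suc n) x) (at x))"
  using assms
proof induction
  case (trig_poly_monom c k)
  let ?D = "\<lambda>n x. c * (\<i> * of_int k) ^ n * cis (of_int k * x)"
  have "(?D n has_vector_derivative ?D (Suc n) x) (at x)" for n x
  proof -
    show ?thesis
      using has_vector_derivative_mult_right[OF has_vector_derivative_cis_mult[of "of_int k" x UNIV], of "c * (\<i> * of_int k) ^ n"]
      by (simp add: mult_ac)
  qed
  thus ?case by (intro exI[of _ ?D]) auto
next
  case (trig_poly_add p q)
  then obtain D E where DE: "D 0 = p" "E 0 = q"
    "\<And>n x. (D n has_vector_derivative D (Suc n) x) (at x)"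
    "\<And>n x. (E n has_vector_derivative E (Suc n) x) (at x)" by blast
  thus ?case
    by (intro exI[of _ "\<lambda>n x. D n x + E n x"]) (auto intro!: has_vector_derivative_add)
qed

lemma cis_int_shift: "cis (of_int k * (x + 2 * pi)) = cis (of_int k * x)"
proof -
  have "cis (of_int k * (x + 2 * pi)) = cis (of_int k * x) * cis (2 * pi * of_int k)"
    by (simp add: cis_mult algebra_simps)
  thus ?thesis by simp
qed

lemma trig_poly_periodic: "trig_poly p \<Longrightarrow> p (x + 2 * pi) = p x"
  by (induction rule: trig_poly.induct) (simp_all add: cis_int_shift)

lemma trig_poly_smooth:
  assumes "trig_poly (\<lambda>x. of_real (p x))"
  shows "torus_smooth p"
proof -
  obtain D where D: "D 0 = (\<lambda>x. complex_of_real (p x))"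
    "\<And>n x. (D n has_vector_derivative D (Suc n) x) (at x)"
    using trig_poly_derivatives[OF assms] by blast
  have R: "((\<lambda>x. Re (D n x)) has_real_derivative Re (D (Suc n) x)) (at x)" for n x
    using bounded_linear.has_vector_derivative[OF bounded_linear_Re D(2)]
    by (simp add: has_real_derivative_iff_has_vector_derivative)
  have der: "(deriv ^^ n) p = (\<lambda>x. Re (D n x))" for n
  proof (induction n)
    case (Suc n)
    thus ?case using DERIV_imp_deriv[OF R] by simp
  qed (simp add: D(1))
  have "(deriv ^^ n) p field_differentiable at x" for n x
    unfolding der field_differentiable_def using R by blast
  moreover have "p (x + 2 * pi) = p x" for x
    using trig_poly_periodic[OF assms, of x] by simp
  ultimately show ?thesis by (simp add: torus_smooth_def torus_fun_def)
qed

text \<open>A measurable function is almost everywhere a limit of continuous ones. Truncation at the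
  levels -B and B keeps the limit and gives the uniform bound that dominated convergence asks for;
  the spare 1 absorbs the error of the trigonometric approximation.\<close>

lemma trig_poly_approx_bounded_measurable:
  fixes f :: "real \<Rightarrow> real"
  assumes f: "f \<in> borel_measurable lebesgue" and B: "\<And>x. \<bar>f x\<bar> \<le> B"
  shows "\<exists>p :: nat \<Rightarrow> real \<Rightarrow> real. (\<forall>n. trig_poly (\<lambda>x. of_real (p n x))) \<and>
    (\<forall>n. \<forall>x\<in>{0..2 * pi}. \<bar>p n x\<bar> \<le> B + 1) \<and>
    (AE x in lebesgue. x \<in> {0..2 * pi} \<longrightarrow> (\<lambda>n. p n x) \<longlonglongrightarrow> f x)"
proof -
  let ?T = "{0..2 * pi}"
  have B0: "B \<ge> 0" using B[of 0] by linarith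
  have "f measurable_on UNIV"
    using f by (intro lebesgue_measurable_imp_measurable_on) auto
  then obtain N g where N: "negligible N" and g: "\<And>n. continuous_on UNIV (g n)"
    and lim: "\<And>x. x \<notin> N \<Longrightarrow> (\<lambda>n. g n x) \<longlonglongrightarrow> f x"
    unfolding measurable_on_def by auto
  \<comment> \<open>The cut-off vanishes at both ends of the period, so that the endpoint values
    agree, and tends to 1 at every interior point.\<close>
  define \<kappa> where "\<kappa> n x = min 1 (real n * (x * (2 * pi - x)))" for n x
  define \<psi> where "\<psi> n x = max (- B) (min B (g n x)) * \<kappa> n x" for n x
  have \<kappa>01: "0 \<le> \<kappa> n x" "\<kappa> n x \<le> 1" if "x \<in> ?T" for n x
    using that by (auto simp: \<kappa>_def)
  have \<psi>B: "\<bar>\<psi> n x\<bar> \<le> B" if "x \<in> ?T" for n x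
  proof -
    have "\<bar>max (- B) (min B (g n x))\<bar> * \<bar>\<kappa> n x\<bar> \<le> B * 1"
      using \<kappa>01[OF that, of n] B0 by (intro mult_mono) auto
    thus ?thesis by (simp add: \<psi>_def abs_mult)
  qed
  have \<psi>c: "continuous_on ?T (\<psi> n)" for n
    unfolding \<psi>_def \<kappa>_def
    by (intro continuous_intros continuous_on_max continuous_on_min continuous_on_subset[OF g]) auto
  have \<psi>e: "\<psi> n 0 = \<psi> n (2 * pi)" for n by (simp add: \<psi>_def \<kappa>_def)
  have "\<exists>p. trig_poly (\<lambda>x. of_real (p x)) \<and> (\<forall>x\<in>?T. \<bar>\<psi> n x - p x\<bar> < 1 / (real n + 1))" for n
    by (rule trig_approximation[OF \<psi>c \<psi>e, of "1 / (real n + 1)" n]) (auto simp: add_pos_nonneg)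
  then obtain p where p: "\<And>n. trig_poly (\<lambda>x. of_real (p n x))"
    "\<And>n x. x \<in> ?T \<Longrightarrow> \<bar>\<psi> n x - p n x\<bar> < 1 / (real n + 1)" by metis
  have pB: "\<bar>p n x\<bar> \<le> B + 1" if "x \<in> ?T" for n x
  proof -
    have "1 / (real n + 1) \<le> 1" by simp
    thus ?thesis using p(2)[OF that, of n] \<psi>B[OF that, of n] by linarith
  qed
  have "N \<union> {0, 2 * pi} \<in> null_sets lebesgue"
    using N by (auto simp flip: negligible_iff_null_sets)
  hence "AE x in lebesgue. x \<notin> N \<union> {0, 2 * pi}" by (rule AE_not_in)
  hence "AE x in lebesgue. x \<in> ?T \<longrightarrow> (\<lambda>n. p n x) \<longlonglongrightarrow> f x"
  proof (rule eventually_mono, intro impI)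
    fix x assume x: "x \<notin> N \<union> {0, 2 * pi}" "x \<in> ?T"
    have "(\<lambda>n. max (- B) (min B (g n x))) \<longlonglongrightarrow> max (- B) (min B (f x))"
      using lim x by (intro tendsto_max tendsto_min tendsto_const) auto
    moreover have "max (- B) (min B (f x)) = f x" using B[of x] by (auto simp: abs_le_iff)
    moreover have "(\<lambda>n. \<kappa> n x) \<longlonglongrightarrow> 1"
    proof (rule tendsto_eventually)
      define y where "y = x * (2 * pi - x)"
      have "y > 0" using x by (auto simp: y_def)
      obtain M :: nat where M: "1 / y < real M" using reals_Archimedean2 by blast
      have "\<kappa> n x = 1" if "n \<ge> M" for n
      proof -
        have "1 \<le> real M * y" using M \<open>y > 0\<close> by (simp add: field_simps)
        also have "\<dots> \<le> real n * y" using that \<open>y > 0\<close> by (intro mult_right_mono) auto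
        finally show ?thesis by (simp add: \<kappa>_def y_def)
      qed
      thus "\<forall>\<^sub>F n in sequentially. \<kappa> n x = 1" by (auto simp: eventually_sequentially)
    qed
    ultimately have "(\<lambda>n. \<psi> n x) \<longlonglongrightarrow> f x * 1"
      unfolding \<psi>_def by (metis tendsto_mult)
    moreover have "(\<lambda>n. \<psi> n x - p n x) \<longlonglongrightarrow> 0"
    proof (rule tendsto_rabs_zero_cancel, rule tendsto_sandwich[OF _ _ tendsto_const])
      show "\<forall>\<^sub>F n in sequentially. \<bar>\<psi> n x - p n x\<bar> \<le> inverse (real (Suc n))"
        using p(2)[OF x(2)] by (intro always_eventually) (auto simp: inverse_eq_divide add.commute intro: less_imp_le)
      show "(\<lambda>n. inverse (real (Suc n))) \<longlonglongrightarrow> 0" by (rule LIMSEQ_inverse_real_of_nat)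
    qed auto
    ultimately have "(\<lambda>n. \<psi> n x - (\<psi> n x - p n x)) \<longlonglongrightarrow> f x * 1 - 0"
      by (rule tendsto_diff)
    thus "(\<lambda>n. p n x) \<longlonglongrightarrow> f x" by simp
  qed
  thus ?thesis using p(1) pB by blast
qed

text \<open>\<open>kawahara_forward_solution\<close> speaks about all smooth approximations of the
  datum; to exploit it, one has to be exhibited.\<close>

lemma smooth_L2_dense:
  fixes f :: "real \<Rightarrow> real"
  assumes f: "f \<in> borel_measurable lebesgue" and B: "\<And>x. \<bar>f x\<bar> \<le> B"
  obtains h :: "nat \<Rightarrow> real \<Rightarrow> real" where "\<And>n. torus_smooth (h n)"
    "(\<lambda>n. L2_norm_torus (\<lambda>x. h n x - f x)) \<longlonglongrightarrow> 0"
proof -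
  let ?T = "{0..2 * pi}"
  obtain p :: "nat \<Rightarrow> real \<Rightarrow> real" where p: "\<And>n. trig_poly (\<lambda>x. of_real (p n x))"
    "\<And>n x. x \<in> ?T \<Longrightarrow> \<bar>p n x\<bar> \<le> B + 1"
    "AE x in lebesgue. x \<in> ?T \<longrightarrow> (\<lambda>n. p n x) \<longlonglongrightarrow> f x"
    using trig_poly_approx_bounded_measurable[OF f B] by blast
  have [measurable]: "f \<in> borel_measurable lebesgue" by (rule f)
  have [measurable]: "p n \<in> borel_measurable lebesgue" for n
  proof -
    have "continuous_on UNIV (\<lambda>x. Re (complex_of_real (p n x)))"
      by (intro continuous_intros trig_poly_continuous p)
    hence "p n \<in> borel_measurable borel"
      by (intro borel_measurable_continuous_onI) simp
    thus ?thesis by (intro measurable_completion) simp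
  qed
  have T[measurable]: "?T \<in> sets lebesgue" by simp
  have "(\<lambda>n. \<integral>x. indicator ?T x *\<^sub>R (p n x - f x)\<^sup>2 \<partial>lebesgue) \<longlonglongrightarrow> (\<integral>x. 0 \<partial>(lebesgue :: real measure))"
  proof (rule integral_dominated_convergence[where w = "\<lambda>x. indicator ?T x *\<^sub>R (2 * B + 1)\<^sup>2"])
    have "set_integrable lebesgue ?T (\<lambda>x. (2 * B + 1)\<^sup>2)"
      by (intro absolutely_integrable_continuous_real continuous_intros)
    thus "integrable lebesgue (\<lambda>x. indicator ?T x *\<^sub>R (2 * B + 1)\<^sup>2)"
      by (simp add: set_integrable_def)
    show "AE x in lebesgue. (\<lambda>n. indicator ?T x *\<^sub>R (p n x - f x)\<^sup>2) \<longlonglongrightarrow> 0"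
      using p(3)
    proof (rule eventually_mono)
      fix x assume *: "x \<in> ?T \<longrightarrow> (\<lambda>n. p n x) \<longlonglongrightarrow> f x"
      show "(\<lambda>n. indicator ?T x *\<^sub>R (p n x - f x)\<^sup>2) \<longlonglongrightarrow> 0"
      proof (cases "x \<in> ?T")
        case True
        hence "(\<lambda>n. (p n x - f x)\<^sup>2) \<longlonglongrightarrow> (f x - f x)\<^sup>2" using * by (intro tendsto_intros) auto
        thus ?thesis using True by simp
      qed simp
    qed
    show "AE x in lebesgue. norm (indicator ?T x *\<^sub>R (p n x - f x)\<^sup>2) \<le> indicator ?T x *\<^sub>R (2 * B + 1)\<^sup>2" for n
    proof (rule AE_I2)
      fix x :: real
      show "norm (indicator ?T x *\<^sub>R (p n x - f x)\<^sup>2) \<le> indicator ?T x *\<^sub>R (2 * B + 1)\<^sup>2"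
      proof (cases "x \<in> ?T")
        case True
        have "\<bar>p n x - f x\<bar> \<le> 2 * B + 1" using p(2)[OF True, of n] B[of x] by linarith
        hence "\<bar>p n x - f x\<bar>\<^sup>2 \<le> (2 * B + 1)\<^sup>2" by (intro power_mono) auto
        thus ?thesis using True by simp
      qed simp
    qed
  qed measurable
  hence "(\<lambda>n. sqrt (\<integral>x. indicator ?T x *\<^sub>R (p n x - f x)\<^sup>2 \<partial>lebesgue)) \<longlonglongrightarrow> sqrt 0"
    by (intro tendsto_real_sqrt) simp
  hence "(\<lambda>n. L2_norm_torus (\<lambda>x. p n x - f x)) \<longlonglongrightarrow> 0"
    by (simp add: L2_norm_torus_def set_lebesgue_integral_def)
  thus thesis using that[of p] trig_poly_smooth[OF p(1)] by blast
qed

text \<open>By linearity \<open>d\<close> is orthogonal to all trigonometric polynomials, and these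
  approximate the sign of its real part boundedly and almost everywhere. In the limit the integral
  of |Re d| is 0. The imaginary part is reached by applying the lemma to
  \<open>\<i> * d\<close>.\<close>

lemma fourier_uniqueness:
  fixes d :: "real \<Rightarrow> complex"
  assumes d: "set_integrable lebesgue {0..2 * pi} d"
    and zero: "\<And>k :: int. (LINT x:{0..2 * pi}|lebesgue. cis (of_int k * x) * d x) = 0"
  shows "AE x in lebesgue. x \<in> {0..2 * pi} \<longrightarrow> Re (d x) = 0"
proof -
  let ?T = "{0..2 * pi}"
  define D where "D x = indicator ?T x *\<^sub>R d x" for x
  have D: "integrable lebesgue D" using d by (simp add: D_def[abs_def] set_integrable_def)
  have [measurable]: "D \<in> borel_measurable lebesgue" using D by (rule borel_measurable_integrable)
  have bint: "integrable lebesgue (\<lambda>x. F x * D x)"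
    if "F \<in> borel_measurable lebesgue" "\<And>x. x \<in> ?T \<Longrightarrow> cmod (F x) \<le> K" for F K
  proof (rule Bochner_Integration.integrable_bound[where f = "\<lambda>x. of_real K * D x"])
    show "integrable lebesgue (\<lambda>x. of_real K * D x)" using D by simp
    show "(\<lambda>x. F x * D x) \<in> borel_measurable lebesgue" using that(1) by measurable
    show "AE x in lebesgue. norm (F x * D x) \<le> norm (complex_of_real K * D x)"
    proof (rule AE_I2)
      fix x :: real
      show "norm (F x * D x) \<le> norm (complex_of_real K * D x)"
        using that(2)[of x] order_trans[OF norm_ge_zero that(2)[of x]]
        by (cases "x \<in> ?T") (auto simp: D_def norm_mult intro!: mult_right_mono)
    qed
  qed
  have tp: "integrable lebesgue (\<lambda>x. P x * D x) \<and> (\<integral>x. P x * D x \<partial>lebesgue) = 0" if "trig_poly P" for P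
    using that
  proof induction
    case (trig_poly_monom c k)
    have "(\<lambda>x. c * cis (of_int k * x)) \<in> borel_measurable borel"
      by (intro borel_measurable_continuous_onI continuous_intros)
    hence "integrable lebesgue (\<lambda>x. c * cis (of_int k * x) * D x)"
      by (intro bint[where K = "cmod c"]) (auto simp: norm_mult intro: measurable_completion)
    moreover have "(\<integral>x. c * cis (of_int k * x) * D x \<partial>lebesgue)
        = c * (LINT x:?T|lebesgue. cis (of_int k * x) * d x)"
      unfolding set_lebesgue_integral_def D_def
      by (subst integral_mult_right_zero[symmetric]) (simp add: mult_ac)
    ultimately show ?case using zero by simp
  next
    case (trig_poly_add p q)
    thus ?case by (auto simp: distrib_right)
  qed
  define s where "s x = sgn (Re (D x))" for x
  have s[measurable]: "s \<in> borel_measurable lebesgue" unfolding s_def[abs_def] by measurable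
  have s1: "\<bar>s x\<bar> \<le> 1" for x by (simp add: s_def sgn_real_def)
  obtain p :: "nat \<Rightarrow> real \<Rightarrow> real" where p: "\<And>n. trig_poly (\<lambda>x. of_real (p n x))"
    "\<And>n x. x \<in> ?T \<Longrightarrow> \<bar>p n x\<bar> \<le> 1 + 1"
    "AE x in lebesgue. x \<in> ?T \<longrightarrow> (\<lambda>n. p n x) \<longlonglongrightarrow> s x"
    using trig_poly_approx_bounded_measurable[OF s s1] by blast
  have "(\<lambda>n. \<integral>x. of_real (p n x) * D x \<partial>lebesgue) \<longlonglongrightarrow> (\<integral>x. of_real (s x) * D x \<partial>lebesgue)"
  proof (rule integral_dominated_convergence[where w = "\<lambda>x. 2 * norm (D x)"])
    show "integrable lebesgue (\<lambda>x. 2 * norm (D x))" using D by simp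
    show "(\<lambda>x. of_real (s x) * D x) \<in> borel_measurable lebesgue" by measurable
    show "(\<lambda>x. of_real (p n x) * D x) \<in> borel_measurable lebesgue" for n
      using tp[OF p(1)] by (intro borel_measurable_integrable) blast
    show "AE x in lebesgue. (\<lambda>n. of_real (p n x) * D x) \<longlonglongrightarrow> of_real (s x) * D x"
      using p(3)
    proof (rule eventually_mono)
      fix x assume *: "x \<in> ?T \<longrightarrow> (\<lambda>n. p n x) \<longlonglongrightarrow> s x"
      thus "(\<lambda>n. of_real (p n x) * D x) \<longlonglongrightarrow> of_real (s x) * D x"
        by (cases "x \<in> ?T") (auto simp: D_def intro!: tendsto_intros)
    qed
    show "AE x in lebesgue. norm (of_real (p n x) * D x) \<le> 2 * norm (D x)" for n
    proof (rule AE_I2)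
      fix x :: real
      show "norm (of_real (p n x) * D x) \<le> 2 * norm (D x)"
        using p(2)[of x n] by (cases "x \<in> ?T") (auto simp: D_def norm_mult intro!: mult_right_mono)
    qed
  qed
  hence "(\<integral>x. of_real (s x) * D x \<partial>lebesgue) = 0"
    using tp[OF p(1)] LIMSEQ_unique[OF _ tendsto_const] by fastforce
  hence "Re (\<integral>x. of_real (s x) * D x \<partial>lebesgue) = 0" by simp
  moreover have "integrable lebesgue (\<lambda>x. of_real (s x) * D x)"
    by (rule bint[where K = 1]) (auto simp: s_def sgn_real_def)
  ultimately have "(\<integral>x. Re (of_real (s x) * D x) \<partial>lebesgue) = 0"
    by (subst integral_Re) auto
  moreover have "Re (of_real (s x) * D x) = \<bar>Re (D x)\<bar>" for x
    by (auto simp: s_def sgn_real_def)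
  ultimately have "(\<integral>x. \<bar>Re (D x)\<bar> \<partial>lebesgue) = 0" by simp
  moreover have "integrable lebesgue (\<lambda>x. \<bar>Re (D x)\<bar>)" using D by auto
  ultimately have "AE x in lebesgue. \<bar>Re (D x)\<bar> = 0"
    by (subst integral_nonneg_eq_0_iff_AE[symmetric]) auto
  thus ?thesis
    by (rule eventually_mono) (auto simp: D_def)
qed

section \<open>Fourier coefficients on one period: orthogonality, Bessel's inequality,
  convolution\<close>

lemma fourier_coeff_cis:
  "fourier_coeff f k = (LINT x:{0..2 * pi}|lebesgue. cis (- (of_int k * x)) * of_real (f x)) / (2 * pi)"
proof -
  have "exp (- \<i> * of_int k * of_real x) = cis (- (of_int k * x))" for x
    by (simp add: cis_conv_exp mult.assoc)
  thus ?thesis by (simp add: fourier_coeff_def)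
qed

lemma set_integral_continuous:
  fixes f :: "real \<Rightarrow> 'a::euclidean_space"
  assumes "continuous_on {a..b} f"
  shows "(LINT x:{a..b}|lebesgue. f x) = integral {a..b} f"
  by (rule set_lebesgue_integral_eq_integral(2)[OF absolutely_integrable_continuous_real[OF assms]])

lemma fourier_coeff_continuous:
  assumes "continuous_on {0..2 * pi} f"
  shows "fourier_coeff f k = integral {0..2 * pi} (\<lambda>x. cis (- (of_int k * x)) * of_real (f x)) / (2 * pi)"
  unfolding fourier_coeff_cis
  by (subst set_integral_continuous) (auto intro!: continuous_intros assms)

lemma has_integral_fourier_coeff:
  assumes "continuous_on {0..2 * pi} f"
  shows "((\<lambda>x. cis (- (of_int k * x)) * of_real (f x)) has_integral 2 * pi * fourier_coeff f k) {0..2 * pi}"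
proof -
  have "(\<lambda>x. cis (- (of_int k * x)) * of_real (f x)) integrable_on {0..2 * pi}"
    by (intro integrable_continuous_real continuous_intros assms)
  thus ?thesis by (simp add: has_integral_iff fourier_coeff_continuous[OF assms])
qed

lemma set_integrable_cis_mult:
  fixes f :: "real \<Rightarrow> complex"
  assumes "set_integrable lebesgue {0..2 * pi} f"
  shows "set_integrable lebesgue {0..2 * pi} (\<lambda>x. cis (of_int k * x) * f x)"
proof -
  have c: "continuous_on {0..2 * pi} (\<lambda>x. cis (of_int k * x))" by (intro continuous_intros)
  have 1: "(\<lambda>x. cis (of_int k * x)) \<in> borel_measurable (lebesgue_on {0..2 * pi})"
    using c by (intro continuous_imp_measurable_on_sets_lebesgue) auto
  have 2: "bounded ((\<lambda>x. cis (of_int k * x)) ` {0..2 * pi})"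
    by (rule boundedI[of _ 1]) auto
  have 3: "{0..2 * pi} \<in> sets lebesgue" by simp
  show ?thesis
    by (rule absolutely_integrable_bounded_measurable_product[OF bilinear_times 1 3 2 assms])
qed

lemma fourier_coeff_diff:
  assumes "set_integrable lebesgue {0..2 * pi} f" "set_integrable lebesgue {0..2 * pi} g"
  shows "fourier_coeff (\<lambda>x. f x - g x) k = fourier_coeff f k - fourier_coeff g k"
proof -
  have c: "set_integrable lebesgue {0..2 * pi} (\<lambda>x. cis (- (of_int k * x)) * of_real (h x))"
    if "set_integrable lebesgue {0..2 * pi} h" for h
  proof -
    have "set_integrable lebesgue {0..2 * pi} (\<lambda>x. complex_of_real (h x))"
      using that by (simp add: set_integrable_def scaleR_conv_of_real flip: of_real_mult)
    from set_integrable_cis_mult[OF this, of "- k"] show ?thesis by simp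
  qed
  show ?thesis
    unfolding fourier_coeff_cis of_real_diff right_diff_distrib
    by (subst set_integral_diff(2)[OF c[OF assms(1)] c[OF assms(2)]]) (simp add: diff_divide_distrib)
qed

lemma has_integral_cis:
  "((\<lambda>x. cis (of_int m * x)) has_integral (if m = 0 then 2 * pi else 0)) {0..2 * pi}"
proof (cases "m = 0")
  case True
  have "((\<lambda>x. 1 :: complex) has_integral (2 * pi - 0) *\<^sub>R 1) {0..2 * pi}"
    using has_integral_const_real[of "1 :: complex" 0 "2 * pi"] by simp
  thus ?thesis using True by (simp add: scaleR_conv_of_real)
next
  case False
  have "((\<lambda>x. cis (of_int m * x) / (\<i> * of_int m)) has_vector_derivative cis (of_int m * x)) (at x within {0..2 * pi})" for x
    using has_vector_derivative_divide[OF has_vector_derivative_cis_mult[of "of_int m" x "{0..2 * pi}"], of "\<i> * of_int m"] False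
    by simp
  hence "((\<lambda>x. cis (of_int m * x)) has_integral
      cis (of_int m * (2 * pi)) / (\<i> * of_int m) - cis (of_int m * 0) / (\<i> * of_int m)) {0..2 * pi}"
    by (intro fundamental_theorem_of_calculus) auto
  thus ?thesis using False cis_int_shift[of m 0] by simp
qed

text \<open>The integral of |f - S|^2 is nonnegative, \<open>S\<close> being the partial sum over
  \<open>A\<close>. By orthogonality the two mixed terms and the square of \<open>S\<close> all
  integrate to 2 pi \<open>Q\<close>, so that the whole integral is that of f^2 minus 2 pi
  \<open>Q\<close>.\<close>

lemma bessel_inequality:
  assumes f: "continuous_on {0..2 * pi} f" and A: "finite A"
  shows "(\<Sum>k\<in>A. (cmod (fourier_coeff f k))\<^sup>2) \<le> integral {0..2 * pi} (\<lambda>x. (f x)\<^sup>2) / (2 * pi)"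
proof -
  let ?T = "{0..2 * pi}"
  define c where "c = fourier_coeff f"
  define S where "S x = (\<Sum>k\<in>A. c k * cis (of_int k * x))" for x
  have ci: "((\<lambda>x. cis (- (of_int k * x)) * of_real (f x)) has_integral 2 * pi * c k) ?T" for k
    unfolding c_def by (rule has_integral_fourier_coeff[OF f])
  define Q where "Q = (\<Sum>k\<in>A. (cmod (c k))\<^sup>2)"
  have cQ: "complex_of_real Q = (\<Sum>k\<in>A. cnj (c k) * c k)"
    unfolding Q_def of_real_sum complex_norm_square by (simp add: mult.commute)
  have 1: "((\<lambda>x. cnj (S x) * of_real (f x)) has_integral 2 * pi * Q) ?T"
  proof -
    have "((\<lambda>x. \<Sum>k\<in>A. cnj (c k) * (cis (- (of_int k * x)) * of_real (f x)))
        has_integral (\<Sum>k\<in>A. cnj (c k) * (2 * pi * c k))) ?T"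
      by (intro has_integral_sum A has_integral_mult_right ci)
    moreover have "(\<lambda>x. \<Sum>k\<in>A. cnj (c k) * (cis (- (of_int k * x)) * of_real (f x)))
        = (\<lambda>x. cnj (S x) * of_real (f x))"
      unfolding S_def cnj_sum sum_distrib_right
      by (intro ext sum.cong refl) (simp add: cis_cnj mult_ac)
    moreover have "(\<Sum>k\<in>A. cnj (c k) * (2 * pi * c k)) = 2 * pi * complex_of_real Q"
      unfolding cQ by (simp add: sum_distrib_left mult_ac)
    ultimately show ?thesis by simp
  qed
  have 2: "((\<lambda>x. cnj (S x) * S x) has_integral 2 * pi * Q) ?T"
  proof -
    have "((\<lambda>x. \<Sum>j\<in>A. \<Sum>k\<in>A. cnj (c j) * c k * cis (of_int (k - j) * x))
        has_integral (\<Sum>j\<in>A. \<Sum>k\<in>A. cnj (c j) * c k * (if k - j = 0 then 2 * pi else 0))) ?T"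
      by (intro has_integral_sum A has_integral_mult_right has_integral_cis)
    moreover have "(\<lambda>x. \<Sum>j\<in>A. \<Sum>k\<in>A. cnj (c j) * c k * cis (of_int (k - j) * x))
        = (\<lambda>x. cnj (S x) * S x)"
      unfolding S_def cnj_sum sum_product
      by (intro ext sum.cong refl) (simp add: cis_cnj cis_mult algebra_simps)
    moreover have "(\<Sum>j\<in>A. \<Sum>k\<in>A. cnj (c j) * c k * (if k - j = 0 then 2 * pi else 0))
        = 2 * pi * complex_of_real Q"
    proof -
      have "(\<Sum>k\<in>A. cnj (c j) * c k * (if k - j = 0 then 2 * pi else 0)) = 2 * pi * (cnj (c j) * c j)"
        if "j \<in> A" for j
      proof -
        have "(\<Sum>k\<in>A. cnj (c j) * c k * (if k - j = 0 then 2 * pi else 0))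
            = (\<Sum>k\<in>A. if k = j then 2 * pi * (cnj (c j) * c j) else 0)"
          by (intro sum.cong refl) auto
        thus ?thesis using that A by simp
      qed
      thus ?thesis unfolding cQ sum_distrib_left by simp
    qed
    ultimately show ?thesis by simp
  qed
  have 3: "((\<lambda>x. of_real (f x) * of_real (f x)) has_integral complex_of_real (integral ?T (\<lambda>x. (f x)\<^sup>2))) ?T"
  proof -
    have "((\<lambda>x. (f x)\<^sup>2) has_integral integral ?T (\<lambda>x. (f x)\<^sup>2)) ?T"
      by (intro integrable_integral integrable_continuous_real continuous_intros f)
    hence "((complex_of_real \<circ> (\<lambda>x. (f x)\<^sup>2)) has_integral complex_of_real (integral ?T (\<lambda>x. (f x)\<^sup>2))) ?T"
      by (rule has_integral_linear[OF _ bounded_linear_of_real])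
    thus ?thesis by (simp add: o_def power2_eq_square)
  qed
  have "((\<lambda>x. cnj (cnj (S x) * of_real (f x))) has_integral cnj (2 * pi * Q)) ?T"
    using 1 has_integral_cnj[of "\<lambda>x. cnj (S x) * of_real (f x)" "2 * pi * Q" ?T]
    by (simp only: o_def)
  hence 4: "((\<lambda>x. S x * of_real (f x)) has_integral 2 * pi * Q) ?T" by simp
  let ?I = "integral ?T (\<lambda>x. (f x)\<^sup>2)"
  have "((\<lambda>x. (of_real (f x) * of_real (f x) - cnj (S x) * of_real (f x)) - (S x * of_real (f x) - cnj (S x) * S x))
      has_integral (complex_of_real ?I - complex_of_real (2 * pi * Q))
        - (complex_of_real (2 * pi * Q) - complex_of_real (2 * pi * Q))) ?T"
    by (intro has_integral_diff 1 2 3 4)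
  from has_integral_linear[OF this bounded_linear_Re] have "((\<lambda>x. Re ((of_real (f x) * of_real (f x) - cnj (S x) * of_real (f x)) - (S x * of_real (f x) - cnj (S x) * S x)))
      has_integral Re ((complex_of_real ?I - complex_of_real (2 * pi * Q))
        - (complex_of_real (2 * pi * Q) - complex_of_real (2 * pi * Q)))) ?T"
    by (simp only: o_def)
  moreover have "Re ((of_real (f x) * of_real (f x) - cnj (S x) * of_real (f x)) - (S x * of_real (f x) - cnj (S x) * S x))
      = (f x - Re (S x))\<^sup>2 + (Im (S x))\<^sup>2" for x
    by (simp add: power2_eq_square algebra_simps)
  ultimately have "((\<lambda>x. (f x - Re (S x))\<^sup>2 + (Im (S x))\<^sup>2) has_integral ?I - 2 * pi * Q) ?T"
    by simp
  hence "0 \<le> ?I - 2 * pi * Q" by (rule has_integral_nonneg) auto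
  thus ?thesis by (simp add: Q_def c_def field_simps)
qed

lemma continuous_AE_zero:
  fixes d :: "real \<Rightarrow> complex"
  assumes d: "continuous_on {0..2 * pi} d" and "AE x in lebesgue. x \<in> {0..2 * pi} \<longrightarrow> d x = 0"
    and x: "x \<in> {0..2 * pi}"
  shows "d x = 0"
proof -
  have "integral {0..2 * pi} (\<lambda>x. cmod (d x)) = (LINT x:{0..2 * pi}|lebesgue. cmod (d x))"
    by (intro set_integral_continuous[symmetric] continuous_intros d)
  also have "\<dots> = 0"
    unfolding set_lebesgue_integral_def
    by (rule integral_eq_zero_AE) (use assms(2) in \<open>auto elim!: eventually_mono simp: indicator_def\<close>)
  finally have "\<forall>x\<in>{0..2 * pi}. cmod (d x) = 0"
    by (subst (asm) integral_eq_0_iff) (auto intro!: continuous_intros d)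
  thus ?thesis using x by simp
qed

text \<open>Quadratic decay makes the symmetric partial sums uniformly Cauchy. Their continuous
  limit has the coefficients of \<open>f\<close>, so uniqueness identifies the two almost everywhere
  and then, by continuity, on the whole closed period.\<close>

lemma fourier_partial_sum_uniform:
  assumes f: "continuous_on {0..2 * pi} f"
    and C: "\<And>k. k \<noteq> 0 \<Longrightarrow> cmod (fourier_coeff f k) \<le> C / (of_int k)\<^sup>2"
    and n: "n \<ge> 1" and x: "x \<in> {0..2 * pi}"
  shows "cmod (of_real (f x) - (\<Sum>k\<in>{- int n..int n}. fourier_coeff f k * cis (of_int k * x))) \<le> 2 * C / real n"
proof -
  let ?T = "{0..2 * pi}"
  define c where "c = fourier_coeff f"
  define S where "S n x = (\<Sum>k\<in>{- int n..int n}. c k * cis (of_int k * x))" for n x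
  have Sc: "continuous_on ?T (S n)" for n unfolding S_def by (intro continuous_intros)
  have C0: "C \<ge> 0" using C[of 1] order_trans[OF norm_ge_zero] by fastforce
  have step: "cmod (S (Suc n) x - S n x) \<le> 2 * C * (1 / real n - 1 / real (Suc n))" if n: "n \<ge> 1" for n x
  proof -
    have "{- int (Suc n)..int (Suc n)} = insert (int (Suc n)) (insert (- int (Suc n)) {- int n..int n})"
      by auto
    hence "S (Suc n) x - S n x = c (int (Suc n)) * cis (of_int (int (Suc n)) * x)
        + c (- int (Suc n)) * cis (of_int (- int (Suc n)) * x)"
      unfolding S_def by (simp del: of_nat_Suc)
    hence "cmod (S (Suc n) x - S n x) \<le> cmod (c (int (Suc n))) + cmod (c (- int (Suc n)))"
      by (metis norm_cis norm_mult norm_triangle_ineq mult.right_neutral)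
    also have "\<dots> \<le> C / (real (Suc n))\<^sup>2 + C / (real (Suc n))\<^sup>2"
    proof (rule add_mono)
      show "cmod (c (int (Suc n))) \<le> C / (real (Suc n))\<^sup>2"
        using C[of "int (Suc n)"] by (simp add: c_def del: of_nat_Suc)
      show "cmod (c (- int (Suc n))) \<le> C / (real (Suc n))\<^sup>2"
        using C[of "- int (Suc n)"] by (simp add: c_def del: of_nat_Suc)
    qed
    also have "\<dots> = 2 * C * (1 / (real (Suc n))\<^sup>2)" by simp
    \<comment> \<open>Comparison with 1 / (n (n + 1)), which makes the increments telescope.\<close>
    also have "1 / (real (Suc n))\<^sup>2 \<le> 1 / real n - 1 / real (Suc n)"
      using n by (simp add: divide_simps power2_eq_square)
    finally show ?thesis using C0 by (simp add: mult_left_mono)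
  qed
  have tele: "cmod (S (n + m) x - S n x) \<le> 2 * C * (1 / real n - 1 / real (n + m))" if n: "n \<ge> 1" for n m x
  proof (induction m)
    case (Suc m)
    have "cmod (S (n + Suc m) x - S n x) \<le> cmod (S (Suc (n + m)) x - S (n + m) x) + cmod (S (n + m) x - S n x)"
      using norm_triangle_ineq[of "S (Suc (n + m)) x - S (n + m) x" "S (n + m) x - S n x"] by simp
    also have "\<dots> \<le> 2 * C * (1 / real (n + m) - 1 / real (Suc (n + m))) + 2 * C * (1 / real n - 1 / real (n + m))"
      using n by (intro add_mono step Suc) auto
    also have "\<dots> = 2 * C * (1 / real n - 1 / real (n + Suc m))"
      by (simp add: algebra_simps)
    finally show ?case .
  qed simp
  have cau: "cmod (S m x - S n x) \<le> 2 * C / real n" if "n \<ge> 1" "m \<ge> n" for m n x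
  proof -
    obtain l where l: "m = n + l" using \<open>m \<ge> n\<close> le_Suc_ex by blast
    have "cmod (S m x - S n x) \<le> 2 * C * (1 / real n - 1 / real m)" unfolding l by (rule tele[OF that(1)])
    also have "\<dots> \<le> 2 * C * (1 / real n)" using C0 by (intro mult_left_mono) auto
    finally show ?thesis by simp
  qed
  have lim0: "(\<lambda>n. 2 * C / real n) \<longlonglongrightarrow> 0" by (rule lim_const_over_n)
  have "convergent (\<lambda>n. S n x)" for x
  proof (rule Cauchy_convergent, rule CauchyI')
    fix e :: real assume "e > 0"
    from order_tendstoD(2)[OF lim0 this] obtain N where N: "\<And>n. n \<ge> N \<Longrightarrow> 2 * C / real n < e"
      unfolding eventually_sequentially by blast
    show "\<exists>M. \<forall>m\<ge>M. \<forall>n>m. dist (S m x) (S n x) < e"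
    proof (intro exI[of _ "max N 1"] allI impI)
      fix m n assume mn: "max N 1 \<le> m" "m < n"
      hence "cmod (S n x - S m x) \<le> 2 * C / real m" by (intro cau) auto
      also have "\<dots> < e" using N mn by simp
      finally show "dist (S m x) (S n x) < e" by (simp add: dist_norm norm_minus_commute)
    qed
  qed
  then obtain W where W: "\<And>x. (\<lambda>n. S n x) \<longlonglongrightarrow> W x" unfolding convergent_def by metis
  have WS: "cmod (W x - S n x) \<le> 2 * C / real n" if "n \<ge> 1" for n x
  proof (rule tendsto_upperbound)
    show "(\<lambda>m. cmod (S m x - S n x)) \<longlonglongrightarrow> cmod (W x - S n x)" by (intro tendsto_intros W)
    show "\<forall>\<^sub>F m in sequentially. cmod (S m x - S n x) \<le> 2 * C / real n"
      using cau[OF that] unfolding eventually_sequentially by blast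
  qed simp
  have "uniform_limit ?T S W sequentially"
    unfolding uniform_limit_sequentially_iff
  proof (intro allI impI)
    fix e :: real assume "e > 0"
    from order_tendstoD(2)[OF lim0 this] obtain N where N: "\<And>n. n \<ge> N \<Longrightarrow> 2 * C / real n < e"
      unfolding eventually_sequentially by blast
    show "\<exists>N. \<forall>n\<ge>N. \<forall>x\<in>?T. dist (S n x) (W x) < e"
    proof (intro exI[of _ "max N 1"] allI impI ballI)
      fix n x assume "max N 1 \<le> n"
      thus "dist (S n x) (W x) < e"
        using WS[of n x] N[of n] by (simp add: dist_norm norm_minus_commute)
    qed
  qed
  hence Wc: "continuous_on ?T W"
    by (rule uniform_limit_theorem[rotated]) (auto intro!: always_eventually Sc)
  define d where "d x = of_real (f x) - W x" for x
  have dc: "continuous_on ?T d" unfolding d_def by (intro continuous_intros f Wc)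
  have dz: "integral ?T (\<lambda>x. cis (of_int k * x) * d x) = 0" for k
  proof -
    have int: "(\<lambda>x. cis (of_int k * x) * g x) integrable_on ?T" if "continuous_on ?T g" for g :: "real \<Rightarrow> complex"
      using that by (intro integrable_continuous_real continuous_intros)
    have b: "cmod (integral ?T (\<lambda>x. cis (of_int k * x) * d x)) \<le> 2 * pi * (2 * C / real n)"
      if n: "n \<ge> 1" "n \<ge> nat \<bar>k\<bar>" for n
    proof -
      have "((\<lambda>x. \<Sum>j\<in>{- int n..int n}. c j * cis (of_int (j + k) * x)) has_integral
          (\<Sum>j\<in>{- int n..int n}. c j * (if j + k = 0 then 2 * pi else 0))) ?T"
        by (intro has_integral_sum has_integral_mult_right has_integral_cis) auto
      moreover have "(\<lambda>x. \<Sum>j\<in>{- int n..int n}. c j * cis (of_int (j + k) * x)) = (\<lambda>x. cis (of_int k * x) * S n x)"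
        unfolding S_def sum_distrib_left by (intro ext sum.cong refl) (simp add: cis_mult algebra_simps)
      moreover have "(\<Sum>j\<in>{- int n..int n}. c j * (if j + k = 0 then 2 * pi else 0)) = 2 * pi * c (- k)"
      proof -
        have "(\<Sum>j\<in>{- int n..int n}. c j * (if j + k = 0 then 2 * pi else 0))
            = (\<Sum>j\<in>{- int n..int n}. if j = - k then 2 * pi * c (- k) else 0)"
          by (intro sum.cong refl) auto
        moreover have "- k \<in> {- int n..int n}" using n by auto
        ultimately show ?thesis by (simp only: sum.delta[OF finite_atLeastAtMost_int] if_True)
      qed
      ultimately have "integral ?T (\<lambda>x. cis (of_int k * x) * S n x) = 2 * pi * c (- k)"
        by (simp add: integral_unique)
      also have "\<dots> = integral ?T (\<lambda>x. cis (of_int k * x) * of_real (f x))"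
        by (simp add: c_def fourier_coeff_continuous[OF f])
      finally have "integral ?T (\<lambda>x. cis (of_int k * x) * d x)
          = integral ?T (\<lambda>x. cis (of_int k * x) * (S n x - W x))"
        unfolding d_def right_diff_distrib
        by (simp add: integral_diff int Sc Wc f continuous_on_of_real)
      also have "cmod \<dots> \<le> 2 * C / real n * (2 * pi - 0)"
      proof (rule integral_bound)
        show "continuous_on ?T (\<lambda>x. cis (of_int k * x) * (S n x - W x))"
          by (intro continuous_intros Sc Wc)
        show "cmod (cis (of_int k * x) * (S n x - W x)) \<le> 2 * C / real n" for x
          using WS[OF n(1), of x] by (simp add: norm_mult norm_minus_commute)
      qed simp
      finally show ?thesis by (simp add: mult_ac)
    qed
    have "(\<lambda>n. 2 * pi * (2 * C / real n)) \<longlonglongrightarrow> 2 * pi * 0" by (intro tendsto_intros lim0)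
    hence "cmod (integral ?T (\<lambda>x. cis (of_int k * x) * d x)) \<le> 2 * pi * 0"
      by (rule tendsto_lowerbound) (use b in \<open>auto simp: eventually_sequentially intro!: exI[of _ "max 1 (nat \<bar>k\<bar>)"]\<close>)
    thus ?thesis by simp
  qed
  have dint: "set_integrable lebesgue ?T d" by (rule absolutely_integrable_continuous_real[OF dc])
  have "AE x in lebesgue. x \<in> ?T \<longrightarrow> Re (d x) = 0"
    by (rule fourier_uniqueness[OF dint])
      (subst set_integral_continuous, auto intro!: continuous_intros dc simp: dz)
  moreover have "AE x in lebesgue. x \<in> ?T \<longrightarrow> Re (\<i> * d x) = 0"
  proof (rule fourier_uniqueness)
    show "set_integrable lebesgue ?T (\<lambda>x. \<i> * d x)" using dint by simp
    have "(\<lambda>x. cis (of_int k * x) * (\<i> * d x)) = (\<lambda>x. \<i> * (cis (of_int k * x) * d x))" for k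
      by (simp add: mult_ac)
    thus "(LINT x:?T|lebesgue. cis (of_int k * x) * (\<i> * d x)) = 0" for k
      by (subst set_integral_continuous) (auto intro!: continuous_intros dc simp: dz)
  qed
  ultimately have "AE x in lebesgue. x \<in> ?T \<longrightarrow> d x = 0"
    by eventually_elim (auto simp: complex_eq_iff)
  hence "d x = 0" by (rule continuous_AE_zero[OF dc _ x])
  hence "of_real (f x) = W x" by (simp add: d_def)
  thus ?thesis using WS[OF n, of x] by (simp add: S_def c_def)
qed

text \<open>The convolution formula with an explicit error. Only one of the two factors of f^2 is
  replaced by its partial sum, so the error is an integral of \<open>f\<close> against a remainder
  of size 2 C / n; accordingly the truncation acts on \<open>j\<close> while \<open>k - j\<close> is
  unrestricted.\<close>

lemma fourier_coeff_square:
  assumes f: "continuous_on {0..2 * pi} f"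
    and C: "\<And>k. k \<noteq> 0 \<Longrightarrow> cmod (fourier_coeff f k) \<le> C / (of_int k)\<^sup>2"
    and B: "\<And>x. x \<in> {0..2 * pi} \<Longrightarrow> \<bar>f x\<bar> \<le> B" and n: "n \<ge> 1"
  shows "cmod (fourier_coeff (\<lambda>x. (f x)\<^sup>2) k
    - (\<Sum>j\<in>{- int n..int n}. fourier_coeff f j * fourier_coeff f (k - j))) \<le> 2 * C * B / real n"
proof -
  let ?T = "{0..2 * pi}"
  let ?c = "fourier_coeff f"
  let ?S = "\<lambda>x. \<Sum>j\<in>{- int n..int n}. ?c j * cis (of_int j * x)"
  let ?F = "\<lambda>x. cis (- (of_int k * x)) * of_real (f x)"
  have B0: "B \<ge> 0" using B[of 0] by simp
  note ci = has_integral_fourier_coeff[OF f]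
  have "((\<lambda>x. \<Sum>j\<in>{- int n..int n}. ?c j * (cis (- (of_int (k - j) * x)) * of_real (f x))) has_integral
      (\<Sum>j\<in>{- int n..int n}. ?c j * (2 * pi * ?c (k - j)))) ?T"
    by (intro has_integral_sum has_integral_mult_right ci) auto
  moreover have "(\<lambda>x. \<Sum>j\<in>{- int n..int n}. ?c j * (cis (- (of_int (k - j) * x)) * of_real (f x)))
      = (\<lambda>x. ?F x * ?S x)"
    unfolding sum_distrib_left
  proof (intro ext sum.cong refl)
    fix x :: real and j :: int
    have "cis (- (of_int (k - j) * x)) = cis (- (of_int k * x)) * cis (of_int j * x)"
      by (simp add: cis_mult algebra_simps)
    thus "?c j * (cis (- (of_int (k - j) * x)) * of_real (f x)) = ?F x * (?c j * cis (of_int j * x))"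
      by (simp add: mult_ac)
  qed
  ultimately have 1: "((\<lambda>x. ?F x * ?S x) has_integral
      2 * pi * (\<Sum>j\<in>{- int n..int n}. ?c j * ?c (k - j))) ?T"
    by (simp add: sum_distrib_left mult_ac)
  have "((\<lambda>x. cis (- (of_int k * x)) * of_real ((f x)\<^sup>2)) has_integral
      2 * pi * fourier_coeff (\<lambda>x. (f x)\<^sup>2) k) ?T"
    by (intro has_integral_fourier_coeff continuous_intros f)
  from has_integral_diff[OF this 1]
  have "((\<lambda>x. ?F x * (of_real (f x) - ?S x)) has_integral 2 * pi * (fourier_coeff (\<lambda>x. (f x)\<^sup>2) k
      - (\<Sum>j\<in>{- int n..int n}. ?c j * ?c (k - j)))) ?T"
    by (simp add: right_diff_distrib power2_eq_square mult_ac)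
  hence eq: "2 * pi * (fourier_coeff (\<lambda>x. (f x)\<^sup>2) k - (\<Sum>j\<in>{- int n..int n}. ?c j * ?c (k - j)))
      = integral ?T (\<lambda>x. ?F x * (of_real (f x) - ?S x))"
    by (simp add: integral_unique)
  have "cmod (integral ?T (\<lambda>x. ?F x * (of_real (f x) - ?S x))) \<le> B * (2 * C / real n) * (2 * pi - 0)"
  proof (rule integral_bound)
    show "continuous_on ?T (\<lambda>x. ?F x * (of_real (f x) - ?S x))" by (intro continuous_intros f)
    show "cmod (?F x * (of_real (f x) - ?S x)) \<le> B * (2 * C / real n)" if x: "x \<in> ?T" for x
      unfolding norm_mult using fourier_partial_sum_uniform[OF f C n x] B[OF x] B0
      by (intro mult_mono) auto
  qed simp
  hence "2 * pi * cmod (fourier_coeff (\<lambda>x. (f x)\<^sup>2) k - (\<Sum>j\<in>{- int n..int n}. ?c j * ?c (k - j)))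
      \<le> 2 * pi * (2 * C * B / real n)"
    unfolding eq[symmetric] norm_mult by (simp add: mult_ac)
  thus ?thesis by (subst (asm) mult_le_cancel_left_pos) auto
qed

lemma L2_imp_set_integrable:
  fixes f :: "real \<Rightarrow> real"
  assumes f: "f \<in> borel_measurable lebesgue" and f2: "set_integrable lebesgue {0..2 * pi} (\<lambda>x. (f x)\<^sup>2)"
  shows "set_integrable lebesgue {0..2 * pi} f"
  unfolding set_integrable_def
proof (rule Bochner_Integration.integrable_bound)
  have "set_integrable lebesgue {0..2 * pi} (\<lambda>x. 1 :: real)"
    by (intro absolutely_integrable_continuous_real continuous_intros)
  from set_integral_add(1)[OF this f2]
  show "integrable lebesgue (\<lambda>x. indicator {0..2 * pi} x *\<^sub>R (1 + (f x)\<^sup>2))"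
    by (simp add: set_integrable_def)
  have [measurable]: "f \<in> borel_measurable lebesgue" by fact
  have [measurable]: "{0..2 * pi} \<in> sets lebesgue" by simp
  show "(\<lambda>x. indicator {0..2 * pi} x *\<^sub>R f x) \<in> borel_measurable lebesgue" by measurable
  have "\<bar>y\<bar> \<le> 1 + y\<^sup>2" for y :: real
    using sum_squares_ge_zero[of "\<bar>y\<bar> - 1" 0] by (simp add: power2_eq_square algebra_simps)
  thus "AE x in lebesgue. norm (indicator {0..2 * pi} x *\<^sub>R f x) \<le> norm (indicator {0..2 * pi} x *\<^sub>R (1 + (f x)\<^sup>2))"
    by (intro AE_I2) (auto simp: indicator_def abs_of_nonneg)
qed

text \<open>Cauchy-Schwarz in the form 2 s |y| <= s^2 + y^2, with \<open>s\<close> slightly above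
  the norm so that dividing by it is legitimate even when the norm is 0. The bound for the integral
  is weakened to 2 pi s, which cancels the normalisation of the coefficient.\<close>

lemma fourier_coeff_le_L2_norm:
  fixes f :: "real \<Rightarrow> real"
  assumes f: "f \<in> borel_measurable lebesgue" and f2: "set_integrable lebesgue {0..2 * pi} (\<lambda>x. (f x)\<^sup>2)"
  shows "cmod (fourier_coeff f k) \<le> L2_norm_torus f"
proof (rule field_le_epsilon)
  fix e :: real assume e: "e > 0"
  let ?T = "{0..2 * pi}"
  let ?N = "L2_norm_torus f"
  define s where "s = ?N + e"
  have I0: "0 \<le> (LINT x:?T|lebesgue. (f x)\<^sup>2)"
    unfolding set_lebesgue_integral_def by (intro integral_nonneg_AE AE_I2) auto
  have N: "?N\<^sup>2 = (LINT x:?T|lebesgue. (f x)\<^sup>2)" "?N \<ge> 0"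
    using I0 by (auto simp: L2_norm_torus_def)
  have s: "s > 0" "?N \<le> s" using e N by (auto simp: s_def)
  have one: "set_integrable lebesgue ?T (\<lambda>x. s)"
    by (intro absolutely_integrable_continuous_real continuous_intros)
  have fi: "set_integrable lebesgue ?T f" by (rule L2_imp_set_integrable[OF f f2])
  have "cmod (LINT x:?T|lebesgue. cis (- (of_int k * x)) * of_real (f x))
      \<le> (LINT x:?T|lebesgue. \<bar>f x\<bar>)"
    using integral_norm_bound[of lebesgue "\<lambda>x. indicator ?T x *\<^sub>R (cis (- (of_int k * x)) * of_real (f x))"]
    by (simp add: set_lebesgue_integral_def norm_mult)
  also have "\<dots> \<le> (LINT x:?T|lebesgue. (s + (f x)\<^sup>2 / s) / 2)"
  proof (rule set_integral_mono)
    show "set_integrable lebesgue ?T (\<lambda>x. (s + (f x)\<^sup>2 / s) / 2)"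
      using one f2 by (intro set_integrable_divide set_integral_add(1)) auto
    show "set_integrable lebesgue ?T (\<lambda>x. \<bar>f x\<bar>)" using fi by (rule set_integrable_abs)
    have "0 \<le> (\<bar>f x\<bar> - s)\<^sup>2" for x by simp
    thus "\<bar>f x\<bar> \<le> (s + (f x)\<^sup>2 / s) / 2" for x
      using s(1) by (simp add: field_simps power2_eq_square)
  qed
  also have "\<dots> = (2 * pi * s + ?N\<^sup>2 / s) / 2"
  proof -
    have "(LINT x:?T|lebesgue. s) = 2 * pi * s"
      by (subst set_integral_continuous) auto
    thus ?thesis using one f2 by (simp add: set_integral_add N(1))
  qed
  also have "\<dots> \<le> (2 * pi * s + s) / 2"
  proof -
    have "?N\<^sup>2 \<le> s\<^sup>2" using s N by (intro power_mono)
    hence "?N\<^sup>2 / s \<le> s" using s(1) by (simp add: pos_divide_le_eq power2_eq_square)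
    thus ?thesis by (intro divide_right_mono add_left_mono) auto
  qed
  also have "\<dots> \<le> 2 * pi * s"
  proof -
    have "1 * s \<le> 2 * pi * s" using s pi_gt3 by (intro mult_right_mono) auto
    thus ?thesis by simp
  qed
  finally have "cmod (fourier_coeff f k) \<le> s"
    unfolding fourier_coeff_cis by (simp add: norm_divide norm_mult pos_divide_le_eq mult_ac)
  thus "cmod (fourier_coeff f k) \<le> ?N + e" by (simp add: s_def)
qed

section \<open>Weyl sums for almost every time\<close>

definition exp_sum :: "(int \<Rightarrow> real) \<Rightarrow> int \<Rightarrow> int \<Rightarrow> complex" where
  "exp_sum \<phi> a b = (\<Sum>k\<in>{a..<b}. cis (\<phi> k))"

definition fdiff :: "int \<Rightarrow> (int \<Rightarrow> real) \<Rightarrow> int \<Rightarrow> real" where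
  "fdiff h \<phi> k = \<phi> (k + h) - \<phi> k"

text \<open>Uniform over all intervals of at most \<open>N\<close> integers, because differencing
  replaces an interval by one that depends on the shift. The power \<open>p\<close> is carried along
  so that roots are taken only at the very end.\<close>

definition weyl_bound :: "nat \<Rightarrow> nat \<Rightarrow> (int \<Rightarrow> real) \<Rightarrow> real \<Rightarrow> bool" where
  "weyl_bound N p \<phi> B \<longleftrightarrow> (\<forall>a b. b - a \<le> int N \<longrightarrow> cmod (exp_sum \<phi> a b) ^ p \<le> B)"

text \<open>The square is expanded into a double sum and grouped by the difference h of the two
  indices. Two indices differ by less than \<open>N\<close>, and those \<open>k\<close> for which
  both \<open>k\<close> and \<open>k + h\<close> lie in the interval form an interval again.\<close>

lemma van_der_corput:
  assumes "b - a \<le> int N"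
  shows "cmod (exp_sum \<phi> a b) ^ 2
    \<le> (\<Sum>h\<in>{- int N<..<int N}. cmod (exp_sum (fdiff h \<phi>) (max a (a - h)) (min b (b - h))))"
proof -
  have inner: "(\<Sum>m\<in>{a..<b}. cis (\<phi> m - \<phi> k))
      = (\<Sum>h\<in>{- int N<..<int N}. if k + h \<in> {a..<b} then cis (fdiff h \<phi> k) else 0)"
    if k: "k \<in> {a..<b}" for k
  proof -
    have "(\<Sum>h\<in>{- int N<..<int N}. if k + h \<in> {a..<b} then cis (fdiff h \<phi> k) else 0)
        = (\<Sum>h\<in>{h\<in>{- int N<..<int N}. k + h \<in> {a..<b}}. cis (fdiff h \<phi> k))"
      by (rule sum.inter_filter[symmetric]) simp
    also have "\<dots> = (\<Sum>m\<in>{a..<b}. cis (\<phi> m - \<phi> k))"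
      by (rule sum.reindex_bij_witness[of _ "\<lambda>m. m - k" "\<lambda>h. k + h"])
        (use k assms in \<open>auto simp: fdiff_def\<close>)
    finally show ?thesis by simp
  qed
  have "of_real (cmod (exp_sum \<phi> a b) ^ 2) = exp_sum \<phi> a b * cnj (exp_sum \<phi> a b)"
    by (simp only: complex_norm_square)
  also have "\<dots> = (\<Sum>k\<in>{a..<b}. \<Sum>m\<in>{a..<b}. cis (\<phi> m - \<phi> k))"
    unfolding exp_sum_def cnj_sum sum_product
    by (subst sum.swap) (simp add: cis_cnj cis_mult)
  also have "\<dots> = (\<Sum>k\<in>{a..<b}. \<Sum>h\<in>{- int N<..<int N}.
      if k + h \<in> {a..<b} then cis (fdiff h \<phi> k) else 0)"
    using inner by simp
  also have "\<dots> = (\<Sum>h\<in>{- int N<..<int N}. \<Sum>k\<in>{a..<b}.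
      if k + h \<in> {a..<b} then cis (fdiff h \<phi> k) else 0)"
    by (rule sum.swap)
  also have "\<dots> = (\<Sum>h\<in>{- int N<..<int N}.
      exp_sum (fdiff h \<phi>) (max a (a - h)) (min b (b - h)))"
  proof (rule sum.cong[OF refl])
    fix h
    have "(\<Sum>k\<in>{a..<b}. if k + h \<in> {a..<b} then cis (fdiff h \<phi> k) else 0)
        = (\<Sum>k\<in>{k\<in>{a..<b}. k + h \<in> {a..<b}}. cis (fdiff h \<phi> k))"
      by (rule sum.inter_filter[symmetric]) simp
    also have "{k\<in>{a..<b}. k + h \<in> {a..<b}} = {max a (a - h)..<min b (b - h)}"
      by auto
    finally show "(\<Sum>k\<in>{a..<b}. if k + h \<in> {a..<b} then cis (fdiff h \<phi> k) else 0)
        = exp_sum (fdiff h \<phi>) (max a (a - h)) (min b (b - h))"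
      by (simp add: exp_sum_def)
  qed
  finally have eq: "complex_of_real (cmod (exp_sum \<phi> a b) ^ 2) = (\<Sum>h\<in>{- int N<..<int N}.
      exp_sum (fdiff h \<phi>) (max a (a - h)) (min b (b - h)))" .
  have "cmod (exp_sum \<phi> a b) ^ 2 = cmod (complex_of_real (cmod (exp_sum \<phi> a b) ^ 2))"
    by (simp only: norm_of_real abs_of_nonneg zero_le_power2)
  also have "\<dots> \<le> (\<Sum>h\<in>{- int N<..<int N}.
      cmod (exp_sum (fdiff h \<phi>) (max a (a - h)) (min b (b - h))))"
    unfolding eq by (rule norm_sum)
  finally show ?thesis .
qed

text \<open>The power mean inequality, by repeated use of Cauchy-Schwarz; hence the exponents that
  are powers of two.\<close>

lemma sum_power_two_power_le:
  fixes x :: "'a \<Rightarrow> real"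
  assumes "\<And>i. i \<in> A \<Longrightarrow> 0 \<le> x i"
  shows "(\<Sum>i\<in>A. x i) ^ (2 ^ m) \<le> real (card A) ^ (2 ^ m - 1) * (\<Sum>i\<in>A. x i ^ (2 ^ m))"
proof (induction m)
  case (Suc m)
  let ?c = "real (card A)" and ?q = "2 ^ m :: nat"
  have q: "1 \<le> ?q" by simp
  have "(\<Sum>i\<in>A. x i) ^ (2 ^ Suc m) = ((\<Sum>i\<in>A. x i) ^ ?q)\<^sup>2"
    by (simp add: power_mult[symmetric] mult.commute)
  also have "\<dots> \<le> (?c ^ (?q - 1) * (\<Sum>i\<in>A. x i ^ ?q))\<^sup>2"
    using Suc assms by (intro power_mono) (auto intro!: zero_le_power sum_nonneg)
  also have "\<dots> = ?c ^ (2 * (?q - 1)) * (\<Sum>i\<in>A. x i ^ ?q)\<^sup>2"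
    by (simp add: power_mult_distrib power_mult[symmetric] mult.commute)
  also have "\<dots> \<le> ?c ^ (2 * (?q - 1)) * ((\<Sum>i\<in>A. (x i ^ ?q)\<^sup>2) * ?c)"
    using sum_squared_le_sum_of_squares[of "\<lambda>i. x i ^ ?q" A]
    by (intro mult_left_mono) (auto simp: mult.commute)
  also have "\<dots> = ?c ^ Suc (2 * (?q - 1)) * (\<Sum>i\<in>A. x i ^ (2 ^ Suc m))"
    by (simp add: power_mult[symmetric] mult.commute mult.left_commute)
  also have "Suc (2 * (?q - 1)) = 2 ^ Suc m - 1"
    using q unfolding power_Suc by linarith
  finally show ?case .
qed simp

text \<open>The prefactor is the price of moving the power 2^m inside a sum over fewer than 2 N
  shifts.\<close>

lemma weyl_bound_step:
  assumes N: "N \<ge> 1" and B: "\<And>h. weyl_bound N (2 ^ m) (fdiff h \<phi>) (B h)"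
  shows "weyl_bound N (2 ^ Suc m) \<phi>
    ((2 * real N) ^ (2 ^ m - 1) * (\<Sum>h\<in>{- int N<..<int N}. B h))"
  unfolding weyl_bound_def
proof (intro allI impI)
  fix a b :: int assume ab: "b - a \<le> int N"
  let ?H = "{- int N<..<int N}"
  let ?s = "\<lambda>h. cmod (exp_sum (fdiff h \<phi>) (max a (a - h)) (min b (b - h)))"
  have "cmod (exp_sum \<phi> a b) ^ (2 ^ Suc m) = (cmod (exp_sum \<phi> a b) ^ 2) ^ (2 ^ m)"
    by (simp add: power_mult[symmetric])
  also have "\<dots> \<le> (\<Sum>h\<in>?H. ?s h) ^ (2 ^ m)"
    by (intro power_mono van_der_corput ab) auto
  also have "\<dots> \<le> real (card ?H) ^ (2 ^ m - 1) * (\<Sum>h\<in>?H. ?s h ^ (2 ^ m))"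
    by (rule sum_power_two_power_le) auto
  also have "\<dots> \<le> (2 * real N) ^ (2 ^ m - 1) * (\<Sum>h\<in>?H. B h)"
  proof (intro mult_mono power_mono sum_mono)
    fix h
    have "min b (b - h) - max a (a - h) \<le> int N" using ab by auto
    thus "?s h ^ (2 ^ m) \<le> B h" using B[of h] by (auto simp: weyl_bound_def)
  qed (use N in \<open>auto intro!: sum_nonneg\<close>)
  finally show "cmod (exp_sum \<phi> a b) ^ (2 ^ Suc m)
      \<le> (2 * real N) ^ (2 ^ m - 1) * (\<Sum>h\<in>?H. B h)" .
qed

text \<open>The harmonic mean of \<open>N\<close> and 1 / |sin (\<theta> / 2)|, the two bounds for a
  geometric sum of at most \<open>N\<close> terms. As a single expression it is continuous in
  \<theta> without a case distinction at the zeros of the sine.\<close>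

definition lin_majorant :: "nat \<Rightarrow> real \<Rightarrow> real" where
  "lin_majorant N \<theta> = 2 / (1 / real N + \<bar>sin (\<theta> / 2)\<bar>)"

lemma norm_1_minus_cis: "cmod (1 - cis \<theta>) = 2 * \<bar>sin (\<theta> / 2)\<bar>"
proof -
  have "(cmod (1 - cis \<theta>))\<^sup>2 = (1 - cos \<theta>)\<^sup>2 + (sin \<theta>)\<^sup>2"
    by (simp add: cmod_power2)
  also have "\<dots> = 2 - 2 * cos \<theta>"
    using sin_cos_squared_add[of \<theta>] by (simp add: power2_eq_square algebra_simps)
  also have "cos \<theta> = 1 - 2 * (sin (\<theta> / 2))\<^sup>2"
    using cos_double_sin[of "\<theta> / 2"] by simp
  finally have "(cmod (1 - cis \<theta>))\<^sup>2 = (2 * \<bar>sin (\<theta> / 2)\<bar>)\<^sup>2"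
    by (simp add: power_mult_distrib)
  thus ?thesis by (rule power2_eq_imp_eq) auto
qed

lemma weyl_bound_linear:
  assumes N: "N \<ge> 1" and \<phi>: "\<And>k. \<phi> k = \<theta> * of_int k + \<beta>"
  shows "weyl_bound N (2 ^ 0) \<phi> (lin_majorant N \<theta>)"
  unfolding weyl_bound_def
proof (intro allI impI)
  fix a b :: int assume ab: "b - a \<le> int N"
  let ?S = "exp_sum \<phi> a b"
  have "cmod ?S \<le> (\<Sum>k\<in>{a..<b}. cmod (cis (\<phi> k)))"
    unfolding exp_sum_def by (rule norm_sum)
  also have "\<dots> = real (nat (b - a))" by simp
  also have "\<dots> \<le> real N" using ab by simp
  finally have 1: "cmod ?S \<le> real N" .
  have tel: "(\<Sum>k\<in>{a..<b}. cis (\<phi> (k + 1)) - cis (\<phi> k)) = (if a \<le> b then cis (\<phi> b) - cis (\<phi> a) else 0)"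
  proof (cases "a \<le> b")
    case True
    then have "(\<Sum>k\<in>{a..<b}. cis (\<phi> (k + 1)) - cis (\<phi> k)) = cis (\<phi> b) - cis (\<phi> a)"
    proof (induction b rule: int_ge_induct)
      case (step i)
      have "{a..<i + 1} = insert i {a..<i}" using step by auto
      thus ?case using step by simp
    qed simp
    thus ?thesis using True by simp
  qed simp
  have "?S * (cis \<theta> - 1) = (\<Sum>k\<in>{a..<b}. cis (\<phi> (k + 1)) - cis (\<phi> k))"
    unfolding exp_sum_def sum_distrib_right
    by (intro sum.cong refl) (simp add: \<phi> right_diff_distrib cis_mult algebra_simps)
  hence "cmod (?S * (cis \<theta> - 1)) \<le> 2"
    unfolding tel using norm_triangle_ineq4[of "cis (\<phi> b)" "cis (\<phi> a)"] by auto
  hence 2: "cmod ?S * \<bar>sin (\<theta> / 2)\<bar> \<le> 1"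
    using norm_1_minus_cis[of \<theta>] by (simp add: norm_mult norm_minus_commute)
  have pos: "1 / real N + \<bar>sin (\<theta> / 2)\<bar> > 0"
    using N by (intro add_pos_nonneg) auto
  have "cmod ?S * (1 / real N + \<bar>sin (\<theta> / 2)\<bar>) \<le> 2"
  proof -
    have "cmod ?S * (1 / real N) \<le> 1" using 1 N by (simp add: divide_simps)
    thus ?thesis using 2 by (simp add: distrib_left)
  qed
  thus "cmod ?S ^ 2 ^ 0 \<le> lin_majorant N \<theta>"
    unfolding lin_majorant_def using pos by (simp add: pos_le_divide_eq)
qed

text \<open>\<open>diff_phase d a \<phi>\<close> describes a polynomial phase of degree \<open>d + 1\<close> with leading
  coefficient \<open>a\<close> through its iterated differences.\<close>

fun diff_phase :: "nat \<Rightarrow> real \<Rightarrow> (int \<Rightarrow> real) \<Rightarrow> bool" where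
  "diff_phase 0 a \<phi> \<longleftrightarrow> (\<exists>\<beta>. \<forall>k. \<phi> k = a * of_int k + \<beta>)"
| "diff_phase (Suc d) a \<phi> \<longleftrightarrow> (\<forall>h. diff_phase d ((real d + 2) * of_int h * a) (fdiff h \<phi>))"

text \<open>Only the leading coefficient \<open>a\<close> enters: the lower ones end up in the
  additive constant of the final linear phase, which does not change the modulus of its sums. The
  factor \<open>real d + 2\<close> comes from differencing a monomial of degree d + 2.\<close>

fun weyl_majorant :: "nat \<Rightarrow> nat \<Rightarrow> real \<Rightarrow> real" where
  "weyl_majorant N 0 a = lin_majorant N a"
| "weyl_majorant N (Suc d) a = (2 * real N) ^ (2 ^ d - 1) *
     (\<Sum>h\<in>{- int N<..<int N}. weyl_majorant N d ((real d + 2) * of_int h * a))"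

lemma weyl_differencing:
  assumes "N \<ge> 1" "diff_phase d a \<phi>"
  shows "weyl_bound N (2 ^ d) \<phi> (weyl_majorant N d a)"
  using assms(2)
proof (induction d arbitrary: a \<phi>)
  case 0
  thus ?case using weyl_bound_linear[OF assms(1)] by fastforce
next
  case (Suc d)
  thus ?case using weyl_bound_step[OF assms(1)] by simp
qed

lemma diff_phase_quadratic:
  assumes "\<And>k. \<phi> k = a * of_int k ^ 2 + b * of_int k + c"
  shows "diff_phase 1 a \<phi>"
proof -
  have "fdiff h \<phi> k = 2 * of_int h * a * of_int k + (a * of_int h ^ 2 + b * of_int h)" for h k
    unfolding fdiff_def assms of_int_add by algebra
  thus ?thesis by (auto simp: One_nat_def)
qed

lemma diff_phase_cubic:
  assumes "\<And>k. \<phi> k = a * of_int k ^ 3 + b * of_int k ^ 2 + c * of_int k + d"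
  shows "diff_phase 2 a \<phi>"
proof -
  have "fdiff h \<phi> k = 3 * of_int h * a * of_int k ^ 2
      + (3 * a * of_int h ^ 2 + 2 * b * of_int h) * of_int k
      + (a * of_int h ^ 3 + b * of_int h ^ 2 + c * of_int h)" for h k
    unfolding fdiff_def assms of_int_add by algebra
  hence "diff_phase 1 (3 * of_int h * a) (fdiff h \<phi>)" for h
    by (rule diff_phase_quadratic)
  thus ?thesis by (simp add: numeral_2_eq_2)
qed

lemma diff_phase_quartic:
  assumes "\<And>k. \<phi> k = a * of_int k ^ 4 + b * of_int k ^ 3 + c * of_int k ^ 2 + d * of_int k + e"
  shows "diff_phase 3 a \<phi>"
proof -
  have "fdiff h \<phi> k = 4 * of_int h * a * of_int k ^ 3
      + (6 * a * of_int h ^ 2 + 3 * b * of_int h) * of_int k ^ 2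
      + (4 * a * of_int h ^ 3 + 3 * b * of_int h ^ 2 + 2 * c * of_int h) * of_int k
      + (a * of_int h ^ 4 + b * of_int h ^ 3 + c * of_int h ^ 2 + d * of_int h)" for h k
    unfolding fdiff_def assms of_int_add by algebra
  hence "diff_phase 2 (4 * of_int h * a) (fdiff h \<phi>)" for h
    by (rule diff_phase_cubic)
  thus ?thesis by (simp add: numeral_3_eq_3 numeral_2_eq_2)
qed

text \<open>\<alpha> and \<open>x\<close> sit in the lower coefficients, so the majorant after four
  differencings depends on \<open>t\<close> alone. The index of \<open>diff_phase\<close> is the
  degree minus one.\<close>

lemma diff_phase_quintic:
  "diff_phase 4 (- t) (\<lambda>k. - t * (of_int k ^ 5 - \<alpha> * of_int k ^ 3) + x * of_int k)"
    (is "diff_phase 4 _ ?\<phi>")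
proof -
  have "fdiff h ?\<phi> k = 5 * of_int h * (- t) * of_int k ^ 4
      + (- 10 * t * of_int h ^ 2) * of_int k ^ 3
      + (- 10 * t * of_int h ^ 3 + 3 * t * \<alpha> * of_int h) * of_int k ^ 2
      + (- 5 * t * of_int h ^ 4 + 3 * t * \<alpha> * of_int h ^ 2) * of_int k
      + (- t * of_int h ^ 5 + t * \<alpha> * of_int h ^ 3 + x * of_int h)" for h k
    unfolding fdiff_def of_int_add by algebra
  hence "diff_phase 3 (5 * of_int h * (- t)) (fdiff h ?\<phi>)" for h
    by (rule diff_phase_quartic)
  hence "diff_phase (Suc 3) (- t) ?\<phi>"
    unfolding diff_phase.simps by simp
  thus ?thesis by simp
qed

section \<open>Mean values of the majorants in time\<close>

lemma lin_majorant_even: "lin_majorant N (- \<theta>) = lin_majorant N \<theta>"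
  by (simp add: lin_majorant_def)

lemma lin_majorant_le:
  assumes "N \<ge> 1" shows "0 \<le> lin_majorant N \<theta>" "lin_majorant N \<theta> \<le> 2 * real N"
proof -
  have "2 / (1 / real N + \<bar>sin (\<theta> / 2)\<bar>) \<le> 2 / (1 / real N)"
    using assms by (intro divide_left_mono mult_pos_pos add_pos_nonneg) auto
  thus "lin_majorant N \<theta> \<le> 2 * real N" by (simp add: lin_majorant_def)
qed (auto simp: lin_majorant_def)

lemma continuous_lin_majorant:
  fixes f :: "real \<Rightarrow> real"
  assumes "N \<ge> 1" "continuous_on A f"
  shows "continuous_on A (\<lambda>t. lin_majorant N (f t))"
proof -
  have "1 / real N + \<bar>sin (f t / 2)\<bar> \<noteq> 0" for t
    using assms by (intro less_imp_neq[symmetric] add_pos_nonneg) auto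
  moreover have "continuous_on A (\<lambda>t. 1 / real N + \<bar>sin (f t / 2)\<bar>)"
    unfolding divide_inverse by (intro continuous_intros assms(2))
  ultimately show ?thesis unfolding lin_majorant_def
    by (intro continuous_on_divide continuous_on_const) auto
qed

lemma continuous_weyl_majorant:
  fixes f :: "real \<Rightarrow> real"
  assumes "N \<ge> 1"
  shows "continuous_on A f \<Longrightarrow> continuous_on A (\<lambda>t. weyl_majorant N d (f t))"
proof (induction d arbitrary: f)
  case 0
  thus ?case using continuous_lin_majorant[OF assms] by simp
next
  case (Suc d)
  have "continuous_on A (\<lambda>t. weyl_majorant N d ((real d + 2) * of_int h * f t))" for h
    by (rule Suc.IH) (intro continuous_intros Suc.prems)
  thus ?case unfolding weyl_majorant.simps by (intro continuous_intros)
qed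

lemma weyl_majorant_nonneg: "N \<ge> 1 \<Longrightarrow> 0 \<le> weyl_majorant N d a"
  by (induction d arbitrary: a) (auto intro!: lin_majorant_le sum_nonneg mult_nonneg_nonneg)

text \<open>Jordan's inequality: concavity puts the sine above its chord.\<close>

lemma sin_ge_linear:
  assumes "0 \<le> x" "x \<le> pi / 2"
  shows "2 / pi * x \<le> sin x"
proof -
  have "convex_on {0..pi / 2} (\<lambda>x. - sin x)"
    by (rule f''_ge0_imp_convex[where f' = "\<lambda>x. - cos x" and f'' = "\<lambda>x. sin x"])
      (auto intro!: derivative_eq_intros sin_ge_zero)
  moreover have "2 / pi * x \<le> 1" using assms by (simp add: field_simps)
  ultimately have "- sin ((1 - 2 / pi * x) *\<^sub>R 0 + (2 / pi * x) *\<^sub>R (pi / 2))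
      \<le> (1 - 2 / pi * x) * (- sin 0) + (2 / pi * x) * (- sin (pi / 2))"
    using assms by (intro convex_onD) auto
  thus ?thesis by simp
qed

lemma integral_periodic_multiple:
  fixes f :: "real \<Rightarrow> real"
  assumes f: "continuous_on UNIV f" and per: "\<And>x. f (x + p) = f x" and p: "p \<ge> 0"
  shows "integral {0..real n * p} f = real n * integral {0..p} f"
proof (induction n)
  case (Suc n)
  have int: "f integrable_on {a..b}" for a b
    using f by (intro integrable_continuous_real) (auto intro: continuous_on_subset)
  have "((f \<circ> ((+) p)) has_integral integral {0 + p..real n * p + p} f) {0..real n * p}"
    unfolding has_integral_shift_Icc_real using int by (rule integrable_integral)
  moreover have "f \<circ> ((+) p) = f" using per by (auto simp: add.commute)
  ultimately have sh: "integral {p..real n * p + p} f = integral {0..real n * p} f"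
    by (simp add: integral_unique)
  have "integral {0..p} f + integral {p..real n * p + p} f = integral {0..real n * p + p} f"
    by (rule Henstock_Kurzweil_Integration.integral_combine) (use p int in auto)
  thus ?case using Suc sh by (simp add: algebra_simps)
qed simp

text \<open>Jordan's inequality bounds the denominator from below by a linear function, whose
  reciprocal has a logarithmic primitive. This is the source of the logarithm in the Weyl
  bound.\<close>

lemma integral_lin_majorant_half:
  assumes N: "N \<ge> 1"
  shows "integral {0..pi} (lin_majorant N) \<le> 2 * pi * ln (1 + real N)"
proof -
  have pos: "1 / real N + t / pi > 0" if "t \<ge> 0" for t
    using N that by (intro add_pos_nonneg) auto
  have der: "((\<lambda>t. 2 * pi * ln (1 / real N + t / pi)) has_vector_derivative
      2 / (1 / real N + t / pi)) (at t within {0..pi})" if "t \<in> {0..pi}" for t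
    using pos[of t] that unfolding has_real_derivative_iff_has_vector_derivative[symmetric]
    by (auto intro!: derivative_eq_intros simp: field_simps)
  have hi: "((\<lambda>t. 2 / (1 / real N + t / pi)) has_integral
      2 * pi * ln (1 / real N + pi / pi) - 2 * pi * ln (1 / real N + 0 / pi)) {0..pi}"
    by (rule fundamental_theorem_of_calculus) (use der in auto)
  have "integral {0..pi} (lin_majorant N) \<le> integral {0..pi} (\<lambda>t. 2 / (1 / real N + t / pi))"
  proof (rule integral_le)
    show "lin_majorant N integrable_on {0..pi}"
      by (intro integrable_continuous_real continuous_lin_majorant[OF N] continuous_on_id)
    show "lin_majorant N t \<le> 2 / (1 / real N + t / pi)" if "t \<in> {0..pi}" for t
    proof -
      have "2 / pi * (t / 2) \<le> sin (t / 2)"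
        using that by (intro sin_ge_linear) auto
      hence "t / pi \<le> \<bar>sin (t / 2)\<bar>" by simp
      thus ?thesis unfolding lin_majorant_def
        using pos[of t] that N by (intro divide_left_mono mult_pos_pos add_pos_nonneg) auto
    qed
  qed (use hi in auto)
  also have "\<dots> = 2 * pi * ln (1 / real N + pi / pi) - 2 * pi * ln (1 / real N + 0 / pi)"
    using hi by (rule integral_unique)
  also have "\<dots> = 2 * pi * (ln ((1 / real N + 1) / (1 / real N)))"
    using N pos[of pi] by (subst ln_div) (auto simp: algebra_simps)
  also have "(1 / real N + 1) / (1 / real N) = 1 + real N"
    using N by (simp add: field_simps)
  finally show ?thesis .
qed

lemma integral_lin_majorant_period:
  assumes N: "N \<ge> 1"
  shows "integral {0..2 * pi} (lin_majorant N) \<le> 4 * pi * ln (1 + real N)"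
proof -
  have int: "lin_majorant N integrable_on {a..b}" for a b
    by (intro integrable_continuous_real continuous_lin_majorant[OF N] continuous_on_id)
  have refl: "lin_majorant N (2 * pi - t) = lin_majorant N t" for t
    by (simp add: lin_majorant_def diff_divide_distrib sin_diff)
  have "((lin_majorant N \<circ> ((+) (2 * pi))) has_integral integral {- pi + 2 * pi..0 + 2 * pi} (lin_majorant N)) {-pi..0}"
    unfolding has_integral_shift_Icc_real using int by (rule integrable_integral)
  moreover have "(lin_majorant N \<circ> ((+) (2 * pi))) = (\<lambda>t. lin_majorant N (- t))"
    using refl[of "- t" for t] by auto
  ultimately have "((\<lambda>t. lin_majorant N (- t)) has_integral integral {pi..2 * pi} (lin_majorant N)) {-pi..- 0}"
    by simp
  hence "(lin_majorant N has_integral integral {pi..2 * pi} (lin_majorant N)) {0..pi}"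
    by (simp only: has_integral_reflect_real)
  hence "integral {pi..2 * pi} (lin_majorant N) = integral {0..pi} (lin_majorant N)"
    by (simp add: integral_unique)
  moreover have "integral {0..pi} (lin_majorant N) + integral {pi..2 * pi} (lin_majorant N)
      = integral {0..2 * pi} (lin_majorant N)"
    by (rule Henstock_Kurzweil_Integration.integral_combine) (use int in auto)
  ultimately show ?thesis using integral_lin_majorant_half[OF N] by simp
qed

text \<open>Over whole periods, a dilation by a nonzero integer leaves the mean of a periodic
  function unchanged, so the bound does not see \<open>m\<close>. The interval consists of whole
  periods for every \<open>m\<close> at once, which is what the sum over shifts in
  \<open>integral_weyl_majorant\<close> relies on.\<close>

lemma integral_lin_majorant_dilated:
  fixes m :: int
  assumes N: "N \<ge> 1" and m: "m \<noteq> 0"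
  shows "integral {- (2 * pi * real L)..2 * pi * real L} (\<lambda>t. lin_majorant N (of_int m * t))
    \<le> 8 * pi * real L * ln (1 + real N)"
proof -
  define n where "n = nat \<bar>m\<bar>"
  have n: "n \<noteq> 0" using m by (simp add: n_def)
  have mn: "lin_majorant N (of_int m * t) = lin_majorant N (real n * t)" for t
    unfolding n_def using lin_majorant_even[of N "of_int m * t"] by (cases "m \<ge> 0") auto
  let ?c = "2 * pi * real L"
  have c: "?c \<ge> 0" by simp
  have int: "(\<lambda>t. lin_majorant N (real n * t)) integrable_on {a..b}" for a b
    by (intro integrable_continuous_real continuous_lin_majorant[OF N] continuous_intros)
  have "integral {- ?c..- 0} (\<lambda>t. lin_majorant N (real n * (- t)))
      = integral {0..?c} (\<lambda>t. lin_majorant N (real n * t))"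
    by (rule Henstock_Kurzweil_Integration.integral_reflect_real)
  hence refl: "integral {- ?c..0} (\<lambda>t. lin_majorant N (real n * t))
      = integral {0..?c} (\<lambda>t. lin_majorant N (real n * t))"
    by (simp add: lin_majorant_even)
  have comb: "integral {- ?c..0} (\<lambda>t. lin_majorant N (real n * t)) + integral {0..?c} (\<lambda>t. lin_majorant N (real n * t))
      = integral {- ?c..?c} (\<lambda>t. lin_majorant N (real n * t))"
    by (rule Henstock_Kurzweil_Integration.integral_combine) (use int c in auto)
  have img: "(\<lambda>x. x / real n) ` {0..real (n * L) * (2 * pi)} = {0..?c}"
    using n by (subst image_divide_atLeastAtMost) (auto simp: field_simps)
  have "integral {0..?c} (\<lambda>t. lin_majorant N (real n * t))
      = (1 / real n) * integral {0..real (n * L) * (2 * pi)} (lin_majorant N)"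
    using integral_stretch_real[of "real n" 0 "real (n * L) * (2 * pi)" "lin_majorant N"] n
    unfolding img by simp
  also have "\<dots> = real L * integral {0..2 * pi} (lin_majorant N)"
  proof (subst integral_periodic_multiple)
    show "continuous_on UNIV (lin_majorant N)"
      by (intro continuous_lin_majorant[OF N] continuous_on_id)
    show "lin_majorant N (x + 2 * pi) = lin_majorant N x" for x
      by (simp add: lin_majorant_def add_divide_distrib sin_add)
  qed (use n in auto)
  also have "\<dots> \<le> real L * (4 * pi * ln (1 + real N))"
    by (intro mult_left_mono integral_lin_majorant_period[OF N]) auto
  finally have half: "integral {0..?c} (\<lambda>t. lin_majorant N (real n * t))
      \<le> real L * (4 * pi * ln (1 + real N))" .
  have "integral {- ?c..?c} (\<lambda>t. lin_majorant N (real n * t))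
      = 2 * integral {0..?c} (\<lambda>t. lin_majorant N (real n * t))"
    using refl comb by linarith
  also have "\<dots> \<le> 2 * (real L * (4 * pi * ln (1 + real N)))"
    using half by linarith
  finally show ?thesis by (simp only: mn) (simp add: mult_ac)
qed

text \<open>The trivial bound. It serves the shift h = 0 of the next lemma, where the dependence on
  time disappears and averaging gains nothing.\<close>

lemma weyl_majorant_le:
  "\<exists>C\<ge>0. \<forall>N\<ge>1. \<forall>a. weyl_majorant N d a \<le> C * real N ^ (2 ^ d)"
proof (induction d)
  case 0
  show ?case by (rule exI[of _ 2]) (auto intro: lin_majorant_le)
next
  case (Suc d)
  then obtain C where C: "C \<ge> 0" "\<And>N a. N \<ge> 1 \<Longrightarrow> weyl_majorant N d a \<le> C * real N ^ (2 ^ d)"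
    by blast
  show ?case
  proof (intro exI[of _ "2 ^ (2 ^ d) * C"] conjI allI impI)
    fix N :: nat and a assume N: "N \<ge> 1"
    let ?q = "2 ^ d :: nat"
    have "(\<Sum>h\<in>{- int N<..<int N}. weyl_majorant N d ((real d + 2) * of_int h * a))
        \<le> of_nat (card {- int N<..<int N}) * (C * real N ^ ?q)"
      by (intro sum_bounded_above C(2) N)
    also have "\<dots> \<le> (2 * real N) * (C * real N ^ ?q)"
      using N C(1) by (intro mult_right_mono) auto
    finally have "weyl_majorant N (Suc d) a \<le> (2 * real N) ^ (?q - 1) * ((2 * real N) * (C * real N ^ ?q))"
      by (simp add: mult_left_mono)
    also have "\<dots> = (2 * real N) ^ Suc (?q - 1) * (C * real N ^ ?q)" by (simp only: power_Suc mult_ac)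
    also have "Suc (?q - 1) = ?q" by simp
    also have "(2 * real N) ^ ?q * (C * real N ^ ?q) = 2 ^ (2 ^ d) * C * real N ^ (2 ^ Suc d)"
      by (simp only: power_mult_distrib power_Suc mult_2 power_add mult_ac)
    finally show "weyl_majorant N (Suc d) a \<le> 2 ^ (2 ^ d) * C * real N ^ (2 ^ Suc d)" .
  qed (use C in auto)
qed

text \<open>A nonzero shift h turns the multiple m of t into the nonzero multiple (d + 2) h m, so
  the induction hypothesis applies with one constant to fewer than 2 N terms; this is why the
  statement ranges over all \<open>m\<close>. These terms together, and the shift 0 by the trivial
  bound, are of order N^(2^d). With the prefactor N^(2^d - 1) the total is one power of N below the
  trivial N^(2^(d + 1)).\<close>

lemma integral_weyl_majorant:
  "\<exists>C\<ge>0. \<forall>N\<ge>1. \<forall>L. \<forall>m::int. m \<noteq> 0 \<longrightarrow>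
     integral {- (2 * pi * real L)..2 * pi * real L} (\<lambda>t. weyl_majorant N d (of_int m * t))
       \<le> C * real L * real N ^ (2 ^ d - 1) * (1 + ln (1 + real N))"
proof (induction d)
  case 0
  show ?case
  proof (intro exI[of _ "8 * pi"] conjI allI impI)
    fix N L :: nat and m :: int assume N: "N \<ge> 1" and m: "m \<noteq> 0"
    show "integral {- (2 * pi * real L)..2 * pi * real L} (\<lambda>t. weyl_majorant N 0 (of_int m * t))
       \<le> 8 * pi * real L * real N ^ (2 ^ 0 - 1) * (1 + ln (1 + real N))"
      using integral_lin_majorant_dilated[OF N m, of L] by (simp add: distrib_left add_increasing)
  qed auto
next
  case (Suc d)
  then obtain C where C: "C \<ge> 0" "\<And>N L m. N \<ge> 1 \<Longrightarrow> m \<noteq> 0 \<Longrightarrow>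
     integral {- (2 * pi * real L)..2 * pi * real L} (\<lambda>t. weyl_majorant N d (of_int m * t))
       \<le> C * real L * real N ^ (2 ^ d - 1) * (1 + ln (1 + real N))"
    by blast
  obtain D where D: "D \<ge> 0" "\<And>N a. N \<ge> 1 \<Longrightarrow> weyl_majorant N d a \<le> D * real N ^ (2 ^ d)"
    using weyl_majorant_le[of d] by blast
  let ?q = "2 ^ d :: nat"
  show ?case
  proof (intro exI[of _ "2 ^ (?q - 1) * (2 * C + 4 * pi * D)"] conjI allI impI)
    fix N L :: nat and m :: int assume N: "N \<ge> 1" and m: "m \<noteq> 0"
    let ?I = "{- (2 * pi * real L)..2 * pi * real L}"
    let ?H = "{- int N<..<int N}"
    let ?l = "1 + ln (1 + real N)"
    have l: "?l \<ge> 1" by simp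
    have int: "(\<lambda>t. weyl_majorant N d (c * t)) integrable_on ?I" for c
      by (intro integrable_continuous_real continuous_weyl_majorant[OF N] continuous_intros)
    have "integral ?I (\<lambda>t. weyl_majorant N (Suc d) (of_int m * t))
        = integral ?I (\<lambda>t. (2 * real N) ^ (?q - 1) *
            (\<Sum>h\<in>?H. weyl_majorant N d (of_int ((int d + 2) * h * m) * t)))"
      by (simp add: mult.assoc)
    also have "\<dots> = (2 * real N) ^ (?q - 1) *
          (\<Sum>h\<in>?H. integral ?I (\<lambda>t. weyl_majorant N d (of_int ((int d + 2) * h * m) * t)))"
      by (subst integral_mult_right, subst integral_sum) (use int in auto)
    also have "(\<Sum>h\<in>?H. integral ?I (\<lambda>t. weyl_majorant N d (of_int ((int d + 2) * h * m) * t)))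
        = integral ?I (\<lambda>t. weyl_majorant N d (of_int ((int d + 2) * 0 * m) * t)) +
          (\<Sum>h\<in>?H - {0}. integral ?I (\<lambda>t. weyl_majorant N d (of_int ((int d + 2) * h * m) * t)))"
      using N by (intro sum.remove) auto
    also have "\<dots> \<le> 4 * pi * D * real L * real N ^ ?q * ?l + 2 * C * real L * real N ^ ?q * ?l"
    proof (rule add_mono)
      have "integral ?I (\<lambda>t. weyl_majorant N d (of_int ((int d + 2) * 0 * m) * t))
          \<le> integral ?I (\<lambda>t. D * real N ^ ?q)"
        by (rule integral_le) (use int[of 0] D(2)[OF N] in auto)
      also have "\<dots> = 4 * pi * D * real L * real N ^ ?q" by simp
      also have "\<dots> \<le> 4 * pi * D * real L * real N ^ ?q * ?l"
        using mult_left_mono[OF l, of "4 * pi * D * real L * real N ^ ?q"] D(1) by simp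
      finally show "integral ?I (\<lambda>t. weyl_majorant N d (of_int ((int d + 2) * 0 * m) * t))
          \<le> 4 * pi * D * real L * real N ^ ?q * ?l" .
      have nz: "(int d + 2) * h * m \<noteq> 0" if "h \<in> ?H - {0}" for h
        using that m by auto
      have "(\<Sum>h\<in>?H - {0}. integral ?I (\<lambda>t. weyl_majorant N d (of_int ((int d + 2) * h * m) * t)))
          \<le> of_nat (card (?H - {0})) * (C * real L * real N ^ (?q - 1) * ?l)"
        by (intro sum_bounded_above C(2)[OF N] nz)
      also have "\<dots> \<le> (2 * real N) * (C * real L * real N ^ (?q - 1) * ?l)"
        using N C(1) l by (intro mult_right_mono mult_nonneg_nonneg) (auto simp: card_Diff_singleton_if)
      also have "\<dots> = 2 * C * real L * real N ^ Suc (?q - 1) * ?l"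
        by (simp only: power_Suc mult_ac)
      also have "Suc (?q - 1) = ?q" by simp
      finally show "(\<Sum>h\<in>?H - {0}. integral ?I (\<lambda>t. weyl_majorant N d (of_int ((int d + 2) * h * m) * t)))
          \<le> 2 * C * real L * real N ^ ?q * ?l" .
    qed
    also have "4 * pi * D * real L * real N ^ ?q * ?l + 2 * C * real L * real N ^ ?q * ?l
        = (2 * C + 4 * pi * D) * real L * real N ^ ?q * ?l"
      by (simp add: algebra_simps)
    finally have "integral ?I (\<lambda>t. weyl_majorant N (Suc d) (of_int m * t))
        \<le> (2 * real N) ^ (?q - 1) * ((2 * C + 4 * pi * D) * real L * real N ^ ?q * ?l)"
      by (simp add: mult_left_mono)
    also have "\<dots> = 2 ^ (?q - 1) * (2 * C + 4 * pi * D) * real L * real N ^ (?q - 1 + ?q) * ?l"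
      by (simp only: power_mult_distrib power_add mult_ac)
    also have "?q - 1 + ?q = 2 ^ Suc d - 1" by simp
    finally show "integral ?I (\<lambda>t. weyl_majorant N (Suc d) (of_int m * t))
       \<le> 2 ^ (?q - 1) * (2 * C + 4 * pi * D) * real L * real N ^ (2 ^ Suc d - 1) * ?l" .
  qed (use C D in auto)
qed

text \<open>A Borel-Cantelli argument through monotone convergence: on each bounded interval the
  weighted majorants have summable integrals, so their sum is finite almost everywhere and bounds
  every single term. Countably many intervals exhaust the line.\<close>

lemma weyl_majorant_ae:
  "AE t in lborel. \<exists>C. \<forall>j. weyl_majorant (2 ^ j) 4 t \<le> C * 2 ^ (15 * j) * (real j + 1) ^ 3"
proof -
  \<comment> \<open>Normalisation by the time average N^15 at N = 2^j. Of the three powers of j + 1,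
    one pays for the logarithm and two make the series converge.\<close>
  define w where "w j = 1 / (2 ^ (15 * j) * (real j + 1) ^ 3)" for j
  have w: "w j > 0" for j by (simp add: w_def add_pos_nonneg)
  obtain C where C: "C \<ge> 0" "\<And>N L m. N \<ge> 1 \<Longrightarrow> m \<noteq> 0 \<Longrightarrow>
     integral {- (2 * pi * real L)..2 * pi * real L} (\<lambda>t. weyl_majorant N 4 (of_int m * t))
       \<le> C * real L * real N ^ (2 ^ 4 - 1) * (1 + ln (1 + real N))"
    using integral_weyl_majorant[of 4] by blast
  have "AE t in lborel. t \<in> {- (2 * pi * real L)..2 * pi * real L} \<longrightarrow>
      (\<exists>C. \<forall>j. weyl_majorant (2 ^ j) 4 t \<le> C * 2 ^ (15 * j) * (real j + 1) ^ 3)" for L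
  proof -
    let ?I = "{- (2 * pi * real L)..2 * pi * real L}"
    define f where "f j t = weyl_majorant (2 ^ j) 4 t * w j" for j t
    have f0: "f j t \<ge> 0" for j t
      using w[of j] by (auto simp: f_def intro!: mult_nonneg_nonneg weyl_majorant_nonneg)
    have fc: "continuous_on A (f j)" for j A
      unfolding f_def by (intro continuous_intros continuous_weyl_majorant) auto
    have fi: "integral ?I (f j) \<le> 2 * C * real L * (1 / (real j + 1) ^ 2)" for j
    proof -
      have "integral ?I (f j) = integral ?I (\<lambda>t. weyl_majorant (2 ^ j) 4 (of_int 1 * t)) * w j"
        unfolding f_def by simp
      also have "\<dots> \<le> C * real L * real (2 ^ j) ^ (2 ^ 4 - 1) * (1 + ln (1 + real (2 ^ j))) * w j"
        using w[of j] by (intro mult_right_mono C(2)) auto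
      also have "\<dots> = C * real L * (1 + ln (1 + real (2 ^ j))) / (real j + 1) ^ 3"
      proof -
        have "real (2 ^ j) ^ (2 ^ 4 - 1) = 2 ^ (15 * j)"
          by (simp add: power_mult mult.commute[of 15])
        thus ?thesis by (simp only: w_def) simp
      qed
      also have "\<dots> \<le> C * real L * (2 * (real j + 1)) / (real j + 1) ^ 3"
      proof (intro divide_right_mono mult_left_mono)
        have "ln (1 + real (2 ^ j)) \<le> ln (2 ^ Suc j)"
          by (subst ln_le_cancel_iff) (auto intro: add_pos_nonneg)
        also have "\<dots> = real (Suc j) * ln 2" by (subst ln_realpow) auto
        also have "\<dots> \<le> real (Suc j) * 1" by (intro mult_left_mono) (auto simp: ln_2_less_1 less_imp_le)
        finally show "1 + ln (1 + real (2 ^ j)) \<le> 2 * (real j + 1)" by simp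
      qed (use C in auto)
      also have "\<dots> = 2 * C * real L * (1 / (real j + 1) ^ 2)"
        by (simp add: power3_eq_cube power2_eq_square divide_simps)
      finally show ?thesis .
    qed
    have nn: "(\<integral>\<^sup>+t. ennreal (f j t) * indicator ?I t \<partial>lborel) = ennreal (integral ?I (f j))" for j
      by (rule nn_integral_has_integral_lebesgue')
        (use f0 fc in \<open>auto intro!: integrable_integral integrable_continuous_real\<close>)
    have meas: "(\<lambda>t. ennreal (f j t) * indicator ?I t) \<in> borel_measurable lborel" for j
    proof -
      have [measurable]: "f j \<in> borel_measurable borel"
        using fc by (rule borel_measurable_continuous_onI)
      thus ?thesis by measurable
    qed
    have sm: "summable (\<lambda>j. 2 * C * real L * (1 / (real j + 1) ^ 2))"
    proof (intro summable_mult)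
      have "summable (\<lambda>j. inverse (real (Suc j) ^ 2))"
        by (subst summable_Suc_iff) (rule inverse_power_summable, simp)
      thus "summable (\<lambda>j. 1 / (real j + 1)\<^sup>2)" by (simp add: inverse_eq_divide add.commute)
    qed
    have "(\<integral>\<^sup>+t. (\<Sum>j. ennreal (f j t) * indicator ?I t) \<partial>lborel)
        = (\<Sum>j. ennreal (integral ?I (f j)))"
      using meas by (subst nn_integral_suminf) (auto simp: nn)
    also have "\<dots> \<le> (\<Sum>j. ennreal (2 * C * real L * (1 / (real j + 1) ^ 2)))"
      by (intro suminf_le ennreal_leI fi) auto
    also have "\<dots> < \<infinity>"
      using sm C(1) by (subst suminf_ennreal2) auto
    finally have "(\<integral>\<^sup>+t. (\<Sum>j. ennreal (f j t) * indicator ?I t) \<partial>lborel) \<noteq> \<infinity>"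
      by simp
    hence "AE t in lborel. (\<Sum>j. ennreal (f j t) * indicator ?I t) \<noteq> \<infinity>"
      by (intro nn_integral_noteq_infinite borel_measurable_suminf_order meas)
    thus ?thesis
    proof (rule eventually_mono, intro impI)
      fix t assume fin: "(\<Sum>j. ennreal (f j t) * indicator ?I t) \<noteq> \<infinity>" and t: "t \<in> ?I"
      hence fin': "(\<Sum>j. ennreal (f j t)) \<noteq> \<infinity>" by simp
      define S where "S = enn2real (\<Sum>j. ennreal (f j t))"
      have "f j t \<le> S" for j
      proof -
        have "ennreal (f j t) \<le> (\<Sum>j. ennreal (f j t))"
          using sum_le_suminf[of "\<lambda>j. ennreal (f j t)" "{j}"] by simp
        also have "\<dots> = ennreal S" using fin' by (simp add: S_def less_top)
        finally show ?thesis using ennreal_le_iff[of S] by (simp add: S_def)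
      qed
      hence "weyl_majorant (2 ^ j) 4 t \<le> S * 2 ^ (15 * j) * (real j + 1) ^ 3" for j
        using w[of j] unfolding f_def w_def by (simp add: divide_simps mult_ac split: if_splits)
      thus "\<exists>C. \<forall>j. weyl_majorant (2 ^ j) 4 t \<le> C * 2 ^ (15 * j) * (real j + 1) ^ 3" by blast
    qed
  qed
  hence "AE t in lborel. \<forall>L. t \<in> {- (2 * pi * real L)..2 * pi * real L} \<longrightarrow>
      (\<exists>C. \<forall>j. weyl_majorant (2 ^ j) 4 t \<le> C * 2 ^ (15 * j) * (real j + 1) ^ 3)"
    by (subst AE_all_countable) auto
  thus ?thesis
  proof (rule eventually_mono)
    fix t :: real
    assume *: "\<forall>L. t \<in> {- (2 * pi * real L)..2 * pi * real L} \<longrightarrow>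
      (\<exists>C. \<forall>j. weyl_majorant (2 ^ j) 4 t \<le> C * 2 ^ (15 * j) * (real j + 1) ^ 3)"
    obtain L where L: "\<bar>t\<bar> \<le> real L" using real_arch_simple by blast
    also have "real L \<le> 2 * pi * real L" using pi_gt3 by (simp add: mult_le_cancel_right1)
    finally show "\<exists>C. \<forall>j. weyl_majorant (2 ^ j) 4 t \<le> C * 2 ^ (15 * j) * (real j + 1) ^ 3"
      using * by (auto simp: abs_le_iff)
  qed
qed

text \<open>All that the sequel asks of a time \<open>t\<close>. The constant is common to all
  \<open>x\<close> and all intervals, since the sums are used for every \<open>x\<close> at once and
  through their partial sums.\<close>

definition weyl_good :: "real \<Rightarrow> real \<Rightarrow> bool" where
  "weyl_good \<alpha> t \<longleftrightarrow> (\<exists>C. \<forall>j x a b. b - a \<le> 2 ^ j \<longrightarrow>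
     cmod (exp_sum (\<lambda>k. - t * (of_int k ^ 5 - \<alpha> * of_int k ^ 3) + x * of_int k) a b)
       \<le> C * (real j + 1) * 2 powr (15 / 16 * real j))"

lemma weyl_majorant_even: "weyl_majorant N d (- a) = weyl_majorant N d a"
proof (induction d arbitrary: a)
  case (Suc d)
  have "weyl_majorant N d ((real d + 2) * of_int h * (- a))
      = weyl_majorant N d ((real d + 2) * of_int h * a)" for h
    using Suc[of "(real d + 2) * of_int h * a"] by simp
  thus ?case unfolding weyl_majorant.simps by presburger
qed (simp add: lin_majorant_even)

theorem weyl_good_ae: "AE t in lebesgue. weyl_good \<alpha> t"
  using AE_completion[OF weyl_majorant_ae]
proof (rule eventually_mono)
  fix t :: real
  assume "\<exists>C. \<forall>j. weyl_majorant (2 ^ j) 4 t \<le> C * 2 ^ (15 * j) * (real j + 1) ^ 3"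
  then obtain C where C: "\<And>j. weyl_majorant (2 ^ j) 4 t \<le> C * 2 ^ (15 * j) * (real j + 1) ^ 3"
    by blast
  let ?C = "max C 1"
  show "weyl_good \<alpha> t" unfolding weyl_good_def
  proof (intro exI[of _ ?C] allI impI)
    fix j :: nat and x :: real and a b :: int assume ab: "b - a \<le> 2 ^ j"
    let ?S = "exp_sum (\<lambda>k. - t * (of_int k ^ 5 - \<alpha> * of_int k ^ 3) + x * of_int k) a b"
    have "weyl_bound (2 ^ j) (2 ^ 4) (\<lambda>k. - t * (of_int k ^ 5 - \<alpha> * of_int k ^ 3) + x * of_int k)
        (weyl_majorant (2 ^ j) 4 (- t))"
      by (intro weyl_differencing diff_phase_quintic) auto
    hence "cmod ?S ^ 16 \<le> weyl_majorant (2 ^ j) 4 t"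
      using ab unfolding weyl_bound_def weyl_majorant_even by simp
    also have "\<dots> \<le> C * 2 ^ (15 * j) * (real j + 1) ^ 3" by (rule C)
    \<comment> \<open>The exponent of j + 1 is raised from 3 to 16 so that the right side becomes a
      perfect 16th power.\<close>
    also have "\<dots> \<le> ?C ^ 16 * 2 ^ (15 * j) * (real j + 1) ^ 16"
    proof (intro mult_mono)
      have "?C ^ 1 \<le> ?C ^ 16" by (intro power_increasing) auto
      thus "C \<le> ?C ^ 16" by simp
      show "(real j + 1) ^ 3 \<le> (real j + 1) ^ 16" by (intro power_increasing) auto
    qed auto
    also have "2 ^ (15 * j) = (2 powr (15 / 16 * real j)) ^ 16"
    proof -
      have "(2 powr (15 / 16 * real j)) ^ 16 = 2 powr (real (15 * j))"
        by (simp add: powr_power)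
      also have "\<dots> = 2 ^ (15 * j)" by (rule powr_realpow) simp
      finally show ?thesis by simp
    qed
    also have "?C ^ 16 * (2 powr (15 / 16 * real j)) ^ 16 * (real j + 1) ^ 16
        = (?C * (real j + 1) * 2 powr (15 / 16 * real j)) ^ 16"
      by (simp only: power_mult_distrib mult_ac)
    finally show "cmod ?S \<le> ?C * (real j + 1) * 2 powr (15 / 16 * real j)"
      by (subst (asm) power_mono_iff) (auto intro!: mult_nonneg_nonneg)
  qed
qed

section \<open>Covering numbers of graphs\<close>

lemma covering_number_le:
  assumes "finite C" "S \<subseteq> (\<Union>c\<in>C. ball c \<epsilon>)"
  shows "covering_number S \<epsilon> \<le> card C"
  unfolding covering_number_def by (rule Least_le) (use assms in blast)

lemma covering_number_attained:
  fixes S :: "'a::metric_space set"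
  assumes "compact S" "\<epsilon> > 0"
  obtains C where "finite C" "card C = covering_number S \<epsilon>" "S \<subseteq> (\<Union>c\<in>C. ball c \<epsilon>)"
proof -
  obtain k where "finite k" "S \<subseteq> (\<Union>x\<in>k. ball x \<epsilon>)"
    using assms unfolding compact_eq_totally_bounded by blast
  hence "\<exists>n. \<exists>C. finite C \<and> card C = n \<and> S \<subseteq> (\<Union>c\<in>C. ball c \<epsilon>)" by blast
  from LeastI_ex[OF this] show ?thesis
    using that unfolding covering_number_def by blast
qed

lemma ln_inverse_at_right_0: "filterlim (\<lambda>\<epsilon>::real. ln (1 / \<epsilon>)) at_top (at_right 0)"
  unfolding divide_inverse mult_1_left
  by (rule filterlim_compose[OF ln_at_top filterlim_inverse_at_top_right])

text \<open>There are of order 1 / \<delta> columns of width \<delta>. Over each of them the graph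
  stays within K \<delta>^\<theta> of its value at the left edge, so of order \<delta>^(\<theta> -
  1) grid heights suffice. The count \<delta>^(\<theta> - 2) determines the dimension, as constants
  vanish after division by ln (1 / \<epsilon>).\<close>

lemma upper_minkowski_dim_holder:
  fixes f :: "real \<Rightarrow> real"
  assumes \<theta>: "0 < \<theta>" "\<theta> \<le> 1" and K: "K \<ge> 0"
    and hol: "\<And>x y. \<bar>f x - f y\<bar> \<le> K * \<bar>x - y\<bar> powr \<theta>"
  shows "upper_minkowski_dim (torus_graph f) \<le> ereal (2 - \<theta>)"
proof -
  let ?S = "torus_graph f"
  define A where "A = (2 * pi + 1) * (2 * K + 3)"
  have A: "A \<ge> 1"
  proof -
    have "1 * 1 \<le> (2 * pi + 1) * (2 * K + 3)" using K by (intro mult_mono) auto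
    thus ?thesis by (simp add: A_def)
  qed
  have bnd: "bounded ?S"
  proof (rule bounded_subset)
    show "bounded ({0..2 * pi} \<times> {f 0 - K * (2 * pi) powr \<theta>..f 0 + K * (2 * pi) powr \<theta>})"
      by (intro bounded_Times) auto
    show "?S \<subseteq> {0..2 * pi} \<times> {f 0 - K * (2 * pi) powr \<theta>..f 0 + K * (2 * pi) powr \<theta>}"
    proof
      fix p assume "p \<in> ?S"
      then obtain x where x: "p = (x, f x)" "0 \<le> x" "x \<le> 2 * pi" by (auto simp: torus_graph_def)
      have "\<bar>f x - f 0\<bar> \<le> K * \<bar>x - 0\<bar> powr \<theta>" by (rule hol)
      also have "\<dots> \<le> K * (2 * pi) powr \<theta>"
        using x \<theta> K by (intro mult_left_mono powr_mono2) auto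
      finally show "p \<in> {0..2 * pi} \<times> {f 0 - K * (2 * pi) powr \<theta>..f 0 + K * (2 * pi) powr \<theta>}"
        using x by (auto simp: abs_le_iff)
    qed
  qed
  have cov: "real (covering_number ?S \<epsilon>) \<le> A * (\<epsilon> / 2) powr (\<theta> - 2)" if \<epsilon>: "0 < \<epsilon>" "\<epsilon> < 1" for \<epsilon>
  proof -
    \<comment> \<open>A grid point within \<delta> in each coordinate is within 2 \<delta> =
      \<epsilon> in the plane.\<close>
    define \<delta> where "\<delta> = \<epsilon> / 2"
    have \<delta>: "0 < \<delta>" "\<delta> < 1" using \<epsilon> by (auto simp: \<delta>_def)
    define I where "I = \<lfloor>2 * pi / \<delta>\<rfloor>"
    define J where "J = \<lfloor>K * \<delta> powr (\<theta> - 1)\<rfloor> + 1"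
    have I0: "0 \<le> I" and J0: "1 \<le> J" using \<delta> K by (auto simp: I_def J_def)
    define C where "C = (\<lambda>(i :: int, j :: int). (of_int i * \<delta>, f (of_int i * \<delta>) + of_int j * \<delta>)) ` ({0..I} \<times> {-J..J})"
    have finC: "finite C" by (auto simp: C_def)
    have "?S \<subseteq> (\<Union>c\<in>C. ball c \<epsilon>)"
    proof
      fix p assume "p \<in> ?S"
      then obtain x where x: "p = (x, f x)" "0 \<le> x" "x \<le> 2 * pi" by (auto simp: torus_graph_def)
      define i where "i = \<lfloor>x / \<delta>\<rfloor>"
      define d where "d = f x - f (of_int i * \<delta>)"
      define j where "j = \<lfloor>d / \<delta>\<rfloor>"
      have i1: "of_int i * \<delta> \<le> x" "x < of_int i * \<delta> + \<delta>"
        using floor_divide_lower[OF \<delta>(1), of x] floor_divide_upper[OF \<delta>(1), of x]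
        by (auto simp: i_def distrib_right)
      have i2: "0 \<le> i" "i \<le> I"
        using x \<delta> by (auto simp: i_def I_def intro!: floor_mono divide_right_mono)
      have j1: "of_int j * \<delta> \<le> d" "d < of_int j * \<delta> + \<delta>"
        using floor_divide_lower[OF \<delta>(1), of d] floor_divide_upper[OF \<delta>(1), of d]
        by (auto simp: j_def distrib_right)
      have "\<bar>d\<bar> \<le> K * \<bar>x - of_int i * \<delta>\<bar> powr \<theta>" unfolding d_def by (rule hol)
      also have "\<dots> \<le> K * \<delta> powr \<theta>"
        using i1 \<theta> K \<delta> by (intro mult_left_mono powr_mono2) auto
      also have "\<delta> powr \<theta> = \<delta> powr (\<theta> - 1) * \<delta>"
        using \<delta> by (simp add: powr_diff)
      finally have "\<bar>d / \<delta>\<bar> \<le> K * \<delta> powr (\<theta> - 1)"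
        using \<delta> by (simp add: abs_divide field_simps)
      hence "- J \<le> j" "j \<le> J"
        unfolding J_def j_def by linarith+
      hence c: "(of_int i * \<delta>, f (of_int i * \<delta>) + of_int j * \<delta>) \<in> C"
        unfolding C_def using i2 by (intro image_eqI[of _ _ "(i, j)"]) auto
      have "dist (of_int i * \<delta>, f (of_int i * \<delta>) + of_int j * \<delta>) p
          \<le> dist (of_int i * \<delta>) x + dist (f (of_int i * \<delta>) + of_int j * \<delta>) (f x)"
        unfolding x dist_Pair_Pair by (rule sqrt_sum_squares_le_sum) auto
      also have "\<dots> < \<delta> + \<delta>"
        using i1 j1 by (intro add_strict_mono) (auto simp: dist_real_def d_def)
      finally show "p \<in> (\<Union>c\<in>C. ball c \<epsilon>)"
        using c by (auto simp: \<delta>_def)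
    qed
    hence "covering_number ?S \<epsilon> \<le> card C" by (intro covering_number_le finC)
    also have "card C \<le> card ({0..I} \<times> {-J..J})"
      unfolding C_def by (intro card_image_le) auto
    finally have "real (covering_number ?S \<epsilon>) \<le> real (card ({0..I} \<times> {-J..J}))" by linarith
    also have "\<dots> = (of_int I + 1) * (2 * of_int J + 1)"
      using I0 J0 by (simp add: card_cartesian_product)
    also have "\<dots> \<le> (2 * pi / \<delta> + 1 / \<delta>) * (2 * (K * \<delta> powr (\<theta> - 1)) + 3 * \<delta> powr (\<theta> - 1))"
    proof (intro mult_mono)
      show "of_int I + 1 \<le> 2 * pi / \<delta> + 1 / \<delta>"
        using \<delta> unfolding I_def by (intro add_mono of_int_floor_le) (auto simp: field_simps)
      have "1 \<le> \<delta> powr (\<theta> - 1)"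
        using \<delta> \<theta> powr_mono2'[of "\<theta> - 1" \<delta> 1] by auto
      thus "2 * of_int J + 1 \<le> 2 * (K * \<delta> powr (\<theta> - 1)) + 3 * \<delta> powr (\<theta> - 1)"
        unfolding J_def using of_int_floor_le[of "K * \<delta> powr (\<theta> - 1)"]
        unfolding of_int_add of_int_1 by argo
    qed (use \<delta> J0 in auto)
    also have "\<dots> = A * (\<delta> powr (\<theta> - 1) / \<delta>)"
    proof -
      have "2 * pi / \<delta> + 1 / \<delta> = (2 * pi + 1) / \<delta>" by (simp add: add_divide_distrib)
      moreover have "2 * (K * \<delta> powr (\<theta> - 1)) + 3 * \<delta> powr (\<theta> - 1) = (2 * K + 3) * \<delta> powr (\<theta> - 1)"
        by (simp add: distrib_right)
      ultimately show ?thesis by (simp add: A_def)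
    qed
    also have "\<delta> powr (\<theta> - 1) / \<delta> = \<delta> powr (\<theta> - 1 - 1)"
      using \<delta> by (simp only: powr_diff powr_one)
    finally show ?thesis by (simp add: \<delta>_def)
  qed
  let ?g = "\<lambda>\<epsilon>. (ln A + (2 - \<theta>) * ln 2) / ln (1 / \<epsilon>) + (2 - \<theta>)"
  have le: "ln (real (covering_number ?S \<epsilon>)) / ln (1 / \<epsilon>) \<le> ?g \<epsilon>" if \<epsilon>: "0 < \<epsilon>" "\<epsilon> < 1" for \<epsilon>
  proof -
    have L: "ln (1 / \<epsilon>) > 0" using \<epsilon> by simp
    have p1: "1 \<le> (\<epsilon> / 2) powr (\<theta> - 2)"
      using \<epsilon> \<theta> powr_mono2'[of "\<theta> - 2" "\<epsilon> / 2" 1] by auto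
    have "ln (real (covering_number ?S \<epsilon>)) \<le> ln (A * (\<epsilon> / 2) powr (\<theta> - 2))"
    \<comment> \<open>As \<open>ln 0 = 0\<close> by convention, a vanishing count has to be compared
      separately, with a logarithm that is nonnegative because A >= 1.\<close>
    proof (cases "covering_number ?S \<epsilon> = 0")
      case True
      have "1 * 1 \<le> A * (\<epsilon> / 2) powr (\<theta> - 2)" using A p1 by (intro mult_mono) auto
      thus ?thesis using True by simp
    next
      case False
      have "0 < A * (\<epsilon> / 2) powr (\<theta> - 2)" using A \<epsilon> by (intro mult_pos_pos) auto
      thus ?thesis using cov[OF \<epsilon>] False by (subst ln_le_cancel_iff) auto
    qed
    also have "\<dots> = ln A + (\<theta> - 2) * (ln \<epsilon> - ln 2)"
      using A \<epsilon> by (simp add: ln_mult ln_powr ln_div)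
    also have "\<dots> = ln A + (2 - \<theta>) * ln 2 + (2 - \<theta>) * ln (1 / \<epsilon>)"
      using \<epsilon> by (simp add: ln_div algebra_simps)
    finally show ?thesis using L by (simp add: field_simps)
  qed
  have "((\<lambda>\<epsilon>. (ln A + (2 - \<theta>) * ln 2) / ln (1 / \<epsilon>) + (2 - \<theta>)) \<longlongrightarrow> 0 + (2 - \<theta>)) (at_right 0)"
    by (intro tendsto_add tendsto_const tendsto_divide_0[OF tendsto_const]
        filterlim_at_top_imp_at_infinity ln_inverse_at_right_0)
  hence lim: "((\<lambda>\<epsilon>. ereal (?g \<epsilon>)) \<longlongrightarrow> ereal (2 - \<theta>)) (at_right 0)" by simp
  have "upper_minkowski_dim ?S
      = Limsup (at_right 0) (\<lambda>\<epsilon>. ereal (ln (real (covering_number ?S \<epsilon>)) / ln (1 / \<epsilon>)))"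
    using bnd by (simp add: upper_minkowski_dim_def)
  also have "\<dots> \<le> Limsup (at_right 0) (\<lambda>\<epsilon>. ereal (?g \<epsilon>))"
  proof (rule Limsup_mono)
    have "eventually (\<lambda>\<epsilon>::real. \<epsilon> \<in> {0<..<1}) (at_right 0)"
      by (rule eventually_at_right_real) simp
    thus "\<forall>\<^sub>F \<epsilon> in at_right 0. ereal (ln (real (covering_number ?S \<epsilon>)) / ln (1 / \<epsilon>)) \<le> ereal (?g \<epsilon>)"
      by (rule eventually_mono) (use le in auto)
  qed
  also have "\<dots> = ereal (2 - \<theta>)"
    by (rule lim_imp_Limsup[OF _ lim]) simp
  finally show ?thesis .
qed

text \<open>The values of \<open>f\<close> on \<open>[x, x + h]\<close> fill the interval between \<open>f x\<close> and \<open>f (x + h)\<close>, so the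
  balls of a cover of the graph that meet this strip project onto it.\<close>

lemma oscillation_le_cover:
  fixes f :: "real \<Rightarrow> real"
  assumes f: "continuous_on UNIV f" and h: "h > 0" and C: "finite C"
    and cov: "torus_graph f \<subseteq> (\<Union>c\<in>C. ball c h)" and x: "0 \<le> x" "x + h \<le> 2 * pi"
  shows "\<bar>f (x + h) - f x\<bar> \<le> (\<Sum>c\<in>C. 2 * h * indicator {fst c - 2 * h<..<fst c + 2 * h} x)"
proof -
  define lo where "lo = min (f x) (f (x + h))"
  define hi where "hi = max (f x) (f (x + h))"
  \<comment> \<open>Half-width 2 h: a centre lies within h of the abscissa of any graph point in its
    ball, and that abscissa lies within h of \<open>x\<close>.\<close>
  define C' where "C' = {c\<in>C. x \<in> {fst c - 2 * h<..<fst c + 2 * h}}"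
  have C': "finite C'" using C by (simp add: C'_def)
  have sub: "{lo..hi} \<subseteq> (\<Union>c\<in>C'. {snd c - h<..<snd c + h})"
  proof
    fix y assume y: "y \<in> {lo..hi}"
    have "connected (f ` {x..x + h})"
      using f by (intro connected_continuous_image) (auto intro: continuous_on_subset)
    moreover have "lo \<in> f ` {x..x + h}" "hi \<in> f ` {x..x + h}"
      using h by (auto simp: lo_def hi_def min_def max_def)
    ultimately have "y \<in> f ` {x..x + h}"
      using y connected_contains_Icc by blast
    then obtain z where z: "x \<le> z" "z \<le> x + h" "y = f z" by auto
    hence "(z, f z) \<in> torus_graph f" using x by (auto simp: torus_graph_def)
    then obtain c where c: "c \<in> C" "dist c (z, f z) < h" using cov by auto
    have "dist (fst c) z \<le> dist c (z, f z)" "dist (snd c) (f z) \<le> dist c (z, f z)"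
      using dist_fst_le[of c "(z, f z)"] dist_snd_le[of c "(z, f z)"] by auto
    hence "\<bar>fst c - z\<bar> < h" "\<bar>snd c - f z\<bar> < h"
      using c by (auto simp: dist_real_def)
    thus "y \<in> (\<Union>c\<in>C'. {snd c - h<..<snd c + h})"
      using z c by (intro UN_I[of c]) (auto simp: C'_def abs_less_iff)
  qed
  have "\<bar>f (x + h) - f x\<bar> = measure lebesgue {lo..hi}"
    by (auto simp: lo_def hi_def)
  also have "\<dots> \<le> measure lebesgue (\<Union>c\<in>C'. {snd c - h<..<snd c + h})"
    using C' by (intro measure_mono_fmeasurable sub) (auto intro!: fmeasurable.finite_UN)
  also have "\<dots> \<le> (\<Sum>c\<in>C'. measure lebesgue {snd c - h<..<snd c + h})"
    by (intro measure_UNION_le C') auto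
  also have "\<dots> = (\<Sum>c\<in>C'. 2 * h)" using h by simp
  also have "\<dots> = (\<Sum>c\<in>C. 2 * h * indicator {fst c - 2 * h<..<fst c + 2 * h} x)"
    unfolding C'_def sum.inter_filter[OF C] by (intro sum.cong refl) (simp add: indicator_def)
  finally show ?thesis .
qed

text \<open>When \<open>oscillation_le_cover\<close> is integrated, each ball counts with height 2 h
  on an interval of length at most 4 h, whence 8 h^2 per ball. The range stops at 2 pi - h because
  the graph spans one period only.\<close>

lemma integral_translation_le_cover:
  fixes f :: "real \<Rightarrow> real"
  assumes f: "continuous_on UNIV f" and h: "h > 0" and C: "finite C"
    and cov: "torus_graph f \<subseteq> (\<Union>c\<in>C. ball c h)"
  shows "integral {0..2 * pi - h} (\<lambda>x. \<bar>f (x + h) - f x\<bar>) \<le> 8 * h\<^sup>2 * real (card C)"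
proof -
  let ?I = "{0..2 * pi - h}"
  let ?A = "\<lambda>c :: real \<times> real. {fst c - 2 * h<..<fst c + 2 * h}"
  have lm: "?A c \<inter> ?I \<in> lmeasurable" for c
    by (intro fmeasurable_Int_fmeasurable) auto
  have ind: "(indicator (?A c) :: real \<Rightarrow> real) integrable_on ?I"
      "integral ?I (indicator (?A c) :: real \<Rightarrow> real) \<le> 4 * h" for c
  proof -
    show "(indicator (?A c) :: real \<Rightarrow> real) integrable_on ?I"
      using lm integrable_on_indicator by blast
    have "integral ?I (indicator (?A c) :: real \<Rightarrow> real) = measure lebesgue (?A c \<inter> ?I)"
      by (rule integral_indicator[OF lm])
    also have "\<dots> \<le> measure lebesgue (?A c)" by (intro measure_mono_fmeasurable) auto
    also have "\<dots> = 4 * h" using h by simp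
    finally show "integral ?I (indicator (?A c) :: real \<Rightarrow> real) \<le> 4 * h" .
  qed
  have "continuous_on UNIV (\<lambda>x. f (x + h))"
    by (rule continuous_on_compose2[OF f]) (auto intro!: continuous_intros)
  hence "continuous_on ?I (\<lambda>x. \<bar>f (x + h) - f x\<bar>)"
    by (intro continuous_intros) (auto intro: continuous_on_subset f continuous_on_subset[OF f])
  hence int: "(\<lambda>x. \<bar>f (x + h) - f x\<bar>) integrable_on ?I"
    by (rule integrable_continuous_real)
  have "(\<lambda>x. 2 * h * indicator (?A c) x) integrable_on ?I" for c
    using ind by (intro integrable_on_mult_right)
  hence int': "(\<lambda>x. \<Sum>c\<in>C. 2 * h * indicator (?A c) x) integrable_on ?I"
    using C by (intro integrable_sum)
  have "integral ?I (\<lambda>x. \<bar>f (x + h) - f x\<bar>)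
      \<le> integral ?I (\<lambda>x. \<Sum>c\<in>C. 2 * h * indicator (?A c) x)"
    by (rule integral_le[OF int int'], rule oscillation_le_cover[OF f h C cov]) auto
  also have "\<dots> = (\<Sum>c\<in>C. 2 * h * integral ?I (indicator (?A c)))"
    using C \<open>\<And>c. (\<lambda>x. 2 * h * indicator (?A c) x) integrable_on ?I\<close>
    by (subst integral_sum) auto
  also have "\<dots> \<le> (\<Sum>c\<in>C. 2 * h * (4 * h))"
    using ind(2) h by (intro sum_mono mult_left_mono) auto
  also have "\<dots> = 8 * h\<^sup>2 * real (card C)" by (simp add: power2_eq_square)
  finally show ?thesis .
qed

text \<open>A limsup strictly below d yields, for all small h, a cover by at most h^(-d) balls of
  radius h; this radius also serves as the length of the translation.\<close>

lemma upper_minkowski_dim_less_imp_translation: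
  fixes f :: "real \<Rightarrow> real"
  assumes f: "continuous_on UNIV f" and dim: "upper_minkowski_dim (torus_graph f) < ereal d"
  shows "\<forall>\<^sub>F h in at_right 0.
    integral {0..2 * pi - h} (\<lambda>x. \<bar>f (x + h) - f x\<bar>) \<le> 8 * h powr (2 - d)"
proof -
  let ?S = "torus_graph f"
  have comp: "compact ?S" unfolding torus_graph_def
    by (intro compact_continuous_image continuous_intros) (auto intro: continuous_on_subset[OF f])
  have "Limsup (at_right 0) (\<lambda>\<epsilon>. ereal (ln (real (covering_number ?S \<epsilon>)) / ln (1 / \<epsilon>))) < ereal d"
    using dim compact_imp_bounded[OF comp] by (simp add: upper_minkowski_dim_def)
  hence "\<forall>\<^sub>F \<epsilon> in at_right 0. ereal (ln (real (covering_number ?S \<epsilon>)) / ln (1 / \<epsilon>)) < ereal d"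
    by (rule Limsup_lessD)
  moreover have "eventually (\<lambda>\<epsilon>::real. \<epsilon> \<in> {0<..<1}) (at_right 0)"
    by (rule eventually_at_right_real) simp
  ultimately show ?thesis
  proof eventually_elim
    case (elim h)
    hence h: "0 < h" "h < 1" by auto
    have L: "ln (1 / h) > 0" using h by simp
    obtain C where C: "finite C" "card C = covering_number ?S h" "?S \<subseteq> (\<Union>c\<in>C. ball c h)"
      using covering_number_attained[OF comp h(1)] by blast
    have "real (card C) \<le> h powr (- d)"
    proof (cases "card C = 0")
      case False
      have "ln (real (card C)) < d * ln (1 / h)"
        using elim L by (simp add: C(2) pos_divide_less_eq)
      also have "\<dots> = ln (h powr (- d))" using h by (simp add: ln_powr ln_div)
      finally show ?thesis using False h by (subst (asm) ln_less_cancel_iff) auto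
    qed simp
    have "integral {0..2 * pi - h} (\<lambda>x. \<bar>f (x + h) - f x\<bar>) \<le> 8 * h\<^sup>2 * real (card C)"
      by (rule integral_translation_le_cover[OF f h(1) C(1,3)])
    also have "\<dots> \<le> 8 * h\<^sup>2 * h powr (- d)"
      using \<open>real (card C) \<le> h powr (- d)\<close> by (intro mult_left_mono) auto
    also have "\<dots> = 8 * h powr (2 - d)"
      using h by (simp add: powr_diff powr_minus divide_inverse)
    finally show ?case .
  qed
qed

section \<open>Normal form for smooth solutions\<close>

lemma has_integral_norm_le:
  fixes f :: "real \<Rightarrow> 'a::real_normed_vector"
  assumes "(f has_integral i) {a..b}" "a \<le> b" "0 \<le> B" "\<And>x. x \<in> {a..b} \<Longrightarrow> norm (f x) \<le> B"
  shows "norm i \<le> B * (b - a)"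
  using has_integral_bound_real[of B "{}" f i a b] assms by simp

lemma one_le_abs_of_int: "k \<noteq> 0 \<Longrightarrow> 1 \<le> \<bar>real_of_int k\<bar>"
  using of_int_le_iff[of 1 "\<bar>k\<bar>", where 'a = real] by simp

text \<open>The derivatives are carried as functions \<open>V\<close>, continuous up to the initial
  time, where only one-sided time derivatives exist. Of the parameter it is \<alpha> <= 1 that the
  lower bound for the phase consumes.\<close>

locale kawahara_smooth =
  fixes \<alpha> :: real and v :: "real \<Rightarrow> real \<Rightarrow> real" and V :: "nat \<Rightarrow> nat \<Rightarrow> real \<Rightarrow> real \<Rightarrow> real"
  assumes alpha: "\<alpha> \<le> 1"
    and V0: "\<And>t x. t \<ge> 0 \<Longrightarrow> V 0 0 t x = v t x"
    and V_cont: "\<And>j k. continuous_on ({0..} \<times> UNIV) (\<lambda>(t, x). V j k t x)"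
    and V_t: "\<And>j k t x. t \<ge> 0 \<Longrightarrow> ((\<lambda>s. V j k s x) has_real_derivative V (Suc j) k t x) (at t within {0..})"
    and V_x: "\<And>j k t x. t \<ge> 0 \<Longrightarrow> (V j k t has_real_derivative V j (Suc k) t x) (at x)"
    and periodic: "\<And>t x. t \<ge> 0 \<Longrightarrow> v t (x + 2 * pi) = v t x"
    and equation: "\<And>t x. t > 0 \<Longrightarrow> V 1 0 t x + V 0 5 t x + \<alpha> * V 0 3 t x + v t x * V 0 1 t x = 0"

lemma kawahara_smoothI:
  assumes "\<alpha> \<le> 1" "kawahara_smooth_solution \<alpha> h v"
  shows "\<exists>V. kawahara_smooth \<alpha> v V"
proof -
  from assms(2) obtain V :: "nat \<Rightarrow> nat \<Rightarrow> real \<Rightarrow> real \<Rightarrow> real" where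
    V0: "\<forall>t\<in>{0..}. \<forall>x. V 0 0 t x = v t x" and
    Vc: "\<forall>j k. continuous_on ({0..} \<times> UNIV) (\<lambda>(t, x). V j k t x)" and
    Vd: "\<forall>j k. \<forall>t\<in>{0..}. \<forall>x.
           ((\<lambda>s. V j k s x) has_real_derivative V (Suc j) k t x) (at t within {0..}) \<and>
           (V j k t has_real_derivative V j (Suc k) t x) (at x)"
    unfolding kawahara_smooth_solution_def smooth_spacetime_def by blast
  have x: "(deriv ^^ k) (v t) = V 0 k t" if "t \<ge> 0" for k t
  proof (induction k)
    case 0
    show ?case using V0 that by auto
  next
    case (Suc k)
    have "deriv (V 0 k t) x = V 0 (Suc k) t x" for x
      using Vd that by (intro DERIV_imp_deriv) auto
    thus ?case using Suc by auto
  qed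
  have t: "deriv (\<lambda>s. v s x) t = V 1 0 t x" if "t > 0" for t x
  proof (rule DERIV_imp_deriv)
    have "at t within {0..} = at t"
      using that by (intro at_within_open_subset[of _ "{0<..}"]) auto
    hence "((\<lambda>s. V 0 0 s x) has_real_derivative V 1 0 t x) (at t)"
      using Vd that by (metis One_nat_def atLeast_iff less_imp_le)
    moreover have "\<forall>\<^sub>F s in nhds t. V 0 0 s x = v s x"
      using eventually_nhds_in_open[of "{0<..}" t] that V0 by (auto elim!: eventually_mono)
    ultimately show "((\<lambda>s. v s x) has_real_derivative V 1 0 t x) (at t)"
      using DERIV_cong_ev[of t t "\<lambda>s. V 0 0 s x" "\<lambda>s. v s x" "V 1 0 t x" "V 1 0 t x"] by simp
  qed
  have "kawahara_smooth \<alpha> v V"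
  proof
    show "\<alpha> \<le> 1" by (rule assms)
    show "V 0 0 t x = v t x" if "t \<ge> 0" for t x using V0 that by auto
    show "continuous_on ({0..} \<times> UNIV) (\<lambda>(t, x). V j k t x)" for j k using Vc by blast
    show "((\<lambda>s. V j k s x) has_real_derivative V (Suc j) k t x) (at t within {0..})"
      "(V j k t has_real_derivative V j (Suc k) t x) (at x)" if "t \<ge> 0" for j k t x
      using Vd that by auto
    show "v t (x + 2 * pi) = v t x" if "t \<ge> 0" for t x
      using assms(2) that by (auto simp: kawahara_smooth_solution_def torus_fun_def)
    show "V 1 0 t x + V 0 5 t x + \<alpha> * V 0 3 t x + v t x * V 0 1 t x = 0" if "t > 0" for t x
    proof -
      have "deriv (\<lambda>s. v s x) t + (deriv ^^ 5) (v t) x + \<alpha> * (deriv ^^ 3) (v t) x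
          + v t x * (deriv ^^ 1) (v t) x = 0"
        using assms(2) that by (simp add: kawahara_smooth_solution_def)
      thus ?thesis unfolding t[OF that] x[OF less_imp_le[OF that]] .
    qed
  qed
  thus ?thesis by blast
qed

context kawahara_smooth
begin

lemma v_eq: "t \<ge> 0 \<Longrightarrow> v t = V 0 0 t"
  using V0 by auto

lemma V_cont_x: "t \<ge> 0 \<Longrightarrow> continuous_on A (V j k t)"
  using V_x by (meson DERIV_continuous_on DERIV_subset subset_UNIV)

lemma V_periodic:
  assumes t: "t \<ge> 0" shows "V 0 k t (x + 2 * pi) = V 0 k t x"
proof (induction k arbitrary: x)
  case 0
  show ?case using V0 periodic t by auto
next
  case (Suc k)
  have "((\<lambda>y. V 0 k t (y + 2 * pi)) has_real_derivative V 0 (Suc k) t (x + 2 * pi)) (at x)"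
    using V_x[OF t] by (rule DERIV_shift[THEN iffD1])
  hence "(V 0 k t has_real_derivative V 0 (Suc k) t (x + 2 * pi)) (at x)"
    using Suc by simp
  thus ?case using V_x[OF t] DERIV_unique by blast
qed

section \<open>Fourier coefficients of a smooth solution and their profiles\<close>

definition a :: "int \<Rightarrow> real \<Rightarrow> complex" where
  "a k t = fourier_coeff (v t) k"

definition q :: "int \<Rightarrow> real \<Rightarrow> complex" where
  "q k t = fourier_coeff (\<lambda>x. (v t x)\<^sup>2) k"

lemma has_integral_parts:
  assumes f: "\<And>x. (f has_real_derivative f' x) (at x)" and per: "f (2 * pi) = f 0"
    and f': "((\<lambda>x. cis (- (of_int k * x)) * of_real (f x)) has_integral I) {0..2 * pi}"
  shows "((\<lambda>x. cis (- (of_int k * x)) * of_real (f' x)) has_integral \<i> * of_int k * I) {0..2 * pi}"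
proof -
  let ?e = "\<lambda>x. cis (of_int (- k) * x)"
  have "((\<lambda>x. ?e x * of_real (f x)) has_vector_derivative
      ?e x * of_real (f' x) + \<i> * of_real (of_int (- k)) * ?e x * of_real (f x)) (at x within {0..2 * pi})" for x
  proof (rule has_vector_derivative_mult)
    have "(f has_real_derivative f' x) (at x within {0..2 * pi})"
      using f by (rule has_field_derivative_at_within)
    thus "((\<lambda>x. complex_of_real (f x)) has_vector_derivative complex_of_real (f' x)) (at x within {0..2 * pi})"
      by (rule has_vector_derivative_of_real)
  qed (rule has_vector_derivative_cis_mult)
  hence "((\<lambda>x. ?e x * of_real (f' x) + \<i> * of_real (of_int (- k)) * ?e x * of_real (f x)) has_integral
      ?e (2 * pi) * of_real (f (2 * pi)) - ?e 0 * of_real (f 0)) {0..2 * pi}"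
    by (intro fundamental_theorem_of_calculus) auto
  moreover have "?e (2 * pi) = 1" "?e 0 = 1" using cis_int_shift[of "- k" 0] by simp_all
  ultimately have "((\<lambda>x. ?e x * of_real (f' x) + \<i> * of_real (of_int (- k)) * ?e x * of_real (f x)) has_integral 0) {0..2 * pi}"
    using per by simp
  from has_integral_add[OF this has_integral_mult_right[OF f', of "\<i> * of_int k"]]
  show ?thesis by (simp add: mult.assoc)
qed

lemma V_has_integral:
  assumes t: "t \<ge> 0"
  shows "((\<lambda>x. cis (- (of_int k * x)) * of_real (V 0 m t x)) has_integral
    (\<i> * of_int k) ^ m * (2 * pi * a k t)) {0..2 * pi}"
proof (induction m)
  case 0
  have "continuous_on {0..2 * pi} (V 0 0 t)" by (rule V_cont_x[OF t])
  from has_integral_fourier_coeff[OF this, of k] show ?case by (simp add: a_def v_eq[OF t])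
next
  case (Suc m)
  have "V 0 m t (2 * pi) = V 0 m t 0" using V_periodic[OF t, of m 0] by simp
  from has_integral_parts[OF V_x[OF t] this Suc] show ?case by (simp add: mult.assoc)
qed

lemma nonlinearity_has_integral:
  assumes t: "t \<ge> 0"
  shows "((\<lambda>x. cis (- (of_int k * x)) * of_real (v t x * V 0 1 t x)) has_integral
    (\<i> * of_int k / 2) * (2 * pi * q k t)) {0..2 * pi}"
proof -
  have d: "((\<lambda>x. (v t x)\<^sup>2) has_real_derivative 2 * (v t x * V 0 1 t x)) (at x)" for x
    unfolding v_eq[OF t] using V_x[OF t, of 0 0 x]
    by (auto intro!: derivative_eq_intros)
  have p: "(v t (2 * pi))\<^sup>2 = (v t 0)\<^sup>2" using periodic[OF t, of 0] by simp
  have "continuous_on {0..2 * pi} (\<lambda>x. (v t x)\<^sup>2)"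
    unfolding v_eq[OF t] by (intro continuous_intros V_cont_x t)
  from has_integral_parts[OF d p has_integral_fourier_coeff[OF this]]
  have "((\<lambda>x. cis (- (of_int k * x)) * of_real (2 * (v t x * V 0 1 t x))) has_integral
      \<i> * of_int k * (2 * pi * q k t)) {0..2 * pi}" by (simp add: q_def)
  from has_integral_mult_right[OF this, of "1 / 2"] show ?thesis by (simp add: mult_ac)
qed

lemma a_time_derivative:
  assumes t: "t \<ge> 0"
  shows "((\<lambda>s. a k s) has_vector_derivative
    integral {0..2 * pi} (\<lambda>x. cis (- (of_int k * x)) * of_real (V 1 0 t x)) / (2 * pi)) (at t within {0..})"
proof -
  let ?e = "\<lambda>x. cis (- (of_int k * x))"
  have "((\<lambda>s. integral (cbox 0 (2 * pi)) (\<lambda>x. ?e x * of_real (V 0 0 s x))) has_vector_derivative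
      integral (cbox 0 (2 * pi)) (\<lambda>x. ?e x * of_real (V 1 0 t x))) (at t within {0..})"
  proof (rule leibniz_rule_vector_derivative)
    fix s x :: real assume s: "s \<in> {0..}"
    have "((\<lambda>s. V 0 0 s x) has_real_derivative V 1 0 s x) (at s within {0..})"
      using V_t[of s 0 0 x] s by simp
    thus "((\<lambda>s. ?e x * of_real (V 0 0 s x)) has_vector_derivative ?e x * of_real (V 1 0 s x)) (at s within {0..})"
      by (intro has_vector_derivative_mult_right has_vector_derivative_of_real)
  next
    fix s :: real assume s: "s \<in> {0..}"
    hence s': "s \<ge> 0" by simp
    show "(\<lambda>x. ?e x * of_real (V 0 0 s x)) integrable_on cbox 0 (2 * pi)"
      by (intro integrable_continuous continuous_intros V_cont_x s')
  next
    have "continuous_on ({0..} \<times> cbox 0 (2 * pi)) (\<lambda>(t, x). V 1 0 t x)"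
      by (rule continuous_on_subset[OF V_cont]) auto
    hence "continuous_on ({0..} \<times> cbox 0 (2 * pi)) (\<lambda>z. V 1 0 (fst z) (snd z))"
      by (simp add: case_prod_unfold)
    thus "continuous_on ({0..} \<times> cbox 0 (2 * pi)) (\<lambda>(s, x). ?e x * of_real (V 1 0 s x))"
      unfolding case_prod_unfold by (intro continuous_intros)
  qed (use t in auto)
  hence d: "((\<lambda>s. integral {0..2 * pi} (\<lambda>x. ?e x * of_real (V 0 0 s x)) / (2 * pi)) has_vector_derivative
      integral {0..2 * pi} (\<lambda>x. ?e x * of_real (V 1 0 t x)) / (2 * pi)) (at t within {0..})"
    by (intro has_vector_derivative_divide) simp
  have eq: "a k s = integral {0..2 * pi} (\<lambda>x. ?e x * of_real (V 0 0 s x)) / (2 * pi)" if "s \<in> {0..}" for s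
    using that by (simp add: a_def v_eq fourier_coeff_continuous V_cont_x)
  show ?thesis
    by (rule has_vector_derivative_transform[OF _ eq d]) (use t in auto)
qed

lemma a_continuous: "continuous_on {0..T} (a k)"
proof -
  have "continuous_on {0..} (a k)"
    by (rule continuous_on_vector_derivative) (use a_time_derivative in auto)
  thus ?thesis by (rule continuous_on_subset) auto
qed

lemma a_equation:
  assumes t: "t > 0"
  shows "(a k has_vector_derivative
    - \<i> * of_real (of_int k ^ 5 - \<alpha> * of_int k ^ 3) * a k t - \<i> * of_int k / 2 * q k t) (at t)"
proof -
  let ?e = "\<lambda>x. cis (- (of_int k * x))"
  have t0: "t \<ge> 0" using t by simp
  have "((\<lambda>x. - (?e x * of_real (V 0 5 t x)) - of_real \<alpha> * (?e x * of_real (V 0 3 t x))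
        - ?e x * of_real (v t x * V 0 1 t x)) has_integral
      - ((\<i> * of_int k) ^ 5 * (2 * pi * a k t)) - of_real \<alpha> * ((\<i> * of_int k) ^ 3 * (2 * pi * a k t))
        - (\<i> * of_int k / 2) * (2 * pi * q k t)) {0..2 * pi}"
    by (intro has_integral_diff has_integral_neg has_integral_mult_right V_has_integral
        nonlinearity_has_integral t0)
  moreover have "(\<lambda>x. - (?e x * of_real (V 0 5 t x)) - of_real \<alpha> * (?e x * of_real (V 0 3 t x))
        - ?e x * of_real (v t x * V 0 1 t x)) = (\<lambda>x. ?e x * of_real (V 1 0 t x))"
  proof
    fix x
    have "V 1 0 t x = - V 0 5 t x - \<alpha> * V 0 3 t x - v t x * V 0 1 t x"
      using equation[OF t, of x] by linarith
    thus "- (?e x * of_real (V 0 5 t x)) - of_real \<alpha> * (?e x * of_real (V 0 3 t x))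
        - ?e x * of_real (v t x * V 0 1 t x) = ?e x * of_real (V 1 0 t x)"
      by (simp only: of_real_diff of_real_minus of_real_mult) (simp add: algebra_simps)
  qed
  ultimately have "integral {0..2 * pi} (\<lambda>x. ?e x * of_real (V 1 0 t x)) / (2 * pi)
      = (- ((\<i> * of_int k) ^ 5 * (2 * pi * a k t)) - of_real \<alpha> * ((\<i> * of_int k) ^ 3 * (2 * pi * a k t))
        - (\<i> * of_int k / 2) * (2 * pi * q k t)) / (2 * pi)"
    by (simp add: integral_unique)
  also have "\<dots> = - ((\<i> * of_int k) ^ 5 * a k t) - of_real \<alpha> * ((\<i> * of_int k) ^ 3 * a k t)
        - (\<i> * of_int k / 2) * q k t"
    by (simp add: field_simps)
  \<comment> \<open>The fifth and third powers of \<i> have opposite signs, which produces the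
    combination k^5 - \<alpha> k^3.\<close>
  also have "(\<i> * of_int k) ^ 5 = \<i> * of_int k ^ 5"
  proof -
    have "\<i> ^ 5 = \<i>" by (simp add: eval_nat_numeral)
    thus ?thesis by (simp only: power_mult_distrib)
  qed
  also have "(\<i> * of_int k) ^ 3 = - \<i> * of_int k ^ 3"
  proof -
    have "\<i> ^ 3 = - \<i>" by (simp add: eval_nat_numeral)
    thus ?thesis by (simp only: power_mult_distrib)
  qed
  also have "- (\<i> * of_int k ^ 5 * a k t) - of_real \<alpha> * (- \<i> * of_int k ^ 3 * a k t) - \<i> * of_int k / 2 * q k t
      = - \<i> * of_real (of_int k ^ 5 - \<alpha> * of_int k ^ 3) * a k t - \<i> * of_int k / 2 * q k t"
    by (simp add: algebra_simps)
  finally show ?thesis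
    using a_time_derivative[OF t0, of k] t
    by (subst (asm) at_within_open_subset[of t "{0<..}" "{0..}"]) auto
qed

definition c :: real where "c = Re (a 0 0)"

text \<open>The interactions with the conserved zero mode contribute the drift term \<open>c * k\<close>.\<close>

definition \<Omega> :: "int \<Rightarrow> real" where
  "\<Omega> k = of_int k ^ 5 - \<alpha> * of_int k ^ 3 + c * of_int k"

text \<open>At k = 0 both terms of \<open>a_equation\<close> carry a factor k. The value is real
  because the solution is.\<close>

lemma mean_conserved:
  assumes "t \<ge> 0" shows "a 0 t = of_real c"
proof -
  have "((\<lambda>_. 0) has_integral a 0 t - a 0 0) {0..t}"
  proof (rule fundamental_theorem_of_calculus_interior[OF assms a_continuous])
    show "(a 0 has_vector_derivative 0) (at x)" if "x \<in> {0<..<t}" for x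
      using a_equation[of x 0] that by simp
  qed
  hence "a 0 t = a 0 0" using has_integral_unique[OF has_integral_0] by fastforce
  moreover have "a 0 0 = of_real c"
  proof -
    have "cnj (a 0 0) = a 0 0"
      unfolding a_def v_eq[OF order_refl] fourier_coeff_continuous[OF V_cont_x[OF order_refl]]
      by (simp add: integral_cnj)
    thus ?thesis by (simp add: c_def complex_eq_iff)
  qed
  ultimately show ?thesis by simp
qed

definition b :: "int \<Rightarrow> real \<Rightarrow> complex" where
  "b k t = cis (\<Omega> k * t) * a k t"

text \<open>\<open>q k\<close> is the convolution of \<open>a\<close> with itself. For nonzero
  \<open>k\<close> the term \<open>2 * of_real c * a k\<close> consists of its two pairs with the
  zero mode, whose phase would vanish; the drift in \<Omega> produces exactly this subtraction when
  \<open>b\<close> is differentiated.\<close>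

definition G :: "int \<Rightarrow> real \<Rightarrow> complex" where
  "G k t = - (\<i> * of_int k / 2) * (cis (\<Omega> k * t) * (q k t - 2 * of_real c * a k t))"

lemma b_derivative:
  assumes "t > 0" shows "(b k has_vector_derivative G k t) (at t)"
proof -
  have "((\<lambda>t. cis (\<Omega> k * t) * a k t) has_vector_derivative
      cis (\<Omega> k * t) * (- \<i> * of_real (of_int k ^ 5 - \<alpha> * of_int k ^ 3) * a k t - \<i> * of_int k / 2 * q k t)
      + \<i> * of_real (\<Omega> k) * cis (\<Omega> k * t) * a k t) (at t)"
    by (intro has_vector_derivative_mult a_equation assms has_vector_derivative_cis_mult)
  moreover have "cis (\<Omega> k * t) * (- \<i> * of_real (of_int k ^ 5 - \<alpha> * of_int k ^ 3) * a k t - \<i> * of_int k / 2 * q k t)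
      + \<i> * of_real (\<Omega> k) * cis (\<Omega> k * t) * a k t = G k t"
    unfolding G_def \<Omega>_def by (simp add: algebra_simps)
  ultimately show ?thesis unfolding b_def[abs_def] by simp
qed

lemma b_continuous: "continuous_on {0..T} (b k)"
  unfolding b_def[abs_def] by (intro continuous_intros a_continuous)

lemma V_bounded: "\<exists>B\<ge>0. \<forall>t\<in>{0..T}. \<forall>x\<in>{0..2 * pi}. \<bar>V j k t x\<bar> \<le> B"
proof -
  have "continuous_on ({0..T} \<times> {0..2 * pi}) (\<lambda>(t, x). V j k t x)"
    by (rule continuous_on_subset[OF V_cont]) auto
  hence "bounded ((\<lambda>(t, x). V j k t x) ` ({0..T} \<times> {0..2 * pi}))"
    by (intro compact_imp_bounded compact_continuous_image compact_Times) auto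
  then obtain B where B: "\<forall>t\<in>{0..T}. \<forall>x\<in>{0..2 * pi}. \<bar>V j k t x\<bar> \<le> B"
    unfolding bounded_iff by auto
  have "\<bar>V j k t x\<bar> \<le> max B 0" if "t \<in> {0..T}" "x \<in> {0..2 * pi}" for t x
    using B that by (meson max.coboundedI1)
  thus ?thesis by (intro exI[of _ "max B 0"]) auto
qed

text \<open>A qualitative bound: its constant depends on second derivatives of the smooth solution.
  It serves to send the truncation error in \<open>smoothing_estimate\<close> to 0 and therefore
  does not reach the final estimate.\<close>

lemma a_decay: "\<exists>C. \<forall>t\<in>{0..T}. \<forall>k. k \<noteq> 0 \<longrightarrow> cmod (a k t) \<le> C / (of_int k)\<^sup>2"
proof -
  obtain B where B: "B \<ge> 0" "\<And>t x. t \<in> {0..T} \<Longrightarrow> x \<in> {0..2 * pi} \<Longrightarrow> \<bar>V 0 2 t x\<bar> \<le> B"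
    using V_bounded[of T 0 2] by blast
  show ?thesis
  proof (intro exI ballI allI impI)
    fix t k assume t: "t \<in> {0..T}" and k: "(k :: int) \<noteq> 0"
    have "cmod ((\<i> * of_int k) ^ 2 * (2 * pi * a k t)) \<le> B * (2 * pi - 0)"
    proof (rule has_integral_norm_le[OF _ _ B(1)])
      show "((\<lambda>x. cis (- (of_int k * x)) * of_real (V 0 2 t x)) has_integral
          (\<i> * of_int k) ^ 2 * (2 * pi * a k t)) {0..2 * pi}"
        using t by (intro V_has_integral) auto
    qed (use B(2)[OF t] in \<open>auto simp: norm_mult\<close>)
    hence "(of_int k)\<^sup>2 * cmod (a k t) \<le> B"
      by (simp add: norm_mult norm_power)
    thus "cmod (a k t) \<le> B / (of_int k)\<^sup>2" using k by (simp add: field_simps)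
  qed
qed

end

lemma sum_abs_powr_le:
  fixes A :: "int set"
  assumes "finite A" "0 \<notin> A"
  shows "(\<Sum>j\<in>A. \<bar>of_int j\<bar> powr (- 3 / 2)) \<le> 2 * (\<Sum>n. real n powr (- 3 / 2))"
proof -
  let ?f = "\<lambda>n. real n powr (- 3 / 2)"
  have sm: "summable ?f" by (subst summable_real_powr_iff) simp
  have le: "(\<Sum>j\<in>B. \<bar>of_int j\<bar> powr (- 3 / 2)) \<le> suminf ?f"
    if B: "finite B" and inj: "inj_on (\<lambda>j. nat \<bar>j\<bar>) B" for B :: "int set"
  proof -
    have "(\<Sum>j\<in>B. \<bar>of_int j\<bar> powr (- 3 / 2)) = (\<Sum>n\<in>(\<lambda>j. nat \<bar>j\<bar>) ` B. ?f n)"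
      by (subst sum.reindex[OF inj]) simp
    also have "\<dots> \<le> suminf ?f" using B sm by (intro sum_le_suminf) auto
    finally show ?thesis .
  qed
  have "A = {j\<in>A. j > 0} \<union> {j\<in>A. \<not> j > 0}" by auto
  hence "(\<Sum>j\<in>A. \<bar>of_int j\<bar> powr (- 3 / 2)) = (\<Sum>j\<in>{j\<in>A. j > 0}. \<bar>of_int j\<bar> powr (- 3 / 2))
      + (\<Sum>j\<in>{j\<in>A. \<not> j > 0}. \<bar>of_int j\<bar> powr (- 3 / 2))"
    using assms(1) by (subst sum.union_disjoint[symmetric]) auto
  also have "\<dots> \<le> suminf ?f + suminf ?f"
    using assms(1) by (intro add_mono le inj_onI) auto
  finally show ?thesis by simp
qed

text \<open>The form is half of (j + l)^2 + j^2 + l^2, hence at least half the square of the larger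
  of |j + l| and |j|. The powers are split so that a further division by |j| leaves the summable
  exponent -3/2 on the input frequency and -3/2 on the output frequency.\<close>

lemma quadratic_form_ge:
  fixes j l :: real
  shows "\<bar>j + l\<bar> powr (3 / 2) * \<bar>j\<bar> powr (1 / 2) / 2 \<le> j\<^sup>2 + j * l + l\<^sup>2"
proof -
  define m where "m = max \<bar>j + l\<bar> \<bar>j\<bar>"
  have "\<bar>j + l\<bar> powr (3 / 2) * \<bar>j\<bar> powr (1 / 2) \<le> m powr (3 / 2) * m powr (1 / 2)"
    by (intro mult_mono powr_mono2) (auto simp: m_def)
  also have "\<dots> = m\<^sup>2" by (cases "m = 0") (auto simp: powr_add[symmetric] m_def)
  also have "\<dots> \<le> (j + l)\<^sup>2 + j\<^sup>2" unfolding m_def max_def by (auto)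
  also have "\<dots> \<le> 2 * (j\<^sup>2 + j * l + l\<^sup>2)"
    using zero_le_power2[of l] by (simp add: power2_eq_square algebra_simps)
  finally show ?thesis by simp
qed

section \<open>Resonance function and integration by parts in time\<close>

context kawahara_smooth
begin

lemma resonance:
  "\<Omega> (j + l) - \<Omega> j - \<Omega> l = of_int (j + l) * of_int j * of_int l
     * (5 * of_int (j\<^sup>2 + j * l + l\<^sup>2) - 3 * \<alpha>)"
  unfolding \<Omega>_def of_int_add of_int_mult of_int_power by algebra

text \<open>A positive definite form with integer values is at least 1 when \<open>j\<close> is
  nonzero, and 5 X - 3 \<alpha> >= 2 X as soon as X >= 1 and \<alpha> <= 1.\<close>

lemma resonance_ge:
  assumes "j \<noteq> 0"
  shows "\<bar>\<Omega> (j + l) - \<Omega> j - \<Omega> l\<bar>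
    \<ge> \<bar>of_int (j + l)\<bar> * \<bar>of_int j\<bar> * \<bar>of_int l\<bar> * (2 * ((of_int j)\<^sup>2 + of_int j * of_int l + (of_int l)\<^sup>2))"
proof -
  have "0 < 3 * j\<^sup>2 + (j + 2 * l)\<^sup>2" using assms by (intro add_pos_nonneg) auto
  also have "\<dots> = 4 * (j\<^sup>2 + j * l + l\<^sup>2)" by (simp add: power2_eq_square algebra_simps)
  finally have "1 \<le> j\<^sup>2 + j * l + l\<^sup>2" by simp
  hence "(1 :: real) \<le> of_int (j\<^sup>2 + j * l + l\<^sup>2)" by (simp only: of_int_1_le_iff)
  moreover have "2 * X \<le> \<bar>5 * X - 3 * \<alpha>\<bar>" if "1 \<le> X" for X :: real
    using alpha that by linarith
  ultimately have "2 * of_int (j\<^sup>2 + j * l + l\<^sup>2) \<le> \<bar>5 * of_int (j\<^sup>2 + j * l + l\<^sup>2) - 3 * \<alpha>\<bar>"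
    by blast
  hence "\<bar>of_int (j + l)\<bar> * \<bar>of_int j\<bar> * \<bar>of_int l\<bar> * (2 * of_int (j\<^sup>2 + j * l + l\<^sup>2))
      \<le> \<bar>of_int (j + l)\<bar> * \<bar>of_int j\<bar> * \<bar>of_int l\<bar> * \<bar>5 * of_int (j\<^sup>2 + j * l + l\<^sup>2) - 3 * \<alpha>\<bar>"
    by (intro mult_left_mono) auto
  thus ?thesis unfolding resonance by (simp add: abs_mult)
qed

context
  fixes T M :: real
  assumes T: "T \<ge> 0" and M: "\<And>t. 0 \<le> t \<Longrightarrow> t \<le> T \<Longrightarrow> L2_norm_torus (v t) \<le> M"
begin

lemma a_le: assumes "0 \<le> t" "t \<le> T" shows "cmod (a k t) \<le> M"
proof -
  have "v t \<in> borel_measurable borel"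
    unfolding v_eq[OF assms(1)] by (intro borel_measurable_continuous_onI V_cont_x assms)
  hence "v t \<in> borel_measurable lebesgue" by (intro measurable_completion) simp
  moreover have "set_integrable lebesgue {0..2 * pi} (\<lambda>x. (v t x)\<^sup>2)"
    unfolding v_eq[OF assms(1)]
    by (intro absolutely_integrable_continuous_real continuous_intros V_cont_x assms)
  ultimately have "cmod (a k t) \<le> L2_norm_torus (v t)"
    unfolding a_def by (rule fourier_coeff_le_L2_norm)
  thus ?thesis using M[OF assms] by linarith
qed

lemma M0: "M \<ge> 0"
  using a_le[of 0 0] T order_trans[OF norm_ge_zero] by fastforce

lemma q_le: assumes "0 \<le> t" "t \<le> T" shows "cmod (q k t) \<le> M\<^sup>2"
proof -
  let ?I = "integral {0..2 * pi} (\<lambda>x. (v t x)\<^sup>2)"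
  have cont: "continuous_on {0..2 * pi} (\<lambda>x. (v t x)\<^sup>2)"
    unfolding v_eq[OF assms(1)] by (intro continuous_intros V_cont_x assms)
  have I0: "0 \<le> ?I" by (intro integral_nonneg integrable_continuous_real cont) auto
  hence I: "?I = (L2_norm_torus (v t))\<^sup>2" "0 \<le> L2_norm_torus (v t)"
    by (simp_all add: L2_norm_torus_def set_integral_continuous[OF cont])
  have "cmod (integral {0..2 * pi} (\<lambda>x. cis (- (of_int k * x)) * of_real ((v t x)\<^sup>2))) \<le> ?I"
    by (intro integral_norm_bound_integral integrable_continuous_real cont continuous_intros)
      (auto simp: norm_mult norm_power)
  also have "?I \<le> M\<^sup>2" unfolding I(1)
    using M[OF assms] I(2) by (intro power_mono)
  finally have "2 * pi * cmod (q k t) \<le> M\<^sup>2"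
    by (simp add: q_def fourier_coeff_continuous[OF cont] norm_divide)
  moreover have "1 * cmod (q k t) \<le> 2 * pi * cmod (q k t)"
    using pi_gt3 by (intro mult_right_mono) auto
  ultimately show ?thesis by simp
qed

lemma c_le: "\<bar>c\<bar> \<le> M"
  using a_le[of 0 0] T mean_conserved[of 0] by simp

lemma G_le: assumes "0 \<le> t" "t \<le> T" shows "cmod (G k t) \<le> 3 / 2 * M\<^sup>2 * \<bar>of_int k\<bar>"
proof -
  have "cmod (q k t - 2 * of_real c * a k t) \<le> cmod (q k t) + cmod (2 * of_real c * a k t)"
    by (rule norm_triangle_ineq4)
  also have "\<dots> \<le> M\<^sup>2 + 2 * M * M"
    unfolding norm_mult using c_le M0
    by (intro add_mono q_le mult_mono a_le assms) auto
  finally have "\<bar>of_int k\<bar> / 2 * cmod (q k t - 2 * of_real c * a k t) \<le> \<bar>of_int k\<bar> / 2 * (3 * M\<^sup>2)"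
    by (intro mult_left_mono) (auto simp: power2_eq_square)
  thus ?thesis unfolding G_def norm_mult norm_minus_cancel by (simp add: norm_mult norm_divide mult_ac)
qed

lemma b_le: assumes "0 \<le> t" "t \<le> T" shows "cmod (b k t) \<le> M"
  using a_le[OF assms] by (simp add: b_def norm_mult)

text \<open>Integration by parts in time gains the factor \<open>1 / \<Phi>\<close>, the time derivatives of the
  profiles \<open>b\<close> losing only one power of the frequency.\<close>

lemma pair_integral_le:
  assumes "\<Omega> (j + l) - \<Omega> j - \<Omega> l \<noteq> 0"
  shows "cmod (integral {0..T} (\<lambda>t. cis (\<Omega> (j + l) * t) * (a j t * a l t)))
    \<le> (2 * M\<^sup>2 + T * (3 / 2 * M ^ 3) * (\<bar>of_int j\<bar> + \<bar>of_int l\<bar>)) / \<bar>\<Omega> (j + l) - \<Omega> j - \<Omega> l\<bar>"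
proof -
  define \<Phi> where "\<Phi> = \<Omega> (j + l) - \<Omega> j - \<Omega> l"
  define P where "P t = cis (\<Phi> * t) * (b j t * b l t)" for t
  define R where "R t = cis (\<Phi> * t) * (b j t * G l t + G j t * b l t)" for t
  define I where "I = integral {0..T} P"
  have P: "P t = cis (\<Omega> (j + l) * t) * (a j t * a l t)" for t
  proof -
    have "cis (\<Omega> (j + l) * t) = cis (\<Phi> * t) * (cis (\<Omega> j * t) * cis (\<Omega> l * t))"
      unfolding cis_mult \<Phi>_def by (simp add: algebra_simps)
    thus ?thesis by (simp add: P_def b_def mult_ac)
  qed
  have Pc: "continuous_on {0..T} P"
    unfolding P_def by (intro continuous_intros b_continuous)
  have "(P has_integral I) {0..T}"
    unfolding I_def by (intro integrable_integral integrable_continuous_real Pc)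
  moreover have "((\<lambda>t. R t + \<i> * of_real \<Phi> * P t) has_integral P T - P 0) {0..T}"
  proof (rule fundamental_theorem_of_calculus_interior[OF T Pc])
    fix t assume t: "t \<in> {0<..<T}"
    have "(P has_vector_derivative cis (\<Phi> * t) * (b j t * G l t + G j t * b l t)
        + \<i> * of_real \<Phi> * cis (\<Phi> * t) * (b j t * b l t)) (at t)"
      unfolding P_def[abs_def] using t
      by (intro has_vector_derivative_mult has_vector_derivative_cis_mult b_derivative) auto
    thus "(P has_vector_derivative R t + \<i> * of_real \<Phi> * P t) (at t)"
      by (simp add: R_def P_def mult_ac)
  qed
  ultimately have "((\<lambda>t. (R t + \<i> * of_real \<Phi> * P t) - \<i> * of_real \<Phi> * P t) has_integral
      (P T - P 0) - \<i> * of_real \<Phi> * I) {0..T}"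
    by (intro has_integral_diff has_integral_mult_right)
  hence "(R has_integral (P T - P 0) - \<i> * of_real \<Phi> * I) {0..T}" by simp
  hence "cmod ((P T - P 0) - \<i> * of_real \<Phi> * I)
      \<le> (3 / 2 * M ^ 3 * (\<bar>of_int j\<bar> + \<bar>of_int l\<bar>)) * (T - 0)"
  proof (rule has_integral_norm_le[OF _ T])
    show "0 \<le> 3 / 2 * M ^ 3 * (\<bar>real_of_int j\<bar> + \<bar>real_of_int l\<bar>)" using M0 by simp
    fix t assume t: "t \<in> {0..T}"
    have "cmod (R t) \<le> cmod (b j t * G l t) + cmod (G j t * b l t)"
      unfolding R_def norm_mult[of "cis _"] norm_cis mult_1 by (rule norm_triangle_ineq)
    also have "\<dots> \<le> M * (3 / 2 * M\<^sup>2 * \<bar>of_int l\<bar>) + 3 / 2 * M\<^sup>2 * \<bar>of_int j\<bar> * M"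
      unfolding norm_mult using t M0 by (intro add_mono mult_mono b_le G_le) auto
    finally show "cmod (R t) \<le> 3 / 2 * M ^ 3 * (\<bar>of_int j\<bar> + \<bar>of_int l\<bar>)"
      by (simp add: power2_eq_square power3_eq_cube algebra_simps)
  qed
  moreover have "cmod (P T - P 0) \<le> 2 * M\<^sup>2"
  proof -
    have "cmod (P t) \<le> M\<^sup>2" if "0 \<le> t" "t \<le> T" for t
      unfolding P_def norm_mult norm_cis power2_eq_square mult_1 using M0 that
      by (intro mult_mono b_le) auto
    from this[of 0] this[of T] show ?thesis
      using norm_triangle_ineq4[of "P T" "P 0"] T by simp
  qed
  moreover have "cmod (\<i> * of_real \<Phi> * I) \<le> cmod ((P T - P 0) - \<i> * of_real \<Phi> * I) + cmod (P T - P 0)"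
    using norm_triangle_sub[of "\<i> * of_real \<Phi> * I" "P T - P 0"] by (simp add: norm_minus_commute)
  ultimately have "\<bar>\<Phi>\<bar> * cmod I \<le> 2 * M\<^sup>2 + T * (3 / 2 * M ^ 3) * (\<bar>of_int j\<bar> + \<bar>of_int l\<bar>)"
    using T by (simp add: norm_mult mult_ac)
  hence "cmod I \<le> (2 * M\<^sup>2 + T * (3 / 2 * M ^ 3) * (\<bar>of_int j\<bar> + \<bar>of_int l\<bar>)) / \<bar>\<Phi>\<bar>"
    using assms by (simp add: \<Phi>_def field_simps)
  moreover have "P = (\<lambda>t. cis (\<Omega> (j + l) * t) * (a j t * a l t))" using P by auto
  ultimately show ?thesis by (simp add: I_def \<Phi>_def)
qed

definition K :: real where "K = M\<^sup>2 + T * (3 / 2 * M ^ 3)"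

lemma K0: "K \<ge> 0" using M0 T by (simp add: K_def)

text \<open>The factor |j + l| of the derivative cancels against the one in the resonance function,
  and (|j| + |l|) / |j l| splits into 1 / |j| + 1 / |l|. In each summand
  \<open>quadratic_form_ge\<close> is used with the variable that stands in the denominator.\<close>

lemma pair_integral_le':
  assumes j: "j \<noteq> 0" and l: "l \<noteq> 0" and k: "j + l \<noteq> 0"
  shows "\<bar>of_int (j + l)\<bar> / 2 * cmod (integral {0..T} (\<lambda>t. cis (\<Omega> (j + l) * t) * (a j t * a l t)))
    \<le> K / 2 * \<bar>of_int (j + l)\<bar> powr (- 3 / 2) * (\<bar>of_int j\<bar> powr (- 3 / 2) + \<bar>of_int l\<bar> powr (- 3 / 2))"
proof -
  let ?j = "\<bar>real_of_int j\<bar>" and ?l = "\<bar>real_of_int l\<bar>" and ?k = "\<bar>real_of_int (j + l)\<bar>"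
  define Q where "Q = (real_of_int j)\<^sup>2 + of_int j * of_int l + (of_int l)\<^sup>2"
  have pos: "?j > 0" "?l > 0" "?k > 0" and one: "?j \<ge> 1" "?l \<ge> 1"
    using j l k one_le_abs_of_int by auto
  have q1: "?k powr (3 / 2) * ?j powr (1 / 2) / 2 \<le> Q"
    using quadratic_form_ge[of "of_int j" "of_int l"] by (simp add: Q_def)
  have q2: "?k powr (3 / 2) * ?l powr (1 / 2) / 2 \<le> Q"
    using quadratic_form_ge[of "of_int l" "of_int j"] by (simp add: Q_def add.commute mult.commute)
  have Q: "Q > 0" using q1 pos by (smt (verit) divide_pos_pos mult_pos_pos powr_gt_zero)
  have res: "?k * ?j * ?l * (2 * Q) \<le> \<bar>\<Omega> (j + l) - \<Omega> j - \<Omega> l\<bar>"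
    using resonance_ge[OF j, of l] by (simp add: Q_def)
  have rp: "0 < ?k * ?j * ?l * (2 * Q)" using pos Q by (intro mult_pos_pos) auto
  \<comment> \<open>The boundary term is absorbed because both frequencies are at least 1 in
    modulus, so 2 <= |j| + |l|.\<close>
  have "2 * M\<^sup>2 + T * (3 / 2 * M ^ 3) * (?j + ?l) \<le> M\<^sup>2 * (?j + ?l) + T * (3 / 2 * M ^ 3) * (?j + ?l)"
    using one by (subst mult.commute, intro add_right_mono mult_left_mono) auto
  also have "\<dots> = K * (?j + ?l)" by (simp add: K_def algebra_simps)
  finally have num: "2 * M\<^sup>2 + T * (3 / 2 * M ^ 3) * (?j + ?l) \<le> K * (?j + ?l)" .
  have "cmod (integral {0..T} (\<lambda>t. cis (\<Omega> (j + l) * t) * (a j t * a l t)))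
      \<le> (2 * M\<^sup>2 + T * (3 / 2 * M ^ 3) * (?j + ?l)) / \<bar>\<Omega> (j + l) - \<Omega> j - \<Omega> l\<bar>"
    using res rp by (intro pair_integral_le) auto
  also have "\<dots> \<le> K * (?j + ?l) / (?k * ?j * ?l * (2 * Q))"
    using num res rp K0 by (intro frac_le mult_nonneg_nonneg) auto
  finally have "?k / 2 * cmod (integral {0..T} (\<lambda>t. cis (\<Omega> (j + l) * t) * (a j t * a l t)))
      \<le> ?k / 2 * (K * (?j + ?l) / (?k * ?j * ?l * (2 * Q)))"
    by (intro mult_left_mono) auto
  also have "\<dots> = K / 4 * (1 / (?j * Q) + 1 / (?l * Q))"
    using pos Q by (simp add: field_simps)
  also have "\<dots> \<le> K / 4 * (2 * (?k powr (- 3 / 2) * ?j powr (- 3 / 2)) + 2 * (?k powr (- 3 / 2) * ?l powr (- 3 / 2)))"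
  proof -
    have *: "1 / (y * Q) \<le> 2 * (?k powr (- 3 / 2) * y powr (- 3 / 2))"
      if y: "y > 0" "?k powr (3 / 2) * y powr (1 / 2) / 2 \<le> Q" for y
    proof -
      have "1 / (y * Q) \<le> 1 / (y * (?k powr (3 / 2) * y powr (1 / 2) / 2))"
        using y pos Q by (intro divide_left_mono mult_left_mono mult_pos_pos) auto
      also have "y * (?k powr (3 / 2) * y powr (1 / 2) / 2) = ?k powr (3 / 2) * (y powr 1 * y powr (1 / 2)) / 2"
        using y by simp
      also have "y powr 1 * y powr (1 / 2) = y powr (3 / 2)" by (simp only: powr_add[symmetric]) simp
      also have "1 / (?k powr (3 / 2) * y powr (3 / 2) / 2) = 2 * (?k powr (- 3 / 2) * y powr (- 3 / 2))"
        by (simp add: powr_minus_divide)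
      finally show ?thesis .
    qed
    show ?thesis using K0 pos q1 q2 by (intro mult_left_mono add_mono *) auto
  qed
  also have "\<dots> = K / 2 * ?k powr (- 3 / 2) * (?j powr (- 3 / 2) + ?l powr (- 3 / 2))"
    by (simp add: algebra_simps)
  finally show ?thesis .
qed

text \<open>For fixed \<open>k\<close> the convolution is truncated at |j| <= n, each remaining pair
  is bounded by \<open>pair_integral_le'\<close>, and n tends to infinity. The solution enters the
  result only through \<open>T\<close> and the bound \<open>M\<close> on its
  \<open>L\<^sup>2\<close> norm.\<close>

lemma smoothing_estimate:
  assumes k: "k \<noteq> 0"
  shows "cmod (b k T - b k 0) \<le> 2 * K * (\<Sum>n. real n powr (- 3 / 2)) * \<bar>of_int k\<bar> powr (- 3 / 2)"
proof -
  let ?Z = "\<Sum>n. real n powr (- 3 / 2)"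
  obtain C where "\<forall>t\<in>{0..T}. \<forall>k. k \<noteq> 0 \<longrightarrow> cmod (a k t) \<le> C / (of_int k)\<^sup>2"
    using a_decay[of T] ..
  hence C: "cmod (a k t) \<le> C / (of_int k)\<^sup>2" if "t \<in> {0..T}" "k \<noteq> 0" for t k
    using that by auto
  obtain B where B: "B \<ge> 0" "\<And>t x. t \<in> {0..T} \<Longrightarrow> x \<in> {0..2 * pi} \<Longrightarrow> \<bar>V 0 0 t x\<bar> \<le> B"
    using V_bounded[of T 0 0] by blast
  have C0: "C \<ge> 0" using C[of 0 1] T order_trans[OF norm_ge_zero] by fastforce
  have main: "cmod (b k T - b k 0) \<le> 2 * K * ?Z * \<bar>of_int k\<bar> powr (- 3 / 2) + \<bar>of_int k\<bar> / 2 * T * (2 * C * B / real n)"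
    if n: "n \<ge> 1" "n \<ge> nat \<bar>k\<bar>" for n
  proof -
    \<comment> \<open>Removing 0 and \<open>k\<close> takes out the two pairs with the zero mode; in
      every remaining pair both frequencies are nonzero, as \<open>pair_integral_le'\<close>
      demands.\<close>
    define A where "A = {- int n..int n} - {0, k}"
    define J where "J j = integral {0..T} (\<lambda>t. cis (\<Omega> k * t) * (a j t * a (k - j) t))" for j
    have finA: "finite A" by (simp add: A_def)
    have split: "(\<Sum>j\<in>{- int n..int n}. a j t * a (k - j) t) = 2 * of_real c * a k t + (\<Sum>j\<in>A. a j t * a (k - j) t)"
      if t: "t \<in> {0..T}" for t
    proof -
      have eq: "{- int n..int n} = insert 0 (insert k A)" using n by (auto simp: A_def)
      have notin: "0 \<notin> insert k A" "k \<notin> A" using k by (auto simp: A_def)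
      have "(\<Sum>j\<in>{- int n..int n}. a j t * a (k - j) t)
          = a 0 t * a (k - 0) t + (a k t * a (k - k) t + (\<Sum>j\<in>A. a j t * a (k - j) t))"
        unfolding eq using notin finA by simp
      thus ?thesis using mean_conserved[of t] t by simp
    qed
    have err: "cmod (q k t - 2 * of_real c * a k t - (\<Sum>j\<in>A. a j t * a (k - j) t)) \<le> 2 * C * B / real n"
      if t: "t \<in> {0..T}" for t
    proof -
      have "cmod (q k t - (\<Sum>j\<in>{- int n..int n}. a j t * a (k - j) t)) \<le> 2 * C * B / real n"
        unfolding q_def a_def
      proof (rule fourier_coeff_square[OF _ _ _ n(1)])
        show "continuous_on {0..2 * pi} (v t)" using t by (simp add: v_eq V_cont_x)
        show "cmod (fourier_coeff (v t) k) \<le> C / (of_int k)\<^sup>2" if "k \<noteq> 0" for k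
          using C[OF t that] by (simp add: a_def)
        show "\<bar>v t x\<bar> \<le> B" if "x \<in> {0..2 * pi}" for x
          using B(2)[OF t that] t by (simp add: V0)
      qed
      thus ?thesis unfolding split[OF t] by (simp add: algebra_simps)
    qed
    have "((\<lambda>t. \<Sum>j\<in>A. cis (\<Omega> k * t) * (a j t * a (k - j) t)) has_integral (\<Sum>j\<in>A. J j)) {0..T}"
      unfolding J_def
      by (intro has_integral_sum finA integrable_integral integrable_continuous_real continuous_intros a_continuous)
    hence hA: "((\<lambda>t. - (\<i> * of_int k / 2) * (\<Sum>j\<in>A. cis (\<Omega> k * t) * (a j t * a (k - j) t))) has_integral
        - (\<i> * of_int k / 2) * (\<Sum>j\<in>A. J j)) {0..T}"
      by (rule has_integral_mult_right)
    have "(G k has_integral b k T - b k 0) {0..T}"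
      by (rule fundamental_theorem_of_calculus_interior[OF T b_continuous]) (auto intro: b_derivative)
    from has_integral_diff[OF this hA]
    have "cmod (b k T - b k 0 - (- (\<i> * of_int k / 2) * (\<Sum>j\<in>A. J j)))
        \<le> (\<bar>of_int k\<bar> / 2 * (2 * C * B / real n)) * (T - 0)"
    proof (rule has_integral_norm_le[OF _ T])
      show "0 \<le> \<bar>real_of_int k\<bar> / 2 * (2 * C * B / real n)" using C0 B(1) by simp
      fix t assume t: "t \<in> {0..T}"
      let ?E = "q k t - 2 * of_real c * a k t - (\<Sum>j\<in>A. a j t * a (k - j) t)"
      have eq: "G k t - - (\<i> * of_int k / 2) * (\<Sum>j\<in>A. cis (\<Omega> k * t) * (a j t * a (k - j) t))
          = - (\<i> * of_int k / 2) * (cis (\<Omega> k * t) * ?E)"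
        unfolding G_def sum_distrib_left[symmetric] by (simp add: algebra_simps)
      have "cmod (- (\<i> * of_int k / 2) * (cis (\<Omega> k * t) * ?E)) = \<bar>of_int k\<bar> / 2 * cmod ?E"
        unfolding norm_mult norm_minus_cancel norm_cis by (simp add: norm_mult norm_divide)
      thus "cmod (G k t - - (\<i> * of_int k / 2) * (\<Sum>j\<in>A. cis (\<Omega> k * t) * (a j t * a (k - j) t)))
          \<le> \<bar>of_int k\<bar> / 2 * (2 * C * B / real n)"
        unfolding eq using mult_left_mono[OF err[OF t], of "\<bar>of_int k\<bar> / 2"] by simp
    qed
    moreover have "cmod (- (\<i> * of_int k / 2) * (\<Sum>j\<in>A. J j)) \<le> 2 * K * ?Z * \<bar>of_int k\<bar> powr (- 3 / 2)"
    proof -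
      have "cmod (- (\<i> * of_int k / 2) * (\<Sum>j\<in>A. J j)) = \<bar>of_int k\<bar> / 2 * cmod (\<Sum>j\<in>A. J j)"
        by (simp add: norm_mult norm_divide)
      also have "\<dots> \<le> \<bar>of_int k\<bar> / 2 * (\<Sum>j\<in>A. cmod (J j))"
        by (intro mult_left_mono norm_sum) auto
      also have "\<dots> = (\<Sum>j\<in>A. \<bar>of_int k\<bar> / 2 * cmod (J j))" by (rule sum_distrib_left)
      also have "\<dots> \<le> (\<Sum>j\<in>A. K / 2 * \<bar>of_int k\<bar> powr (- 3 / 2)
          * (\<bar>of_int j\<bar> powr (- 3 / 2) + \<bar>of_int (k - j)\<bar> powr (- 3 / 2)))"
      proof (rule sum_mono)
        fix j assume "j \<in> A"
        thus "\<bar>of_int k\<bar> / 2 * cmod (J j) \<le> K / 2 * \<bar>of_int k\<bar> powr (- 3 / 2)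
          * (\<bar>of_int j\<bar> powr (- 3 / 2) + \<bar>of_int (k - j)\<bar> powr (- 3 / 2))"
          using pair_integral_le'[of j "k - j"] k by (simp add: A_def J_def)
      qed
      also have "\<dots> = K / 2 * \<bar>of_int k\<bar> powr (- 3 / 2)
          * ((\<Sum>j\<in>A. \<bar>of_int j\<bar> powr (- 3 / 2)) + (\<Sum>j\<in>A. \<bar>of_int (k - j)\<bar> powr (- 3 / 2)))"
        by (simp only: sum_distrib_left[symmetric] sum.distrib)
      \<comment> \<open>The reflected set again avoids 0, since \<open>A\<close> omits
        \<open>k\<close>, so one bound serves both sums.\<close>
      also have "(\<Sum>j\<in>A. \<bar>of_int (k - j)\<bar> powr (- 3 / 2)) = (\<Sum>j\<in>(\<lambda>j. k - j) ` A. \<bar>of_int j\<bar> powr (- 3 / 2))"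
        by (subst sum.reindex) (auto simp: inj_on_def)
      also have "K / 2 * \<bar>of_int k\<bar> powr (- 3 / 2) * ((\<Sum>j\<in>A. \<bar>of_int j\<bar> powr (- 3 / 2)) + (\<Sum>j\<in>(\<lambda>j. k - j) ` A. \<bar>of_int j\<bar> powr (- 3 / 2)))
          \<le> K / 2 * \<bar>of_int k\<bar> powr (- 3 / 2) * (2 * ?Z + 2 * ?Z)"
        using finA K0 by (intro mult_left_mono add_mono sum_abs_powr_le) (auto simp: A_def)
      finally show ?thesis by (simp add: algebra_simps)
    qed
    moreover have "\<bar>real_of_int k\<bar> / 2 * (2 * C * B / real n) * (T - 0) = \<bar>of_int k\<bar> / 2 * T * (2 * C * B / real n)"
      by simp
    ultimately show ?thesis
      using norm_triangle_sub[of "b k T - b k 0" "- (\<i> * of_int k / 2) * (\<Sum>j\<in>A. J j)"]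
      by linarith
  qed
  have "(\<lambda>n. 2 * K * ?Z * \<bar>of_int k\<bar> powr (- 3 / 2) + \<bar>of_int k\<bar> / 2 * T * (2 * C * B / real n))
      \<longlonglongrightarrow> 2 * K * ?Z * \<bar>of_int k\<bar> powr (- 3 / 2) + \<bar>of_int k\<bar> / 2 * T * 0"
    by (intro tendsto_intros lim_const_over_n)
  hence "cmod (b k T - b k 0) \<le> 2 * K * ?Z * \<bar>of_int k\<bar> powr (- 3 / 2) + \<bar>of_int k\<bar> / 2 * T * 0"
  proof (rule tendsto_lowerbound)
    show "\<forall>\<^sub>F n in sequentially. cmod (b k T - b k 0)
        \<le> 2 * K * ?Z * \<bar>of_int k\<bar> powr (- 3 / 2) + \<bar>of_int k\<bar> / 2 * T * (2 * C * B / real n)"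
      using eventually_ge_at_top[of "max 1 (nat \<bar>k\<bar>)"]
      by (rule eventually_mono) (rule main; simp)
  qed simp
  thus ?thesis by simp
qed

lemmas smoothing = smoothing_estimate[unfolded K_def]

end

end

section \<open>Nonlinear smoothing\<close>

definition square_integrable :: "(real \<Rightarrow> real) \<Rightarrow> bool" where
  "square_integrable f \<longleftrightarrow> f \<in> borel_measurable lebesgue \<and> set_integrable lebesgue {0..2 * pi} (\<lambda>x. (f x)\<^sup>2)"

lemma square_integrable_diff:
  assumes "square_integrable f" "square_integrable g"
  shows "square_integrable (\<lambda>x. f x - g x)"
proof -
  have [measurable]: "f \<in> borel_measurable lebesgue" "g \<in> borel_measurable lebesgue"
    using assms by (auto simp: square_integrable_def)
  have [measurable]: "{0..2 * pi} \<in> sets lebesgue" by simp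
  have "integrable lebesgue (\<lambda>x. indicator {0..2 * pi} x *\<^sub>R (f x - g x)\<^sup>2)"
  proof (rule Bochner_Integration.integrable_bound)
    have "set_integrable lebesgue {0..2 * pi} (\<lambda>x. 2 * (f x)\<^sup>2 + 2 * (g x)\<^sup>2)"
      using assms by (intro set_integral_add(1) set_integrable_mult_right) (auto simp: square_integrable_def)
    thus "integrable lebesgue (\<lambda>x. indicator {0..2 * pi} x *\<^sub>R (2 * (f x)\<^sup>2 + 2 * (g x)\<^sup>2))"
      by (simp add: set_integrable_def)
    show "(\<lambda>x. indicator {0..2 * pi} x *\<^sub>R (f x - g x)\<^sup>2) \<in> borel_measurable lebesgue" by measurable
    have "(x - y)\<^sup>2 \<le> 2 * x\<^sup>2 + 2 * y\<^sup>2" for x y :: real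
      using zero_le_power2[of "x + y"] by (simp add: power2_eq_square algebra_simps)
    thus "AE x in lebesgue. norm (indicator {0..2 * pi} x *\<^sub>R (f x - g x)\<^sup>2)
        \<le> norm (indicator {0..2 * pi} x *\<^sub>R (2 * (f x)\<^sup>2 + 2 * (g x)\<^sup>2))"
      by (intro AE_I2) (auto simp: indicator_def)
  qed
  thus ?thesis by (simp add: square_integrable_def set_integrable_def)
qed

lemma L2_norm_torus_nonneg: "0 \<le> L2_norm_torus f"
  and L2_norm_torus_square: "(L2_norm_torus f)\<^sup>2 = (LINT x:{0..2 * pi}|lebesgue. (f x)\<^sup>2)"
proof -
  have "0 \<le> (LINT x:{0..2 * pi}|lebesgue. (f x)\<^sup>2)"
    unfolding set_lebesgue_integral_def by (intro integral_nonneg_AE AE_I2) auto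
  thus "0 \<le> L2_norm_torus f" "(L2_norm_torus f)\<^sup>2 = (LINT x:{0..2 * pi}|lebesgue. (f x)\<^sup>2)"
    by (auto simp: L2_norm_torus_def)
qed

lemma L2_norm_torus_triangle:
  assumes "square_integrable f" "square_integrable g"
  shows "(L2_norm_torus f)\<^sup>2 \<le> 2 * (L2_norm_torus g)\<^sup>2 + 2 * (L2_norm_torus (\<lambda>x. f x - g x))\<^sup>2"
proof -
  let ?T = "{0..2 * pi}"
  have g: "set_integrable lebesgue ?T (\<lambda>x. 2 * (g x)\<^sup>2)"
    and d: "set_integrable lebesgue ?T (\<lambda>x. 2 * (f x - g x)\<^sup>2)"
    using assms square_integrable_diff[OF assms]
    by (auto intro!: set_integrable_mult_right simp: square_integrable_def)
  have "(LINT x:?T|lebesgue. (f x)\<^sup>2) \<le> (LINT x:?T|lebesgue. 2 * (g x)\<^sup>2 + 2 * (f x - g x)\<^sup>2)"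
  proof (rule set_integral_mono)
    show "set_integrable lebesgue ?T (\<lambda>x. (f x)\<^sup>2)" using assms by (simp add: square_integrable_def)
    show "set_integrable lebesgue ?T (\<lambda>x. 2 * (g x)\<^sup>2 + 2 * (f x - g x)\<^sup>2)"
      using g d by (rule set_integral_add(1))
    show "(f x)\<^sup>2 \<le> 2 * (g x)\<^sup>2 + 2 * (f x - g x)\<^sup>2" for x
      using zero_le_power2[of "2 * g x - f x"] by (simp add: power2_eq_square algebra_simps)
  qed
  also have "\<dots> = 2 * (LINT x:?T|lebesgue. (g x)\<^sup>2) + 2 * (LINT x:?T|lebesgue. (f x - g x)\<^sup>2)"
    using set_integral_add(2)[OF g d] by simp
  finally show ?thesis by (simp add: L2_norm_torus_square)
qed

lemma square_integrable_continuous: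
  assumes "continuous_on UNIV f" shows "square_integrable f"
proof -
  have "f \<in> borel_measurable borel" using assms by (rule borel_measurable_continuous_onI)
  hence "f \<in> borel_measurable lebesgue" by (intro measurable_completion) simp
  moreover have "set_integrable lebesgue {0..2 * pi} (\<lambda>x. (f x)\<^sup>2)"
    by (intro absolutely_integrable_continuous_real continuous_intros continuous_on_subset[OF assms]) auto
  ultimately show ?thesis by (simp add: square_integrable_def)
qed

lemma fourier_coeff_tendsto:
  assumes "\<And>n. square_integrable (f n)" "square_integrable g"
    and "(\<lambda>n. L2_norm_torus (\<lambda>x. f n x - g x)) \<longlonglongrightarrow> 0"
  shows "(\<lambda>n. fourier_coeff (f n) k) \<longlonglongrightarrow> fourier_coeff g k"
proof (rule LIM_zero_cancel, rule Lim_null_comparison[OF _ assms(3)])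
  have si: "set_integrable lebesgue {0..2 * pi} h" if "square_integrable h" for h
    using that L2_imp_set_integrable by (auto simp: square_integrable_def)
  show "\<forall>\<^sub>F n in sequentially. cmod (fourier_coeff (f n) k - fourier_coeff g k) \<le> L2_norm_torus (\<lambda>x. f n x - g x)"
  proof (rule always_eventually, rule allI)
    fix n
    have "square_integrable (\<lambda>x. f n x - g x)" by (intro square_integrable_diff assms)
    thus "cmod (fourier_coeff (f n) k - fourier_coeff g k) \<le> L2_norm_torus (\<lambda>x. f n x - g x)"
      unfolding fourier_coeff_diff[OF si[OF assms(1)] si[OF assms(2)], symmetric]
      by (intro fourier_coeff_le_L2_norm) (auto simp: square_integrable_def)
  qed
qed

lemma torus_BV_bounded:
  assumes "torus_BV g"
  obtains B where "\<And>x. x \<in> {0..2 * pi} \<Longrightarrow> \<bar>g x\<bar> \<le> B"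
proof -
  obtain M where M: "\<And>n (p :: nat \<Rightarrow> real). (\<forall>i\<le>n. p i \<in> {0..2 * pi}) \<and> (\<forall>i<n. p i \<le> p (Suc i)) \<Longrightarrow>
        (\<Sum>i<n. \<bar>g (p (Suc i)) - g (p i)\<bar>) \<le> M"
    using assms unfolding torus_BV_def bounded_variation_on_def by blast
  have "\<bar>g x\<bar> \<le> \<bar>g 0\<bar> + M" if "x \<in> {0..2 * pi}" for x
  proof -
    have "(\<Sum>i<1. \<bar>g ((if Suc i = 0 then 0 else x)) - g (if i = 0 then 0 else x)\<bar>) \<le> M"
      by (rule M[of 1 "\<lambda>i. if i = 0 then 0 else x"]) (use that in auto)
    thus ?thesis by simp
  qed
  thus thesis by (rule that)
qed

text \<open>Measurability of \<open>g\<close> is inherited from \<open>u 0\<close>, with which it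
  agrees almost everywhere, by completeness of Lebesgue measure; square integrability then follows
  from boundedness.\<close>

lemma forward_solution_data:
  assumes B: "\<And>x. x \<in> {0..2 * pi} \<Longrightarrow> \<bar>g x\<bar> \<le> B" and sol: "kawahara_forward_solution \<alpha> g u"
  shows "g \<in> borel_measurable lebesgue" "square_integrable g"
proof -
  have "AE x in lebesgue. u 0 x = g x" "u 0 \<in> borel_measurable lebesgue"
    using sol by (auto simp: kawahara_forward_solution_def torus_L2_def)
  thus g[measurable]: "g \<in> borel_measurable lebesgue" using borel_measurable_AE by blast
  have [measurable]: "{0..2 * pi} \<in> sets lebesgue" by simp
  have "integrable lebesgue (\<lambda>x. indicator {0..2 * pi} x *\<^sub>R (g x)\<^sup>2)"
  proof (rule Bochner_Integration.integrable_bound)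
    have "set_integrable lebesgue {0..2 * pi} (\<lambda>x. B\<^sup>2)"
      by (intro absolutely_integrable_continuous_real continuous_intros)
    thus "integrable lebesgue (\<lambda>x. indicator {0..2 * pi} x *\<^sub>R B\<^sup>2)" by (simp add: set_integrable_def)
    show "(\<lambda>x. indicator {0..2 * pi} x *\<^sub>R (g x)\<^sup>2) \<in> borel_measurable lebesgue" by measurable
    have "(g x)\<^sup>2 \<le> B\<^sup>2" if "x \<in> {0..2 * pi}" for x
      using power_mono[OF B[OF that], of 2] by simp
    thus "AE x in lebesgue. norm (indicator {0..2 * pi} x *\<^sub>R (g x)\<^sup>2) \<le> norm (indicator {0..2 * pi} x *\<^sub>R B\<^sup>2)"
      by (intro AE_I2) (auto simp: indicator_def)
  qed
  thus "square_integrable g" by (simp add: square_integrable_def set_integrable_def g)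
qed

text \<open>The smooth solutions converge in \<open>L\<^sup>2\<close> uniformly in time, so from
  some index on their norms share one bound on [0, t] and \<open>smoothing\<close> holds with a
  common constant. All Fourier coefficients, including the mean inside the phase, then pass to the
  limit.\<close>

lemma forward_smoothing:
  assumes \<alpha>: "\<alpha> \<le> 1" and B: "\<And>x. x \<in> {0..2 * pi} \<Longrightarrow> \<bar>g x\<bar> \<le> B" and sol: "kawahara_forward_solution \<alpha> g u" and t: "t \<ge> 0"
  shows "\<exists>C. \<forall>k. k \<noteq> 0 \<longrightarrow> cmod (fourier_coeff (u t) k
      - cis (- ((of_int k ^ 5 - \<alpha> * of_int k ^ 3 + Re (fourier_coeff g 0) * of_int k) * t)) * fourier_coeff g k)
    \<le> C * \<bar>of_int k\<bar> powr (- 3 / 2)"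
proof -
  let ?T = "{0..2 * pi}"
  note g = forward_solution_data[OF B sol]
  have us: "square_integrable (u s)" if "s \<ge> 0" for s
    using sol that by (simp add: kawahara_forward_solution_def torus_L2_def square_integrable_def)
  \<comment> \<open>The bound on \<open>g\<close> is known on one period; the cut-off makes it
    global and leaves the \<open>L\<^sup>2\<close> norm over that period unchanged.\<close>
  define g' where "g' x = indicator ?T x * g x" for x
  have T[measurable]: "?T \<in> sets lebesgue" by simp
  have [measurable]: "g \<in> borel_measurable lebesgue" by (rule g)
  have "g' \<in> borel_measurable lebesgue" unfolding g'_def[abs_def] by measurable
  moreover have "\<bar>g' x\<bar> \<le> B" for x using B[of x] B[of 0] by (auto simp: g'_def indicator_def)
  ultimately obtain h where h: "\<And>n. torus_smooth (h n)" "(\<lambda>n. L2_norm_torus (\<lambda>x. h n x - g' x)) \<longlonglongrightarrow> 0"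
    using smooth_L2_dense[of g' B] by metis
  have "L2_norm_torus (\<lambda>x. h n x - g' x) = L2_norm_torus (\<lambda>x. h n x - g x)" for n
    unfolding L2_norm_torus_def set_lebesgue_integral_def
    by (intro arg_cong[of _ _ sqrt] Bochner_Integration.integral_cong) (auto simp: g'_def indicator_def)
  hence hg: "(\<lambda>n. L2_norm_torus (\<lambda>x. h n x - g x)) \<longlonglongrightarrow> 0" using h(2) by simp
  have "\<exists>v. (\<forall>n. kawahara_smooth_solution \<alpha> (h n) (v n)) \<and>
       (\<forall>T>0. uniform_limit {0..T} (\<lambda>n t. L2_norm_torus (\<lambda>x. v n t x - u t x)) (\<lambda>_. 0) sequentially)"
    using sol h(1) hg unfolding kawahara_forward_solution_def by blast
  then obtain v where v: "\<And>n. kawahara_smooth_solution \<alpha> (h n) (v n)"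
    and "\<forall>T>0. uniform_limit {0..T} (\<lambda>n t. L2_norm_torus (\<lambda>x. v n t x - u t x)) (\<lambda>_. 0) sequentially"
    by blast
  hence lim: "uniform_limit {0..t + 1} (\<lambda>n t. L2_norm_torus (\<lambda>x. v n t x - u t x)) (\<lambda>_. 0) sequentially"
    using t by simp
  have "\<exists>V. kawahara_smooth \<alpha> (v n) V" for n using kawahara_smoothI[OF \<alpha> v] .
  hence "\<exists>V. \<forall>n. kawahara_smooth \<alpha> (v n) (V n)" by (intro choice) blast
  then obtain V where V: "\<And>n. kawahara_smooth \<alpha> (v n) (V n)" by blast
  have vs: "square_integrable (v n s)" if "s \<ge> 0" for n s
    unfolding kawahara_smooth.v_eq[OF V that]
    by (intro square_integrable_continuous kawahara_smooth.V_cont_x[OF V] that)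
  obtain N where "\<forall>n\<ge>N. \<forall>s\<in>{0..t + 1}. dist (L2_norm_torus (\<lambda>x. v n s x - u s x)) 0 < 1"
    using lim zero_less_one unfolding uniform_limit_sequentially_iff by blast
  hence N: "L2_norm_torus (\<lambda>x. v n s x - u s x) < 1" if "n \<ge> N" "s \<in> {0..t + 1}" for n s
    using that by (fastforce simp: dist_real_def)
  obtain B' where B': "B' \<ge> 0" "\<And>s x. s \<in> {0..t} \<Longrightarrow> x \<in> ?T \<Longrightarrow> \<bar>V N 0 0 s x\<bar> \<le> B'"
    using kawahara_smooth.V_bounded[OF V, of t N 0 0] by blast
  have vN: "(L2_norm_torus (v N s))\<^sup>2 \<le> 2 * pi * B'\<^sup>2" if s: "s \<in> {0..t}" for s
  proof -
    have "(LINT x:?T|lebesgue. (v N s x)\<^sup>2) \<le> (LINT x:?T|lebesgue. B'\<^sup>2)"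
    proof (rule set_integral_mono)
      show "set_integrable lebesgue ?T (\<lambda>x. (v N s x)\<^sup>2)"
        using vs[of s N] s by (simp add: square_integrable_def)
      show "set_integrable lebesgue ?T (\<lambda>x. B'\<^sup>2)"
        by (intro absolutely_integrable_continuous_real continuous_intros)
      show "(v N s x)\<^sup>2 \<le> B'\<^sup>2" if "x \<in> ?T" for x
        using power_mono[OF B'(2)[OF s that], of 2] kawahara_smooth.V0[OF V, of s N x] s by simp
    qed
    also have "\<dots> = 2 * pi * B'\<^sup>2" by (subst set_integral_continuous) auto
    finally show ?thesis by (simp add: L2_norm_torus_square)
  qed
  \<comment> \<open>Two uses of (x + y)^2 <= 2 x^2 + 2 y^2: from the single solution
    \<open>v N\<close>, bounded by compactness, to \<open>u\<close>, and from \<open>u\<close> to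
    every later \<open>v n\<close>; each distance is below 1.\<close>
  define M where "M = sqrt (2 * (2 * (2 * pi * B'\<^sup>2) + 2) + 2)"
  have small: "(L2_norm_torus f)\<^sup>2 \<le> 1" if "L2_norm_torus f < 1" for f
    using that L2_norm_torus_nonneg[of f] by (intro power_le_one) auto
  have M: "L2_norm_torus (v n s) \<le> M" if n: "n \<ge> N" and s: "0 \<le> s" "s \<le> t" for n s
  proof -
    have flip: "L2_norm_torus (\<lambda>x. u s x - v N s x) = L2_norm_torus (\<lambda>x. v N s x - u s x)"
      by (simp add: L2_norm_torus_def power2_commute)
    have "(L2_norm_torus (u s))\<^sup>2 \<le> 2 * (L2_norm_torus (v N s))\<^sup>2 + 2 * (L2_norm_torus (\<lambda>x. v N s x - u s x))\<^sup>2"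
      using L2_norm_torus_triangle[OF us vs, of s s N] s flip by simp
    also have "\<dots> \<le> 2 * (2 * pi * B'\<^sup>2) + 2 * 1"
      using s by (intro add_mono mult_left_mono vN small N) auto
    finally have us2: "(L2_norm_torus (u s))\<^sup>2 \<le> 2 * (2 * pi * B'\<^sup>2) + 2" by simp
    have "(L2_norm_torus (v n s))\<^sup>2 \<le> 2 * (L2_norm_torus (u s))\<^sup>2 + 2 * (L2_norm_torus (\<lambda>x. v n s x - u s x))\<^sup>2"
      using s by (intro L2_norm_torus_triangle us vs)
    also have "\<dots> \<le> 2 * (2 * (2 * pi * B'\<^sup>2) + 2) + 2 * 1"
      using s n by (intro add_mono mult_left_mono us2 small N) auto
    finally show ?thesis unfolding M_def by (intro real_le_rsqrt) simp
  qed
  define C where "C = 2 * (M\<^sup>2 + t * (3 / 2 * M ^ 3)) * (\<Sum>n. real n powr (- 3 / 2))"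
  define w where "w \<beta> k = of_int k ^ 5 - \<alpha> * of_int k ^ 3 + \<beta> * of_int k" for \<beta> k
  have v0: "v n 0 = h n" for n
    using v[of n] by (auto simp: kawahara_smooth_solution_def)
  have approx: "cmod (fourier_coeff (v n t) k - cis (- (w (Re (fourier_coeff (h n) 0)) k * t)) * fourier_coeff (h n) k)
      \<le> C * \<bar>of_int k\<bar> powr (- 3 / 2)" if n: "n \<ge> N" and k: "k \<noteq> 0" for n k
  proof -
    let ?w = "w (Re (fourier_coeff (h n) 0)) k"
    have "cmod (kawahara_smooth.b \<alpha> (v n) k t - kawahara_smooth.b \<alpha> (v n) k 0) \<le> C * \<bar>of_int k\<bar> powr (- 3 / 2)"
      unfolding C_def by (rule kawahara_smooth.smoothing[OF V t M[OF n] k])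
    also have "kawahara_smooth.b \<alpha> (v n) k t - kawahara_smooth.b \<alpha> (v n) k 0
        = cis (?w * t) * fourier_coeff (v n t) k - fourier_coeff (h n) k"
      by (simp add: kawahara_smooth.b_def[OF V] kawahara_smooth.a_def[OF V]
          kawahara_smooth.\<Omega>_def[OF V] kawahara_smooth.c_def[OF V] v0 w_def)
    also have "\<dots> = cis (?w * t) * (fourier_coeff (v n t) k - cis (- (?w * t)) * fourier_coeff (h n) k)"
      by (simp add: right_diff_distrib mult.assoc[symmetric] cis_mult)
    finally show ?thesis by (simp add: norm_mult)
  qed
  have lim_t: "(\<lambda>n. L2_norm_torus (\<lambda>x. v n t x - u t x)) \<longlonglongrightarrow> 0"
    using t by (intro tendsto_uniform_limitI[OF lim]) auto
  have hs: "square_integrable (h n)" for n using vs[of 0 n] by (simp add: v0)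
  show ?thesis
  proof (intro exI allI impI)
    fix k :: int assume k: "k \<noteq> 0"
    have hk: "(\<lambda>n. fourier_coeff (h n) k) \<longlonglongrightarrow> fourier_coeff g k" for k
      by (rule fourier_coeff_tendsto[OF hs g(2) hg])
    have "(\<lambda>n. cmod (fourier_coeff (v n t) k - cis (- (w (Re (fourier_coeff (h n) 0)) k * t)) * fourier_coeff (h n) k))
        \<longlonglongrightarrow> cmod (fourier_coeff (u t) k - cis (- (w (Re (fourier_coeff g 0)) k * t)) * fourier_coeff g k)"
      unfolding w_def cis_conv_exp
      by (intro tendsto_intros hk fourier_coeff_tendsto vs us t lim_t)
    hence "cmod (fourier_coeff (u t) k - cis (- (w (Re (fourier_coeff g 0)) k * t)) * fourier_coeff g k)
        \<le> C * \<bar>of_int k\<bar> powr (- 3 / 2)"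
      by (rule tendsto_upperbound) (use approx[OF _ k] in \<open>auto simp: eventually_sequentially\<close>)
    thus "cmod (fourier_coeff (u t) k
      - cis (- ((of_int k ^ 5 - \<alpha> * of_int k ^ 3 + Re (fourier_coeff g 0) * of_int k) * t)) * fourier_coeff g k)
      \<le> C * \<bar>of_int k\<bar> powr (- 3 / 2)" by (simp add: w_def)
  qed
qed

section \<open>Reflection in space and negative times\<close>

lemma distr_lebesgue_reflect: "distr lebesgue lebesgue (\<lambda>x. c - x) = (lebesgue :: real measure)"
proof -
  have "(lebesgue :: real measure) = density (distr lebesgue lebesgue (\<lambda>x. c + - 1 * x)) (\<lambda>_. ennreal \<bar>- 1\<bar>)"
    by (rule lebesgue_real_affine) simp
  thus ?thesis by (simp add: density_1)
qed

lemma measurable_lebesgue_reflect: "(\<lambda>x. c - x) \<in> lebesgue \<rightarrow>\<^sub>M (lebesgue :: real measure)"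
  using lebesgue_affine_measurable[where c = "\<lambda>_. - 1 :: real" and t = c] by simp

lemma set_integral_reflect:
  fixes f :: "real \<Rightarrow> 'a :: {banach, second_countable_topology}"
  assumes "f \<in> borel_measurable lebesgue"
  shows "(LINT x:{0..c}|lebesgue. f (c - x)) = (LINT x:{0..c}|lebesgue. f x)"
    and "set_integrable lebesgue {0..c} (\<lambda>x. f (c - x)) \<longleftrightarrow> set_integrable lebesgue {0..c} f"
proof -
  let ?F = "\<lambda>x. indicator {0..c} x *\<^sub>R f x"
  have [measurable]: "f \<in> borel_measurable lebesgue" "{0..c} \<in> sets lebesgue" using assms by auto
  have F: "?F \<in> borel_measurable lebesgue" by measurable
  have eq: "?F (c - x) = indicator {0..c} x *\<^sub>R f (c - x)" for x
    by (auto simp: indicator_def)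
  have "integral\<^sup>L (distr lebesgue lebesgue (\<lambda>x. c - x)) ?F = (\<integral>x. ?F (c - x) \<partial>lebesgue)"
    by (rule integral_distr[OF measurable_lebesgue_reflect F])
  thus "(LINT x:{0..c}|lebesgue. f (c - x)) = (LINT x:{0..c}|lebesgue. f x)"
    unfolding distr_lebesgue_reflect eq by (simp add: set_lebesgue_integral_def)
  have "integrable (distr lebesgue lebesgue (\<lambda>x. c - x)) ?F \<longleftrightarrow> integrable lebesgue (\<lambda>x. ?F (c - x))"
    by (rule integrable_distr_eq[OF measurable_lebesgue_reflect F])
  thus "set_integrable lebesgue {0..c} (\<lambda>x. f (c - x)) \<longleftrightarrow> set_integrable lebesgue {0..c} f"
    unfolding distr_lebesgue_reflect eq by (simp add: set_integrable_def)
qed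

lemma torus_fun_reflect:
  assumes "torus_fun f" shows "f (- x) = f (2 * pi - x)"
  using assms[unfolded torus_fun_def, rule_format, of "- x"] by (simp add: add.commute)

lemma fourier_coeff_reflect:
  assumes per: "torus_fun f" and f[measurable]: "f \<in> borel_measurable lebesgue"
  shows "fourier_coeff (\<lambda>x. f (- x)) k = fourier_coeff f (- k)"
proof -
  define F where "F x = cis (of_int k * x) * of_real (f x)" for x
  have "(\<lambda>x. cis (of_int k * x)) \<in> borel_measurable borel"
    by (intro borel_measurable_continuous_onI continuous_intros)
  hence [measurable]: "(\<lambda>x. cis (of_int k * x)) \<in> borel_measurable lebesgue"
    by (intro measurable_completion) simp
  have F: "F \<in> borel_measurable lebesgue" unfolding F_def[abs_def] by measurable
  have "cis (- (of_int k * x)) * complex_of_real (f (- x)) = F (2 * pi - x)" for x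
    using cis_int_shift[of k "- x"] by (simp add: F_def torus_fun_reflect[OF per] algebra_simps)
  hence "fourier_coeff (\<lambda>x. f (- x)) k = (LINT x:{0..2 * pi}|lebesgue. F (2 * pi - x)) / (2 * pi)"
    by (simp add: fourier_coeff_cis)
  also have "\<dots> = fourier_coeff f (- k)"
    unfolding set_integral_reflect(1)[OF F] by (simp add: fourier_coeff_cis F_def[abs_def])
  finally show ?thesis .
qed

lemma torus_L2_reflect:
  assumes "torus_L2 f" shows "torus_L2 (\<lambda>x. f (- x))"
proof -
  have per: "torus_fun f" and f: "f \<in> borel_measurable lebesgue"
    and i: "set_integrable lebesgue {0..2 * pi} (\<lambda>x. (f x)\<^sup>2)"
    using assms by (auto simp: torus_L2_def)
  have "(\<lambda>x. f (0 - x)) \<in> borel_measurable lebesgue"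
    by (rule measurable_compose[OF measurable_lebesgue_reflect f])
  moreover have "set_integrable lebesgue {0..2 * pi} (\<lambda>x. (f (2 * pi - x))\<^sup>2)"
    by (subst set_integral_reflect(2)[of "\<lambda>x. (f x)\<^sup>2"]) (use f i in auto)
  moreover have "torus_fun (\<lambda>x. f (- x))"
    using per unfolding torus_fun_def by (metis add_uminus_conv_diff diff_add_cancel minus_add_distrib)
  ultimately show ?thesis by (simp add: torus_L2_def torus_fun_reflect[OF per])
qed

text \<open>The drift is kept apart as a term linear in \<open>k\<close>, that is, a translation by
  \<open>c * t\<close> in space; Weyl sum bounds uniform in x absorb it.\<close>

definition lin_phase :: "real \<Rightarrow> real \<Rightarrow> real \<Rightarrow> int \<Rightarrow> real" where
  "lin_phase \<alpha> c t k = - t * (of_int k ^ 5 - \<alpha> * of_int k ^ 3) + - (c * t) * of_int k"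

text \<open>For negative times the forward estimate is applied to the reflected solution. Reflection
  sends \<open>k\<close> to \<open>- k\<close>, and since the dispersion relation is odd, the sign
  changes of frequency and time cancel in the phase.\<close>

lemma solution_smoothing:
  assumes \<alpha>: "\<alpha> \<le> 1" and bv: "torus_BV g" and sol: "kawahara_solution \<alpha> g u"
  shows "torus_L2 (u t)"
    and "\<exists>C. \<forall>k. k \<noteq> 0 \<longrightarrow> cmod (fourier_coeff (u t) k
      - cis (lin_phase \<alpha> (Re (fourier_coeff g 0)) t k) * fourier_coeff g k) \<le> C * \<bar>of_int k\<bar> powr (- 3 / 2)"
proof -
  obtain B where B: "\<And>x. x \<in> {0..2 * pi} \<Longrightarrow> \<bar>g x\<bar> \<le> B" using torus_BV_bounded[OF bv] by blast
  have per: "torus_fun g" using bv by (simp add: torus_BV_def)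
  have fw: "kawahara_forward_solution \<alpha> g u"
    and bw: "kawahara_forward_solution \<alpha> (\<lambda>x. g (- x)) (\<lambda>t x. u (- t) (- x))"
    using sol by (auto simp: kawahara_solution_def)
  note g = forward_solution_data(1)[OF B fw]
  have ph: "lin_phase \<alpha> c t k = - ((of_int k ^ 5 - \<alpha> * of_int k ^ 3 + c * of_int k) * t)" for c k
    by (simp add: lin_phase_def algebra_simps)
  have "torus_L2 (u t) \<and> (\<exists>C. \<forall>k. k \<noteq> 0 \<longrightarrow> cmod (fourier_coeff (u t) k
      - cis (lin_phase \<alpha> (Re (fourier_coeff g 0)) t k) * fourier_coeff g k) \<le> C * \<bar>of_int k\<bar> powr (- 3 / 2))"
  proof (cases "t \<ge> 0")
    case True
    thus ?thesis
      using forward_smoothing[OF \<alpha> B fw True] fw by (simp add: kawahara_forward_solution_def ph)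
  next
    case False
    hence s: "- t \<ge> 0" by simp
    have f: "torus_L2 (\<lambda>x. u t (- x))"
      using bw s unfolding kawahara_forward_solution_def by (metis minus_minus)
    have L2: "torus_L2 (u t)" using torus_L2_reflect[OF f] by simp
    have cu: "fourier_coeff (\<lambda>x. u (- (- t)) (- x)) k = fourier_coeff (u t) (- k)" for k
      using L2 fourier_coeff_reflect[of "u t" k] by (simp add: torus_L2_def)
    have cg: "fourier_coeff (\<lambda>x. g (- x)) k = fourier_coeff g (- k)" for k
      by (rule fourier_coeff_reflect[OF per g])
    have B': "\<bar>g (- x)\<bar> \<le> B" if "x \<in> {0..2 * pi}" for x
      using B[of "2 * pi - x"] that by (simp add: torus_fun_reflect[OF per])
    obtain C where C: "\<And>k. k \<noteq> 0 \<Longrightarrow> cmod (fourier_coeff (u t) (- k)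
        - cis (- ((of_int k ^ 5 - \<alpha> * of_int k ^ 3 + Re (fourier_coeff g 0) * of_int k) * (- t))) * fourier_coeff g (- k))
      \<le> C * \<bar>of_int k\<bar> powr (- 3 / 2)"
      using forward_smoothing[OF \<alpha> B' bw s] unfolding cu cg by auto
    have "cmod (fourier_coeff (u t) k
      - cis (lin_phase \<alpha> (Re (fourier_coeff g 0)) t k) * fourier_coeff g k) \<le> C * \<bar>of_int k\<bar> powr (- 3 / 2)"
      if "k \<noteq> 0" for k
    proof -
      have "- ((of_int (- k) ^ 5 - \<alpha> * of_int (- k) ^ 3 + Re (fourier_coeff g 0) * of_int (- k)) * (- t))
          = lin_phase \<alpha> (Re (fourier_coeff g 0)) t k"
        by (simp add: lin_phase_def algebra_simps)
      thus ?thesis using C[of "- k"] that by simp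
    qed
    thus ?thesis using L2 by blast
  qed
  thus "torus_L2 (u t)" "\<exists>C. \<forall>k. k \<noteq> 0 \<longrightarrow> cmod (fourier_coeff (u t) k
      - cis (lin_phase \<alpha> (Re (fourier_coeff g 0)) t k) * fourier_coeff g k) \<le> C * \<bar>of_int k\<bar> powr (- 3 / 2)"
    by auto
qed

section \<open>Linear evolution of data of bounded variation\<close>

text \<open>The supremum of the oscillation of \<open>g\<close> over a subinterval need not be
  attained, as \<open>g\<close> may jump; a nearly maximal point is good enough for the Riemann sums
  below.\<close>

lemma approximate_sup:
  fixes \<phi> :: "real \<Rightarrow> real"
  assumes bdd: "\<And>y. y \<in> S \<Longrightarrow> \<phi> y \<le> B" and ne: "S \<noteq> {}" and e: "e > 0"
  shows "\<exists>z\<in>S. \<forall>y\<in>S. \<phi> y \<le> \<phi> z + e"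
proof -
  have bd: "bdd_above (\<phi> ` S)" using bdd by (intro bdd_aboveI[of _ B]) auto
  obtain z where "z \<in> S" "Sup (\<phi> ` S) - e < \<phi> z"
    using less_cSup_iff[of "\<phi> ` S" "Sup (\<phi> ` S) - e"] bd ne e by auto
  moreover have "\<phi> y \<le> Sup (\<phi> ` S)" if "y \<in> S" for y
    using that bd by (intro cSup_upper) auto
  ultimately show ?thesis by (intro bexI[of _ z]) force+
qed

text \<open>Riemann sums turn \<open>\<integral> Q' g\<close> into sums over the increments of \<open>g\<close>; no Stieltjes integral
  is needed.\<close>

lemma integral_derivative_BV_le:
  fixes Q Q' :: "real \<Rightarrow> complex" and g :: "real \<Rightarrow> real"
  assumes var: "\<And>n (p :: nat \<Rightarrow> real). (\<forall>i\<le>n. p i \<in> {0..2 * pi}) \<Longrightarrow> (\<forall>i<n. p i \<le> p (Suc i)) \<Longrightarrow>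
        (\<Sum>i<n. \<bar>g (p (Suc i)) - g (p i)\<bar>) \<le> TV"
    and g: "g (2 * pi) = g 0"
    and Q: "\<And>x. (Q has_vector_derivative Q' x) (at x)" and Qper: "Q (2 * pi) = Q 0"
    and Q': "continuous_on UNIV Q'"
    and S: "\<And>x. x \<in> {0..2 * pi} \<Longrightarrow> cmod (Q x) \<le> S"
    and int: "(\<lambda>x. Q' x * of_real (g x)) integrable_on {0..2 * pi}"
  shows "cmod (integral {0..2 * pi} (\<lambda>x. Q' x * of_real (g x))) \<le> TV * S"
proof -
  let ?T = "{0..2 * pi}"
  let ?F = "\<lambda>x. Q' x * of_real (g x)"
  have S0: "S \<ge> 0" using S[of 0] order_trans[OF norm_ge_zero] by fastforce
  have "bounded (Q' ` ?T)"
    by (intro compact_imp_bounded compact_continuous_image continuous_on_subset[OF Q']) auto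
  then obtain D where D: "\<And>x. x \<in> ?T \<Longrightarrow> cmod (Q' x) \<le> D"
    unfolding bounded_iff by blast
  have D0: "D \<ge> 0" using D[of 0] order_trans[OF norm_ge_zero] by fastforce
  have main: "cmod (integral ?T ?F) \<le> TV * S + D * (TV + 1) * (2 * pi) / real n" if n: "n \<ge> 1" for n
  proof -
    define h where "h = 2 * pi / real n"
    define x where "x i = real i * h" for i
    have h: "h > 0" using n by (simp add: h_def)
    have xn: "x n = 2 * pi" and x0: "x 0 = 0" using n by (simp_all add: x_def h_def)
    have xs: "x (Suc i) = x i + h" for i by (simp add: x_def algebra_simps)
    have xT: "x i \<in> ?T" if "i \<le> n" for i
    proof -
      have "x i \<le> x n" unfolding x_def using that h by (intro mult_right_mono) auto
      moreover have "0 \<le> x i" using h by (simp add: x_def)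
      ultimately show ?thesis using xn by simp
    qed
    have sub: "{x i..x (Suc i)} \<subseteq> ?T" if "i < n" for i
      using xT[of i] xT[of "Suc i"] that by auto
    have ybound: "\<bar>g y - g (x i)\<bar> \<le> TV" if "i < n" "y \<in> {x i..x (Suc i)}" for i y
    proof -
      have "(\<Sum>j<1. \<bar>g (if Suc j = 0 then x i else y) - g (if j = 0 then x i else y)\<bar>) \<le> TV"
        using that sub[of i] xT[of i]
        by (intro var[of 1 "\<lambda>j. if j = 0 then x i else y"]) auto
      thus ?thesis by simp
    qed
    have "\<exists>z\<in>{x i..x (Suc i)}. \<forall>y\<in>{x i..x (Suc i)}. \<bar>g y - g (x i)\<bar> \<le> \<bar>g z - g (x i)\<bar> + 1 / real n"
      if "i < n" for i
      using ybound[OF that] h n by (intro approximate_sup[of _ "\<lambda>y. \<bar>g y - g (x i)\<bar>" TV]) (auto simp: xs)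
    then obtain z where z: "\<And>i. i < n \<Longrightarrow> z i \<in> {x i..x (Suc i)}"
      "\<And>i y. i < n \<Longrightarrow> y \<in> {x i..x (Suc i)} \<Longrightarrow> \<bar>g y - g (x i)\<bar> \<le> \<bar>g (z i) - g (x i)\<bar> + 1 / real n"
      by metis
    have osc: "(\<Sum>i<n. \<bar>g (z i) - g (x i)\<bar>) \<le> TV"
    proof -
      \<comment> \<open>The interleaved points x_0, z_0, x_1, z_1, ... are nondecreasing, so the
        oscillations over all pieces are part of a single variation sum and together cost only
        \<open>TV\<close>.\<close>
      define p where "p i = (if even i then x (i div 2) else z (i div 2))" for i
      have pT: "p i \<in> ?T" if "i \<le> 2 * n" for i
      proof (cases "even i")
        case True
        thus ?thesis using xT[of "i div 2"] that by (simp add: p_def)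
      next
        case False
        hence "i div 2 < n" using that by (metis div_less_iff_less_mult dvd_triv_left le_neq_implies_less mult.commute zero_less_numeral)
        thus ?thesis using z(1)[of "i div 2"] sub[of "i div 2"] False by (auto simp: p_def)
      qed
      have pm: "p i \<le> p (Suc i)" if "i < 2 * n" for i
      proof -
        have "i div 2 < n" using that by auto
        thus ?thesis using z(1)[of "i div 2"] by (cases "even i") (auto simp: p_def)
      qed
      have "(\<Sum>i<n. \<bar>g (z i) - g (x i)\<bar>) = (\<Sum>i<n. \<bar>g (p (Suc (2 * i))) - g (p (2 * i))\<bar>)"
        by (simp add: p_def)
      also have "\<dots> = (\<Sum>i\<in>(\<lambda>i. 2 * i) ` {..<n}. \<bar>g (p (Suc i)) - g (p i)\<bar>)"
        by (subst sum.reindex) (auto simp: inj_on_def)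
      also have "\<dots> \<le> (\<Sum>i<2 * n. \<bar>g (p (Suc i)) - g (p i)\<bar>)"
        by (rule sum_mono2) auto
      also have "\<dots> \<le> TV" using pT pm by (intro var) auto
      finally show ?thesis .
    qed
    have Fi: "?F integrable_on {x i..x (Suc i)}" if "i < n" for i
      using int sub[OF that] by (rule integrable_on_subinterval)
    have pieces: "integral {0..x m} ?F = (\<Sum>i<m. integral {x i..x (Suc i)} ?F)" if "m \<le> n" for m
      using that
    proof (induction m)
      case 0
      thus ?case by (simp add: x0)
    next
      case (Suc m)
      have "integral {0..x m} ?F + integral {x m..x (Suc m)} ?F = integral {0..x (Suc m)} ?F"
      proof (rule Henstock_Kurzweil_Integration.integral_combine)
        show "?F integrable_on {0..x (Suc m)}"
          using int by (rule integrable_on_subinterval) (use xT[OF Suc.prems] in auto)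
      qed (use xT[of m] Suc.prems h in \<open>auto simp: xs\<close>)
      thus ?case using Suc by simp
    qed
    have piece: "cmod (integral {x i..x (Suc i)} ?F - of_real (g (x i)) * (Q (x (Suc i)) - Q (x i)))
        \<le> D * (\<bar>g (z i) - g (x i)\<bar> + 1 / real n) * h" if i: "i < n" for i
    proof -
      have le: "x i \<le> x (Suc i)" using h by (simp add: xs)
      have "(Q' has_integral Q (x (Suc i)) - Q (x i)) {x i..x (Suc i)}"
        by (rule fundamental_theorem_of_calculus[OF le]) (rule has_vector_derivative_at_within[OF Q])
      from has_integral_diff[OF integrable_integral[OF Fi[OF i]] has_integral_mult_right[OF this, of "of_real (g (x i))"]]
      have "cmod (integral {x i..x (Suc i)} ?F - of_real (g (x i)) * (Q (x (Suc i)) - Q (x i)))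
          \<le> (D * (\<bar>g (z i) - g (x i)\<bar> + 1 / real n)) * (x (Suc i) - x i)"
      proof (rule has_integral_norm_le[OF _ le])
        show "0 \<le> D * (\<bar>g (z i) - g (x i)\<bar> + 1 / real n)" using D0 by simp
        fix y assume y: "y \<in> {x i..x (Suc i)}"
        have "Q' y * of_real (g y) - of_real (g (x i)) * Q' y = Q' y * of_real (g y - g (x i))"
          by (simp add: algebra_simps)
        hence "cmod (Q' y * of_real (g y) - of_real (g (x i)) * Q' y) = cmod (Q' y) * \<bar>g y - g (x i)\<bar>"
          by (simp only: norm_mult norm_of_real)
        also have "\<dots> \<le> D * (\<bar>g (z i) - g (x i)\<bar> + 1 / real n)"
          using D[of y] z(2)[OF i y] y sub[OF i] D0 by (intro mult_mono) auto
        finally show "cmod (Q' y * of_real (g y) - of_real (g (x i)) * Q' y)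
            \<le> D * (\<bar>g (z i) - g (x i)\<bar> + 1 / real n)" .
      qed
      thus ?thesis by (simp add: xs)
    qed
    \<comment> \<open>Abel summation; the boundary terms cancel because \<open>Q\<close> and
      \<open>g\<close> each take equal values at the two ends of the period.\<close>
    have abel: "(\<Sum>i<n. of_real (g (x i)) * (Q (x (Suc i)) - Q (x i)))
        = - (\<Sum>i<n. Q (x (Suc i)) * of_real (g (x (Suc i)) - g (x i)))"
    proof -
      have "(\<Sum>i<n. of_real (g (x i)) * (Q (x (Suc i)) - Q (x i)) + Q (x (Suc i)) * of_real (g (x (Suc i)) - g (x i)))
          = (\<Sum>i<n. of_real (g (x (Suc i))) * Q (x (Suc i)) - of_real (g (x i)) * Q (x i))"
        by (intro sum.cong refl) (simp add: algebra_simps)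
      also have "\<dots> = of_real (g (x n)) * Q (x n) - of_real (g (x 0)) * Q (x 0)"
        by (rule sum_lessThan_telescope)
      also have "\<dots> = 0" by (simp add: xn x0 g Qper)
      finally show ?thesis by (simp add: sum.distrib add_eq_0_iff)
    qed
    have "cmod (\<Sum>i<n. of_real (g (x i)) * (Q (x (Suc i)) - Q (x i)))
        \<le> (\<Sum>i<n. cmod (Q (x (Suc i)) * of_real (g (x (Suc i)) - g (x i))))"
      unfolding abel norm_minus_cancel by (rule norm_sum)
    also have "\<dots> \<le> (\<Sum>i<n. S * \<bar>g (x (Suc i)) - g (x i)\<bar>)"
      unfolding norm_mult norm_of_real using S xT by (intro sum_mono mult_right_mono) auto
    also have "\<dots> = S * (\<Sum>i<n. \<bar>g (x (Suc i)) - g (x i)\<bar>)" by (rule sum_distrib_left[symmetric])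
    also have "\<dots> \<le> S * TV"
      using xT h S0 by (intro mult_left_mono var) (auto simp: xs)
    finally have 1: "cmod (\<Sum>i<n. of_real (g (x i)) * (Q (x (Suc i)) - Q (x i))) \<le> S * TV" .
    have "cmod (\<Sum>i<n. integral {x i..x (Suc i)} ?F - of_real (g (x i)) * (Q (x (Suc i)) - Q (x i)))
        \<le> (\<Sum>i<n. D * (\<bar>g (z i) - g (x i)\<bar> + 1 / real n) * h)"
      using piece by (intro order_trans[OF norm_sum] sum_mono) auto
    also have "\<dots> = D * h * ((\<Sum>i<n. \<bar>g (z i) - g (x i)\<bar>) + (\<Sum>i<n. 1 / real n))"
      by (simp only: sum_distrib_left sum.distrib[symmetric] mult_ac)
    also have "(\<Sum>i<n. 1 / real n) = 1" using n by simp
    also have "D * h * ((\<Sum>i<n. \<bar>g (z i) - g (x i)\<bar>) + 1) \<le> D * h * (TV + 1)"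
      using osc D0 h by (intro mult_left_mono) auto
    finally have 2: "cmod (\<Sum>i<n. integral {x i..x (Suc i)} ?F - of_real (g (x i)) * (Q (x (Suc i)) - Q (x i)))
        \<le> D * h * (TV + 1)" .
    have "integral ?T ?F = (\<Sum>i<n. integral {x i..x (Suc i)} ?F - of_real (g (x i)) * (Q (x (Suc i)) - Q (x i)))
        + (\<Sum>i<n. of_real (g (x i)) * (Q (x (Suc i)) - Q (x i)))"
      using pieces[of n] by (simp add: xn sum_subtractf)
    hence "cmod (integral ?T ?F) \<le> D * h * (TV + 1) + S * TV"
      using norm_triangle_mono[OF 2 1] by simp
    thus ?thesis by (simp add: h_def mult_ac)
  qed
  have "(\<lambda>n. TV * S + D * (TV + 1) * (2 * pi) / real n) \<longlonglongrightarrow> TV * S + 0"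
    by (intro tendsto_intros lim_const_over_n)
  hence "cmod (integral ?T ?F) \<le> TV * S + 0"
  proof (rule tendsto_lowerbound)
    show "\<forall>\<^sub>F n in sequentially. cmod (integral ?T ?F) \<le> TV * S + D * (TV + 1) * (2 * pi) / real n"
      using eventually_ge_at_top[of 1] by (rule eventually_mono) (rule main)
  qed simp
  thus ?thesis by simp
qed

text \<open>Abel summation against decreasing weights: their differences are nonnegative and
  telescope.\<close>

lemma summation_by_parts_le:
  fixes z :: "nat \<Rightarrow> complex" and r :: "nat \<Rightarrow> real"
  assumes W: "\<And>m. m \<le> n \<Longrightarrow> cmod (\<Sum>i<m. z i) \<le> W"
    and r: "\<And>i. r (Suc i) \<le> r i" "\<And>i. r i \<ge> 0"
  shows "cmod (\<Sum>i<n. z i * of_real (r i)) \<le> W * r 0"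
proof -
  define s where "s m = (\<Sum>i<m. z i)" for m
  have sW: "cmod (s m) \<le> W" if "m \<le> n" for m using W[OF that] by (simp add: s_def)
  have id: "(\<Sum>i<m. z i * of_real (r i)) = s m * of_real (r m) + (\<Sum>i<m. s (Suc i) * of_real (r i - r (Suc i)))" for m
    by (induction m) (auto simp: s_def algebra_simps)
  have "cmod (\<Sum>i<n. z i * of_real (r i))
      \<le> cmod (s n) * r n + (\<Sum>i<n. cmod (s (Suc i) * of_real (r i - r (Suc i))))"
    unfolding id using r by (intro order_trans[OF norm_triangle_ineq] add_mono norm_sum) (simp add: norm_mult)
  also have "\<dots> \<le> W * r n + (\<Sum>i<n. W * (r i - r (Suc i)))"
    using r unfolding norm_mult norm_of_real
    by (intro add_mono mult_right_mono sum_mono mult_mono' sW) auto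
  also have "(\<Sum>i<n. W * (r i - r (Suc i))) = W * (r 0 - r n)"
    unfolding sum_distrib_left[symmetric] by (subst sum_lessThan_telescope') simp
  finally show ?thesis by (simp add: algebra_simps)
qed

section \<open>Dyadic frequency blocks\<close>

definition dyadic :: "nat \<Rightarrow> int set" where
  "dyadic j = {k. 2 ^ j \<le> \<bar>k\<bar> \<and> \<bar>k\<bar> < 2 ^ Suc j}"

lemma sum_dyadic:
  fixes F :: "int \<Rightarrow> 'a::comm_monoid_add"
  shows "(\<Sum>k\<in>dyadic j. F k) = (\<Sum>i<2 ^ j. F (2 ^ j + int i) + F (- (2 ^ j + int i)))"
proof -
  have eq: "dyadic j = (\<lambda>i. 2 ^ j + int i) ` {..<2 ^ j} \<union> (\<lambda>i. - (2 ^ j + int i)) ` {..<2 ^ j}"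
  proof (intro equalityI subsetI)
    fix k assume k: "k \<in> dyadic j"
    define i where "i = nat (\<bar>k\<bar> - 2 ^ j)"
    have i: "int i = \<bar>k\<bar> - 2 ^ j" "i < 2 ^ j"
      using k by (auto simp: dyadic_def i_def nat_less_iff)
    show "k \<in> (\<lambda>i. 2 ^ j + int i) ` {..<2 ^ j} \<union> (\<lambda>i. - (2 ^ j + int i)) ` {..<2 ^ j}"
    proof (cases "k \<ge> 0")
      case True
      hence "k = 2 ^ j + int i" using i by simp
      thus ?thesis using i by blast
    next
      case False
      hence "k = - (2 ^ j + int i)" using i by simp
      thus ?thesis using i by blast
    qed
  next
    fix k assume "k \<in> (\<lambda>i. 2 ^ j + int i) ` {..<2 ^ j} \<union> (\<lambda>i. - (2 ^ j + int i)) ` {..<2 ^ j}"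
    then obtain i :: nat where i: "i < 2 ^ j" "k = 2 ^ j + int i \<or> k = - (2 ^ j + int i)" by auto
    have "(0 :: int) \<le> 2 ^ j + int i" by simp
    hence "\<bar>k\<bar> = 2 ^ j + int i" using i(2) by linarith
    note i = i(1) this
    have "int i < 2 ^ j" using i(1) by (metis of_nat_less_iff of_nat_numeral of_nat_power)
    thus "k \<in> dyadic j" using i by (simp add: dyadic_def)
  qed
  have pos: "(0 :: int) < 2 ^ j + int i" for i by (intro add_pos_nonneg) auto
  have disj: "(\<lambda>i. 2 ^ j + int i) ` {..<2 ^ j} \<inter> (\<lambda>i. - (2 ^ j + int i)) ` {..<2 ^ j} = {}"
  proof (rule ccontr)
    assume "\<not> ?thesis"
    then obtain i i' where "2 ^ j + int i = - (2 ^ j + int i')" by auto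
    thus False using pos[of i] pos[of i'] by linarith
  qed
  show ?thesis
    unfolding eq by (subst sum.union_disjoint[OF _ _ disj], simp, simp)
      (simp add: sum.reindex inj_on_def sum.distrib)
qed

lemma finite_dyadic: "finite (dyadic j)"
  by (rule finite_subset[of _ "{- (2 ^ Suc j)..2 ^ Suc j}"]) (auto simp: dyadic_def)

lemma dyadic_nonzero: "k \<in> dyadic j \<Longrightarrow> k \<noteq> 0"
  by (auto simp: dyadic_def)

lemma lin_phase_minus: "lin_phase \<alpha> c t (- k) = - lin_phase \<alpha> c t k"
  by (simp add: lin_phase_def algebra_simps)

text \<open>The phase is odd, so the negative half of a block is the complex conjugate of the
  positive half, up to which one interval of length 2^j suffices. Division by k gains 2^(-j) through
  partial summation and turns the exponent 15/16 into -1/16.\<close>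

lemma weyl_good_blocks:
  assumes "weyl_good \<alpha> t"
  obtains C where "C \<ge> 0"
    "\<And>j z. cmod (\<Sum>k\<in>dyadic j. cis (lin_phase \<alpha> c t k) * cis (of_int k * z))
       \<le> C * (real j + 1) * 2 powr (15 / 16 * real j)"
    "\<And>j z. cmod (\<Sum>k\<in>dyadic j. cis (lin_phase \<alpha> c t k) * cis (of_int k * z) / (\<i> * of_int k))
       \<le> C * (real j + 1) * 2 powr (- 1 / 16 * real j)"
proof -
  obtain C where C: "\<And>j x a b. b - a \<le> 2 ^ j \<Longrightarrow>
     cmod (exp_sum (\<lambda>k. - t * (of_int k ^ 5 - \<alpha> * of_int k ^ 3) + x * of_int k) a b)
       \<le> C * (real j + 1) * 2 powr (15 / 16 * real j)"
    using assms unfolding weyl_good_def by blast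
  have C0: "C \<ge> 0" using C[of 0 0 0 0] order_trans[OF norm_ge_zero] by (fastforce simp: exp_sum_def)
  define e where "e z k = cis (lin_phase \<alpha> c t k) * cis (of_int k * z)" for z k
  have e: "e z k = cis (- t * (of_int k ^ 5 - \<alpha> * of_int k ^ 3) + (z - c * t) * of_int k)" for z k
    by (simp add: e_def lin_phase_def cis_mult algebra_simps)
  have em: "e z (- k) = cnj (e z k)" for z k
    by (simp add: e_def lin_phase_minus cis_cnj)
  let ?W = "\<lambda>j. C * (real j + 1) * 2 powr (15 / 16 * real j)"
  have part: "cmod (\<Sum>i<m. e z (2 ^ j + int i)) \<le> ?W j" if m: "m \<le> 2 ^ j" for z j m
  proof -
    have "(\<Sum>i<m. e z (2 ^ j + int i)) = (\<Sum>k\<in>(\<lambda>i. 2 ^ j + int i) ` {..<m}. e z k)"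
      by (subst sum.reindex) (auto simp: inj_on_def)
    also have "(\<lambda>i. 2 ^ j + int i) ` {..<m} = {2 ^ j..<2 ^ j + int m}"
    proof (intro equalityI subsetI)
      fix k assume "k \<in> {2 ^ j..<2 ^ j + int m}"
      hence "k = 2 ^ j + int (nat (k - 2 ^ j))" "nat (k - 2 ^ j) < m" by auto
      thus "k \<in> (\<lambda>i. 2 ^ j + int i) ` {..<m}" by blast
    qed auto
    finally have "(\<Sum>i<m. e z (2 ^ j + int i)) = exp_sum (\<lambda>k. - t * (of_int k ^ 5 - \<alpha> * of_int k ^ 3)
        + (z - c * t) * of_int k) (2 ^ j) (2 ^ j + int m)"
      by (simp add: exp_sum_def e)
    moreover have "int m \<le> 2 ^ j" using m by (metis of_nat_le_iff of_nat_numeral of_nat_power)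
    ultimately show ?thesis using C by simp
  qed
  have re: "cmod (x + cnj x) \<le> 2 * cmod x" for x
    using norm_triangle_ineq[of x "cnj x"] by simp
  show thesis
  proof (rule that[of "2 * C"])
    show "0 \<le> 2 * C" using C0 by simp
    fix j z
    have "(\<Sum>k\<in>dyadic j. e z k) = (\<Sum>i<2 ^ j. e z (2 ^ j + int i)) + cnj (\<Sum>i<2 ^ j. e z (2 ^ j + int i))"
      unfolding sum_dyadic em by (simp add: sum.distrib)
    hence "cmod (\<Sum>k\<in>dyadic j. e z k) \<le> 2 * ?W j"
      using re[of "\<Sum>i<2 ^ j. e z (2 ^ j + int i)"] part[of "2 ^ j" j z] by simp
    thus "cmod (\<Sum>k\<in>dyadic j. cis (lin_phase \<alpha> c t k) * cis (of_int k * z))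
       \<le> 2 * C * (real j + 1) * 2 powr (15 / 16 * real j)"
      by (simp add: e_def)
    let ?P = "\<Sum>i<2 ^ j. e z (2 ^ j + int i) / (\<i> * of_int (2 ^ j + int i))"
    have "e z (- k) / (\<i> * of_int (- k)) = cnj (e z k / (\<i> * of_int k))" for k
      by (simp add: em)
    hence "(\<Sum>k\<in>dyadic j. e z k / (\<i> * of_int k)) = ?P + cnj ?P"
      unfolding sum_dyadic by (simp only: sum.distrib cnj_sum)
    hence le: "cmod (\<Sum>k\<in>dyadic j. e z k / (\<i> * of_int k)) \<le> 2 * cmod ?P"
      using re[of ?P] by simp
    have "?P = - \<i> * (\<Sum>i<2 ^ j. e z (2 ^ j + int i) * of_real (1 / (2 ^ j + real i)))"
      unfolding sum_distrib_left
      by (intro sum.cong refl) (simp add: divide_inverse inverse_mult_distrib mult_ac del: distrib_left_numeral)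
    hence "cmod ?P = cmod (\<Sum>i<2 ^ j. e z (2 ^ j + int i) * of_real (1 / (2 ^ j + real i)))"
      by (simp only: norm_mult norm_minus_cancel norm_ii mult_1)
    also have "\<dots> \<le> ?W j * (1 / (2 ^ j + real 0))"
    proof (rule summation_by_parts_le)
      show "cmod (\<Sum>i<m. e z (2 ^ j + int i)) \<le> ?W j" if "m \<le> 2 ^ j" for m by (rule part[OF that])
      show "1 / (2 ^ j + real (Suc i)) \<le> 1 / (2 ^ j + real i)" for i
        by (intro divide_left_mono mult_pos_pos add_pos_nonneg) auto
    qed simp
    also have "\<dots> = C * (real j + 1) * (2 powr (15 / 16 * real j) / 2 powr (real j))"
      by (simp add: powr_realpow)
    also have "2 powr (15 / 16 * real j) / 2 powr (real j) = 2 powr (- 1 / 16 * real j)"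
      by (simp add: powr_diff[symmetric])
    finally show "cmod (\<Sum>k\<in>dyadic j. cis (lin_phase \<alpha> c t k) * cis (of_int k * z) / (\<i> * of_int k))
       \<le> 2 * C * (real j + 1) * 2 powr (- 1 / 16 * real j)"
      using le by (simp add: e_def)
  qed
qed

lemma torus_BV_variation:
  assumes "torus_BV g"
  obtains TV where "TV \<ge> 0" "\<And>n (p :: nat \<Rightarrow> real). (\<forall>i\<le>n. p i \<in> {0..2 * pi}) \<Longrightarrow> (\<forall>i<n. p i \<le> p (Suc i)) \<Longrightarrow>
        (\<Sum>i<n. \<bar>g (p (Suc i)) - g (p i)\<bar>) \<le> TV"
proof -
  obtain M where M: "\<And>n (p :: nat \<Rightarrow> real). (\<forall>i\<le>n. p i \<in> {0..2 * pi}) \<and> (\<forall>i<n. p i \<le> p (Suc i)) \<Longrightarrow>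
        (\<Sum>i<n. \<bar>g (p (Suc i)) - g (p i)\<bar>) \<le> M"
    using assms unfolding torus_BV_def bounded_variation_on_def by blast
  have "(\<Sum>i<0. \<bar>g 0 - g 0\<bar>) \<le> M" using M[of 0 "\<lambda>_. 0"] by simp
  hence "M \<ge> 0" by simp
  thus thesis using M by (intro that[of M]) auto
qed

text \<open>\<open>\<Sum> q k * fourier_coeff g k\<close> is the integral of \<open>g\<close> against the derivative of the trigonometric
  polynomial whose supremum is bounded by \<open>S\<close>.\<close>

lemma BV_multiplier_le:
  fixes q :: "int \<Rightarrow> complex"
  assumes bv: "torus_BV g" and g: "square_integrable g"
    and var: "\<And>n (p :: nat \<Rightarrow> real). (\<forall>i\<le>n. p i \<in> {0..2 * pi}) \<Longrightarrow> (\<forall>i<n. p i \<le> p (Suc i)) \<Longrightarrow>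
        (\<Sum>i<n. \<bar>g (p (Suc i)) - g (p i)\<bar>) \<le> TV"
    and A: "finite A" "0 \<notin> A"
    and S: "\<And>y. cmod (\<Sum>k\<in>A. q k * cis (- (of_int k * y)) / (\<i> * of_int k)) \<le> S"
  shows "cmod (\<Sum>k\<in>A. q k * fourier_coeff g k) \<le> TV * S"
proof -
  let ?T = "{0..2 * pi}"
  define Q where "Q y = - (\<Sum>k\<in>A. q k * cis (- (of_int k * y)) / (\<i> * of_int k))" for y
  define Q' where "Q' y = (\<Sum>k\<in>A. q k * cis (- (of_int k * y)))" for y
  have gi: "set_integrable lebesgue ?T (\<lambda>x. complex_of_real (g x))"
    using g L2_imp_set_integrable[of g]
    by (simp add: square_integrable_def set_integrable_def scaleR_conv_of_real flip: of_real_mult)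
  have hi: "((\<lambda>x. cis (- (of_int k * x)) * of_real (g x)) has_integral 2 * pi * fourier_coeff g k) ?T" for k
  proof -
    have si: "set_integrable lebesgue ?T (\<lambda>x. cis (- (of_int k * x)) * of_real (g x))"
      using set_integrable_cis_mult[OF gi, of "- k"] by simp
    show ?thesis
      using set_lebesgue_integral_eq_integral[OF si]
      by (simp add: has_integral_iff fourier_coeff_cis)
  qed
  have "((\<lambda>x. \<Sum>k\<in>A. q k * (cis (- (of_int k * x)) * of_real (g x))) has_integral
      (\<Sum>k\<in>A. q k * (2 * pi * fourier_coeff g k))) ?T"
    by (intro has_integral_sum A has_integral_mult_right hi)
  hence int: "((\<lambda>x. Q' x * of_real (g x)) has_integral 2 * pi * (\<Sum>k\<in>A. q k * fourier_coeff g k)) ?T"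
    by (simp add: Q'_def sum_distrib_left sum_distrib_right mult_ac)
  have Qd: "(Q has_vector_derivative Q' x) (at x)" for x
  proof -
    have "((\<lambda>y. q k * cis (of_int (- k) * y) / (\<i> * of_int k)) has_vector_derivative - (q k * cis (of_int (- k) * x))) (at x)"
      if "k \<in> A" for k
    proof -
      have "k \<noteq> 0" using that A by metis
      thus ?thesis
        using has_vector_derivative_divide[OF has_vector_derivative_mult_right[OF has_vector_derivative_cis_mult[of "of_int (- k)" x UNIV], of "q k"], of "\<i> * of_int k"]
        by (simp add: mult_ac)
    qed
    hence "((\<lambda>y. - (\<Sum>k\<in>A. q k * cis (of_int (- k) * y) / (\<i> * of_int k))) has_vector_derivative
        - (\<Sum>k\<in>A. - (q k * cis (of_int (- k) * x)))) (at x)"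
      by (intro has_vector_derivative_minus has_vector_derivative_sum)
    thus ?thesis by (simp add: Q_def[abs_def] Q'_def sum_negf)
  qed
  have "cmod (integral ?T (\<lambda>x. Q' x * of_real (g x))) \<le> TV * S"
  proof (rule integral_derivative_BV_le[OF var _ Qd])
    show "g (2 * pi) = g 0" using bv unfolding torus_BV_def torus_fun_def by (metis add_0)
    have "cis (- (of_int k * (2 * pi))) = 1" for k
      using cis_int_shift[of "- k" 0] by simp
    thus "Q (2 * pi) = Q 0" by (simp add: Q_def)
    show "continuous_on UNIV Q'" unfolding Q'_def by (intro continuous_intros)
    show "cmod (Q x) \<le> S" for x using S[of x] by (simp add: Q_def)
    show "(\<lambda>x. Q' x * of_real (g x)) integrable_on ?T" using int by blast
  qed auto
  hence "2 * pi * cmod (\<Sum>k\<in>A. q k * fourier_coeff g k) \<le> TV * S"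
    unfolding integral_unique[OF int] norm_mult by simp
  moreover have "1 * cmod (\<Sum>k\<in>A. q k * fourier_coeff g k) \<le> 2 * pi * cmod (\<Sum>k\<in>A. q k * fourier_coeff g k)"
    using pi_gt3 by (intro mult_right_mono) auto
  ultimately show ?thesis by simp
qed

lemma vector_derivative_bound_imp_lipschitz:
  fixes P P' :: "real \<Rightarrow> complex"
  assumes P: "\<And>x. (P has_vector_derivative P' x) (at x)" and W: "\<And>x. cmod (P' x) \<le> W"
  shows "cmod (P x - P y) \<le> W * \<bar>x - y\<bar>"
proof -
  have W0: "W \<ge> 0" using W[of 0] order_trans[OF norm_ge_zero] by fastforce
  have *: "cmod (P x - P y) \<le> W * (x - y)" if "y \<le> x" for x y
  proof (rule has_integral_norm_le[OF _ that W0 W])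
    show "(P' has_integral P x - P y) {y..x}"
      by (rule fundamental_theorem_of_calculus[OF that]) (rule has_vector_derivative_at_within[OF P])
  qed
  show ?thesis
    using *[of y x] *[of x y] by (cases "y \<le> x") (auto simp: norm_minus_commute)
qed

text \<open>Both sums pair \<open>g\<close> with the derivative of translates of one kernel
  \<open>P j\<close>, the block divided by \<i> k. The supremum of \<open>P j\<close> gives the
  first bound; its derivative is the undivided block, whose bound makes \<open>P j\<close> Lipschitz
  and gives the second.\<close>

lemma linear_block_bounds:
  assumes bv: "torus_BV g" and g: "square_integrable g" and good: "weyl_good \<alpha> t"
  obtains E where "E \<ge> 0"
    "\<And>j x. cmod (\<Sum>k\<in>dyadic j. cis (lin_phase \<alpha> c t k) * fourier_coeff g k * cis (of_int k * x))
       \<le> E * (real j + 1) * 2 powr (- 1 / 16 * real j)"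
    "\<And>j x y. cmod (\<Sum>k\<in>dyadic j. cis (lin_phase \<alpha> c t k) * fourier_coeff g k * (cis (of_int k * x) - cis (of_int k * y)))
       \<le> E * (real j + 1) * 2 powr (15 / 16 * real j) * \<bar>x - y\<bar>"
proof -
  obtain TV where TV: "TV \<ge> 0" "\<And>n (p :: nat \<Rightarrow> real). (\<forall>i\<le>n. p i \<in> {0..2 * pi}) \<Longrightarrow> (\<forall>i<n. p i \<le> p (Suc i)) \<Longrightarrow>
        (\<Sum>i<n. \<bar>g (p (Suc i)) - g (p i)\<bar>) \<le> TV"
    by (rule torus_BV_variation[OF bv]) (rule that, assumption, blast)
  let ?e = "\<lambda>k. cis (lin_phase \<alpha> c t k)"
  obtain C where C: "C \<ge> 0"
    "\<And>j z. cmod (\<Sum>k\<in>dyadic j. ?e k * cis (of_int k * z)) \<le> C * (real j + 1) * 2 powr (15 / 16 * real j)"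
    "\<And>j z. cmod (\<Sum>k\<in>dyadic j. ?e k * cis (of_int k * z) / (\<i> * of_int k)) \<le> C * (real j + 1) * 2 powr (- 1 / 16 * real j)"
    by (rule weyl_good_blocks[OF good, of c]) blast
  define P where "P j z = (\<Sum>k\<in>dyadic j. ?e k * cis (of_int k * z) / (\<i> * of_int k))" for j z
  have nz: "0 \<notin> dyadic j" for j using dyadic_nonzero by blast
  note mult = BV_multiplier_le[OF bv g TV(2) finite_dyadic nz]
  have sh: "cis (of_int k * x) * cis (- (of_int k * y)) = cis (of_int k * (x - y))" for k and x y :: real
    by (simp add: cis_mult algebra_simps)
  have Pd: "(P j has_vector_derivative (\<Sum>k\<in>dyadic j. ?e k * cis (of_int k * x))) (at x)" for j x
  proof -
    have "((\<lambda>y. ?e k * cis (of_int k * y) / (\<i> * of_int k)) has_vector_derivative ?e k * cis (of_int k * x)) (at x)"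
      if "k \<in> dyadic j" for k
      using dyadic_nonzero[OF that]
        has_vector_derivative_divide[OF has_vector_derivative_mult_right[OF has_vector_derivative_cis_mult[of "of_int k" x UNIV], of "?e k"], of "\<i> * of_int k"]
      by (simp add: mult_ac)
    thus ?thesis unfolding P_def[abs_def] by (intro has_vector_derivative_sum)
  qed
  have lip: "cmod (P j x - P j y) \<le> C * (real j + 1) * 2 powr (15 / 16 * real j) * \<bar>x - y\<bar>" for j x y
    by (rule vector_derivative_bound_imp_lipschitz[OF Pd C(2)])
  show thesis
  proof (rule that[of "TV * C"])
    show "TV * C \<ge> 0" using TV(1) C(1) by simp
    fix j x y
    have "cmod (\<Sum>k\<in>dyadic j. (?e k * cis (of_int k * x)) * fourier_coeff g k)
        \<le> TV * (C * (real j + 1) * 2 powr (- 1 / 16 * real j))"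
    proof (rule mult)
      fix y
      have "(\<Sum>k\<in>dyadic j. ?e k * cis (of_int k * x) * cis (- (of_int k * y)) / (\<i> * of_int k)) = P j (x - y)"
        by (simp only: P_def mult.assoc sh)
      thus "cmod (\<Sum>k\<in>dyadic j. ?e k * cis (of_int k * x) * cis (- (of_int k * y)) / (\<i> * of_int k))
          \<le> C * (real j + 1) * 2 powr (- 1 / 16 * real j)"
        using C(3)[where z = "x - y"] by (simp add: P_def)
    qed
    thus "cmod (\<Sum>k\<in>dyadic j. ?e k * fourier_coeff g k * cis (of_int k * x))
       \<le> TV * C * (real j + 1) * 2 powr (- 1 / 16 * real j)" by (simp add: mult_ac)
    have "cmod (\<Sum>k\<in>dyadic j. (?e k * (cis (of_int k * x) - cis (of_int k * y))) * fourier_coeff g k)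
        \<le> TV * (C * (real j + 1) * 2 powr (15 / 16 * real j) * \<bar>x - y\<bar>)"
    proof (rule mult)
      fix s
      have "(\<Sum>k\<in>dyadic j. ?e k * (cis (of_int k * x) - cis (of_int k * y)) * cis (- (of_int k * s)) / (\<i> * of_int k))
          = P j (x - s) - P j (y - s)"
        unfolding P_def sum_subtractf[symmetric]
        by (intro sum.cong refl) (simp only: mult.assoc left_diff_distrib sh right_diff_distrib diff_divide_distrib)
      thus "cmod (\<Sum>k\<in>dyadic j. ?e k * (cis (of_int k * x) - cis (of_int k * y)) * cis (- (of_int k * s)) / (\<i> * of_int k))
          \<le> C * (real j + 1) * 2 powr (15 / 16 * real j) * \<bar>x - y\<bar>"
        using lip[where x = "x - s" and y = "y - s"] by simp
    qed
    thus "cmod (\<Sum>k\<in>dyadic j. ?e k * fourier_coeff g k * (cis (of_int k * x) - cis (of_int k * y)))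
       \<le> TV * C * (real j + 1) * 2 powr (15 / 16 * real j) * \<bar>x - y\<bar>" by (simp add: mult_ac)
  qed
qed

lemma norm_cis_diff_le: "cmod (cis x - cis y) \<le> \<bar>x - y\<bar>"
proof -
  have "cis x - cis y = cis x * (1 - cis (y - x))" by (simp add: right_diff_distrib cis_mult)
  hence "cmod (cis x - cis y) = 2 * \<bar>sin ((y - x) / 2)\<bar>" by (simp add: norm_mult norm_1_minus_cis)
  also have "\<dots> \<le> 2 * \<bar>(y - x) / 2\<bar>" by (intro mult_left_mono abs_sin_x_le_abs_x) auto
  finally show ?thesis by simp
qed

lemma card_dyadic: "card (dyadic j) = 2 * 2 ^ j"
proof -
  have "int (card (dyadic j)) = (\<Sum>k\<in>dyadic j. 1)" by simp
  also have "\<dots> = int (2 * 2 ^ j)" unfolding sum_dyadic by simp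
  finally show ?thesis by (simp only: of_nat_eq_iff)
qed

lemma dyadic_powr_le:
  assumes "k \<in> dyadic j"
  shows "\<bar>real_of_int k\<bar> powr (- 3 / 2) \<le> 2 powr (- 3 / 2 * real j)"
proof -
  have "2 ^ j \<le> \<bar>k\<bar>" using assms by (simp add: dyadic_def)
  hence "real_of_int (2 ^ j) \<le> real_of_int \<bar>k\<bar>" by (simp only: of_int_le_iff)
  hence "(2 :: real) ^ j \<le> \<bar>of_int k\<bar>" by simp
  hence "\<bar>real_of_int k\<bar> powr (- 3 / 2) \<le> (2 ^ j) powr (- 3 / 2)"
    by (intro powr_mono2') auto
  also have "\<dots> = 2 powr (- 3 / 2 * real j)" by (simp add: powr_powr powr_realpow[symmetric] mult.commute)
  finally show ?thesis .
qed

text \<open>A block has 2^(j + 1) terms of size 2^(-3 j / 2), which gives 2^(-j / 2) for the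
  supremum and 2^(j / 2) for the Lipschitz constant. Both are weakened to the shape of the linear
  bounds so that they can be added to these.\<close>

lemma smooth_block_bounds:
  assumes C: "\<And>k. k \<noteq> 0 \<Longrightarrow> cmod (n k) \<le> C * \<bar>of_int k\<bar> powr (- 3 / 2)"
  shows "cmod (\<Sum>k\<in>dyadic j. n k * cis (of_int k * x)) \<le> 4 * C * (real j + 1) * 2 powr (- 1 / 16 * real j)"
    and "cmod (\<Sum>k\<in>dyadic j. n k * (cis (of_int k * x) - cis (of_int k * y)))
       \<le> 4 * C * (real j + 1) * 2 powr (15 / 16 * real j) * \<bar>x - y\<bar>"
proof -
  have C0: "C \<ge> 0" using C[of 1] order_trans[OF norm_ge_zero] by fastforce
  have n: "cmod (n k) \<le> C * 2 powr (- 3 / 2 * real j)" if "k \<in> dyadic j" for k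
    using C[OF dyadic_nonzero[OF that]] mult_left_mono[OF dyadic_powr_le[OF that] C0] by linarith
  have mono: "2 powr a \<le> (real j + 1) * 2 powr b" if "a \<le> b" for a b :: real
  proof -
    have "1 * 2 powr a \<le> (real j + 1) * 2 powr b" using that by (intro mult_mono powr_mono) auto
    thus ?thesis by simp
  qed
  have "cmod (\<Sum>k\<in>dyadic j. n k * cis (of_int k * x)) \<le> of_nat (card (dyadic j)) * (C * 2 powr (- 3 / 2 * real j))"
    using n by (intro order_trans[OF norm_sum] sum_bounded_above) (simp add: norm_mult)
  also have "\<dots> = 2 * C * (2 powr real j * 2 powr (- 3 / 2 * real j))"
    by (simp add: card_dyadic powr_realpow)
  also have "\<dots> = 2 * C * 2 powr (- 1 / 2 * real j)" by (simp add: powr_add[symmetric])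
  also have "\<dots> \<le> 4 * C * ((real j + 1) * 2 powr (- 1 / 16 * real j))"
    using C0 by (intro mult_mono[OF _ mono]) auto
  finally show "cmod (\<Sum>k\<in>dyadic j. n k * cis (of_int k * x)) \<le> 4 * C * (real j + 1) * 2 powr (- 1 / 16 * real j)"
    by (simp add: mult.assoc)
  have d: "cmod (n k * (cis (of_int k * x) - cis (of_int k * y))) \<le> C * 2 powr (- 3 / 2 * real j) * (2 powr (real j + 1) * \<bar>x - y\<bar>)"
    if k: "k \<in> dyadic j" for k
  proof -
    have "\<bar>k\<bar> \<le> 2 ^ Suc j" using k by (simp add: dyadic_def)
    hence "real_of_int \<bar>k\<bar> \<le> real_of_int (2 ^ Suc j)" by (simp only: of_int_le_iff)
    hence "\<bar>real_of_int k\<bar> \<le> 2 ^ Suc j" by simp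
    also have "(2 :: real) ^ Suc j = 2 powr (real j + 1)" by (simp add: powr_add powr_realpow)
    finally have k': "\<bar>real_of_int k\<bar> \<le> 2 powr (real j + 1)" .
    have "cmod (cis (of_int k * x) - cis (of_int k * y)) \<le> \<bar>of_int k * x - of_int k * y\<bar>" by (rule norm_cis_diff_le)
    also have "\<dots> = \<bar>of_int k\<bar> * \<bar>x - y\<bar>" by (simp add: abs_mult right_diff_distrib[symmetric])
    also have "\<dots> \<le> 2 powr (real j + 1) * \<bar>x - y\<bar>" using k' by (intro mult_right_mono) auto
    finally show ?thesis unfolding norm_mult using n[OF k] C0 by (intro mult_mono) auto
  qed
  have "cmod (\<Sum>k\<in>dyadic j. n k * (cis (of_int k * x) - cis (of_int k * y)))
      \<le> of_nat (card (dyadic j)) * (C * 2 powr (- 3 / 2 * real j) * (2 powr (real j + 1) * \<bar>x - y\<bar>))"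
    using d by (intro order_trans[OF norm_sum] sum_bounded_above)
  also have "\<dots> = 4 * C * (2 powr real j * 2 powr (- 3 / 2 * real j) * 2 powr real j) * \<bar>x - y\<bar>"
    by (simp add: card_dyadic powr_realpow powr_add)
  also have "\<dots> = 4 * C * 2 powr (1 / 2 * real j) * \<bar>x - y\<bar>" by (simp add: powr_add[symmetric])
  also have "\<dots> \<le> 4 * C * ((real j + 1) * 2 powr (15 / 16 * real j)) * \<bar>x - y\<bar>"
    using C0 by (intro mult_right_mono mult_left_mono mono) auto
  finally show "cmod (\<Sum>k\<in>dyadic j. n k * (cis (of_int k * x) - cis (of_int k * y)))
       \<le> 4 * C * (real j + 1) * 2 powr (15 / 16 * real j) * \<bar>x - y\<bar>"
    by (simp add: mult.assoc)
qed

lemma solution_block_bounds: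
  assumes bv: "torus_BV g" and g: "square_integrable g" and good: "weyl_good \<alpha> t"
    and f: "\<And>k. k \<noteq> 0 \<Longrightarrow> cmod (f k - cis (lin_phase \<alpha> c t k) * fourier_coeff g k) \<le> C * \<bar>of_int k\<bar> powr (- 3 / 2)"
  obtains E where "E \<ge> 0"
    "\<And>j x. cmod (\<Sum>k\<in>dyadic j. f k * cis (of_int k * x)) \<le> E * (real j + 1) * 2 powr (- 1 / 16 * real j)"
    "\<And>j x y. cmod (\<Sum>k\<in>dyadic j. f k * (cis (of_int k * x) - cis (of_int k * y)))
       \<le> E * (real j + 1) * 2 powr (15 / 16 * real j) * \<bar>x - y\<bar>"
proof -
  have C0: "C \<ge> 0" using f[of 1] order_trans[OF norm_ge_zero] by fastforce
  let ?l = "\<lambda>k. cis (lin_phase \<alpha> c t k) * fourier_coeff g k"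
  obtain E where E: "E \<ge> 0"
    "\<And>j x. cmod (\<Sum>k\<in>dyadic j. ?l k * cis (of_int k * x)) \<le> E * (real j + 1) * 2 powr (- 1 / 16 * real j)"
    "\<And>j x y. cmod (\<Sum>k\<in>dyadic j. ?l k * (cis (of_int k * x) - cis (of_int k * y)))
       \<le> E * (real j + 1) * 2 powr (15 / 16 * real j) * \<bar>x - y\<bar>"
    by (rule linear_block_bounds[OF bv g good, of c]) blast
  note S = smooth_block_bounds[of "\<lambda>k. f k - ?l k" C, OF f]
  have split: "(\<Sum>k\<in>dyadic j. f k * F k) = (\<Sum>k\<in>dyadic j. ?l k * F k) + (\<Sum>k\<in>dyadic j. (f k - ?l k) * F k)"
    for j and F :: "int \<Rightarrow> complex"
    unfolding sum.distrib[symmetric] by (intro sum.cong refl) (simp add: algebra_simps)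
  show thesis
  proof (rule that[of "E + 4 * C"])
    show "E + 4 * C \<ge> 0" using E C0 by simp
    fix j x y
    show "cmod (\<Sum>k\<in>dyadic j. f k * cis (of_int k * x)) \<le> (E + 4 * C) * (real j + 1) * 2 powr (- 1 / 16 * real j)"
      unfolding split distrib_right by (rule norm_triangle_mono[OF E(2) S(1)])
    show "cmod (\<Sum>k\<in>dyadic j. f k * (cis (of_int k * x) - cis (of_int k * y)))
       \<le> (E + 4 * C) * (real j + 1) * 2 powr (15 / 16 * real j) * \<bar>x - y\<bar>"
      unfolding split distrib_right by (rule norm_triangle_mono[OF E(3) S(2)])
  qed
qed

section \<open>Synthesis of dyadic blocks\<close>

lemma summable_linear_geometric:
  assumes "s < 0"
  shows "summable (\<lambda>j. (real j + 1) * 2 powr (s * real j))"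
proof -
  define r :: real where "r = 2 powr s"
  have r: "0 < r" "r < 1" using assms powr_less_mono[of s 0 2] by (auto simp: r_def)
  have "(\<lambda>j. of_nat (Suc j) * r ^ j) sums (1 / (1 - r)\<^sup>2)"
    using r by (intro geometric_deriv_sums) auto
  moreover have "of_nat (Suc j) * r ^ j = (real j + 1) * 2 powr (s * real j)" for j
    by (simp add: r_def powr_realpow[symmetric] powr_powr)
  ultimately show ?thesis by (simp only: sums_iff)
qed

definition low :: "nat \<Rightarrow> int set" where
  "low J = {k. \<bar>k\<bar> < 2 ^ J}"

lemma low_Suc: "low (Suc J) = low J \<union> dyadic J" "low J \<inter> dyadic J = {}"
proof -
  have "(2 :: int) ^ J \<le> 2 ^ Suc J" by simp
  thus "low (Suc J) = low J \<union> dyadic J" unfolding low_def dyadic_def by fastforce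
qed (auto simp: low_def dyadic_def)

lemma low_0: "low 0 = {0}"
  by (auto simp: low_def)

lemma finite_low: "finite (low J)"
  by (induction J) (auto simp: low_Suc low_0 finite_dyadic)

lemma sum_low:
  fixes F :: "int \<Rightarrow> 'a::comm_monoid_add"
  shows "(\<Sum>k\<in>low J. F k) = F 0 + (\<Sum>j<J. \<Sum>k\<in>dyadic j. F k)"
  by (induction J) (auto simp: low_0 low_Suc sum.union_disjoint finite_low finite_dyadic add.assoc)

lemma finite_subset_low:
  assumes "finite F" obtains J where "F \<subseteq> low J"
proof -
  obtain n :: nat where n: "\<And>k. k \<in> F \<Longrightarrow> \<bar>k\<bar> \<le> int n"
  proof -
    have "\<bar>k\<bar> \<le> int (nat (Max (abs ` F)))" if "k \<in> F" for k
    proof -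
      have "\<bar>k\<bar> \<le> Max (abs ` F)" using that assms by (intro Max_ge) auto
      moreover have "\<bar>k\<bar> \<le> int (nat m)" if "\<bar>k\<bar> \<le> m" for m using that by linarith
      ultimately show ?thesis by blast
    qed
    thus thesis by (rule that)
  qed
  have "int n < 2 ^ n" using of_nat_less_iff[of n "2 ^ n", where 'a = int] by simp
  hence "F \<subseteq> low n" unfolding low_def using n le_less_trans by blast
  thus thesis by (rule that)
qed

text \<open>Supremum and Lipschitz bound of a block are interpolated with weights 1 - \<theta> and
  \<theta>. The exponent -(1 - \<theta>) / 16 + 15 \<theta> / 16 = \<theta> - 1/16 is negative for
  \<theta> < 1/16, and the blocks then sum geometrically in spite of the factor j + 1.\<close>

lemma block_synthesis:
  fixes c :: "int \<Rightarrow> complex"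
  assumes E: "E \<ge> 0"
    and b: "\<And>j x. cmod (\<Sum>k\<in>dyadic j. c k * cis (of_int k * x)) \<le> E * (real j + 1) * 2 powr (- 1 / 16 * real j)"
    and l: "\<And>j x y. cmod (\<Sum>k\<in>dyadic j. c k * (cis (of_int k * x) - cis (of_int k * y)))
       \<le> E * (real j + 1) * 2 powr (15 / 16 * real j) * \<bar>x - y\<bar>"
  obtains w :: "real \<Rightarrow> complex" where "continuous_on UNIV w"
    "\<And>\<theta>. 0 < \<theta> \<Longrightarrow> \<theta> < 1 / 16 \<Longrightarrow> \<exists>H\<ge>0. \<forall>x y. cmod (w x - w y) \<le> H * \<bar>x - y\<bar> powr \<theta>"
    "\<exists>B. \<forall>x. cmod (w x) \<le> B"
    "\<And>x. w (x + 2 * pi) = w x"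
    "\<And>k. integral {0..2 * pi} (\<lambda>x. cis (- (of_int k * x)) * w x) = 2 * pi * c k"
proof -
  let ?T = "{0..2 * pi}"
  define M where "M j = E * ((real j + 1) * 2 powr (- 1 / 16 * real j))" for j
  have M: "summable M" unfolding M_def by (intro summable_mult summable_linear_geometric) simp
  define d where "d j x = (\<Sum>k\<in>dyadic j. c k * cis (of_int k * x))" for j x
  have dM: "cmod (d j x) \<le> M j" for j x using b[where j = j and x = x] by (simp add: d_def M_def mult.assoc)
  have ds: "summable (\<lambda>j. d j x)" for x by (rule summable_comparison_test'[OF M dM])
  define S where "S J x = (\<Sum>k\<in>low J. c k * cis (of_int k * x))" for J x
  have S: "S J x = c 0 + (\<Sum>j<J. d j x)" for J x by (simp add: S_def sum_low d_def)
  define w where "w x = c 0 + (\<Sum>j. d j x)" for x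
  define tail where "tail J = (\<Sum>j. M j) - (\<Sum>j<J. M j)" for J
  have tail0: "tail \<longlonglongrightarrow> 0"
  proof -
    have "(\<lambda>J. (\<Sum>j. M j) - (\<Sum>j<J. M j)) \<longlonglongrightarrow> (\<Sum>j. M j) - (\<Sum>j. M j)"
      by (intro tendsto_intros summable_LIMSEQ M)
    thus ?thesis by (simp add: tail_def[abs_def])
  qed
  have wS: "cmod (w x - S J x) \<le> tail J" for x J
  proof -
    have "w x - S J x = (\<Sum>j. d (j + J) x)"
      using suminf_minus_initial_segment[OF ds[of x], of J] by (simp add: w_def S)
    also have "cmod \<dots> \<le> (\<Sum>j. M (j + J))"
      using M dM by (intro norm_suminf_le) (auto simp: summable_iff_shift)
    also have "\<dots> = tail J" unfolding tail_def by (rule suminf_minus_initial_segment[OF M])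
    finally show ?thesis .
  qed
  have hol: "\<exists>H\<ge>0. \<forall>x y. cmod (w x - w y) \<le> H * \<bar>x - y\<bar> powr \<theta>" if \<theta>: "0 < \<theta>" "\<theta> < 1 / 16" for \<theta>
  proof -
    define G where "G j = 2 * E * ((real j + 1) * 2 powr ((\<theta> - 1 / 16) * real j))" for j
    have G: "summable G" unfolding G_def using \<theta> by (intro summable_mult summable_linear_geometric) simp
    have G0: "G j \<ge> 0" for j using E by (simp add: G_def)
    have dd: "cmod (d j x - d j y) \<le> G j * \<bar>x - y\<bar> powr \<theta>" for j x y
    proof -
      define D where "D = cmod (d j x - d j y)"
      have D0: "D \<ge> 0" by (simp add: D_def)
      define A where "A = 2 * E * (real j + 1)"
      have A0: "A \<ge> 0" using E by (simp add: A_def)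
      have 1: "D \<le> A * 2 powr (- 1 / 16 * real j)"
        using norm_triangle_ineq4[of "d j x" "d j y"] dM[of j x] dM[of j y]
        by (simp add: D_def M_def A_def mult.assoc)
      have "d j x - d j y = (\<Sum>k\<in>dyadic j. c k * (cis (of_int k * x) - cis (of_int k * y)))"
        by (simp add: d_def right_diff_distrib sum_subtractf)
      hence "D \<le> E * (real j + 1) * 2 powr (15 / 16 * real j) * \<bar>x - y\<bar>" using l[where j = j and x = x and y = y] by (simp add: D_def)
      also have "\<dots> \<le> A * 2 powr (15 / 16 * real j) * \<bar>x - y\<bar>"
        using E by (intro mult_right_mono) (auto simp: A_def)
      finally have 2: "D \<le> A * 2 powr (15 / 16 * real j) * \<bar>x - y\<bar>" .
      have "D = D powr ((1 - \<theta>) + \<theta>)" using D0 by simp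
      also have "\<dots> = D powr (1 - \<theta>) * D powr \<theta>" by (rule powr_add)
      also have "\<dots> \<le> (A * 2 powr (- 1 / 16 * real j)) powr (1 - \<theta>) * (A * 2 powr (15 / 16 * real j) * \<bar>x - y\<bar>) powr \<theta>"
        using 1 2 D0 \<theta> by (intro mult_mono powr_mono2) auto
      also have "\<dots> = (A powr (1 - \<theta>) * A powr \<theta>) * (2 powr (- 1 / 16 * real j * (1 - \<theta>)) * 2 powr (15 / 16 * real j * \<theta>)) * \<bar>x - y\<bar> powr \<theta>"
        using A0 by (simp add: powr_mult powr_powr)
      also have "A powr (1 - \<theta>) * A powr \<theta> = A" using A0 by (simp add: powr_add[symmetric])
      also have "2 powr (- 1 / 16 * real j * (1 - \<theta>)) * 2 powr (15 / 16 * real j * \<theta>) = 2 powr ((\<theta> - 1 / 16) * real j)"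
      proof -
        have "- 1 / 16 * real j * (1 - \<theta>) + 15 / 16 * real j * \<theta> = (\<theta> - 1 / 16) * real j"
          by (simp add: field_simps)
        thus ?thesis by (simp only: powr_add[symmetric])
      qed
      finally show ?thesis by (simp add: D_def A_def G_def mult.assoc)
    qed
    show ?thesis
    proof (intro exI[of _ "\<Sum>j. G j"] conjI allI)
      show "0 \<le> (\<Sum>j. G j)" using G G0 by (intro suminf_nonneg)
      fix x y
      have "w x - w y = (\<Sum>j. d j x - d j y)"
        using suminf_diff[OF ds ds, of x y] by (simp add: w_def)
      also have "cmod \<dots> \<le> (\<Sum>j. G j * \<bar>x - y\<bar> powr \<theta>)"
        using dd G by (intro norm_suminf_le summable_mult2)
      also have "\<dots> = (\<Sum>j. G j) * \<bar>x - y\<bar> powr \<theta>" by (rule suminf_mult2[OF G, symmetric])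
      finally show "cmod (w x - w y) \<le> (\<Sum>j. G j) * \<bar>x - y\<bar> powr \<theta>" .
    qed
  qed
  have wc: "continuous_on UNIV w"
  proof -
    have "uniform_limit UNIV S w sequentially"
      unfolding uniform_limit_sequentially_iff
    proof (intro allI impI)
      fix e :: real assume "e > 0"
      from order_tendstoD(2)[OF tail0 this] obtain N where N: "\<And>n. n \<ge> N \<Longrightarrow> tail n < e"
        unfolding eventually_sequentially by blast
      show "\<exists>N. \<forall>n\<ge>N. \<forall>x\<in>UNIV. dist (S n x) (w x) < e"
        using N wS by (metis dist_commute dist_norm order_le_less_trans)
    qed
    moreover have "continuous_on UNIV (S J)" for J unfolding S_def by (intro continuous_intros)
    ultimately show ?thesis
      by (intro uniform_limit_theorem[OF always_eventually]) auto
  qed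
  have bd: "cmod (w x) \<le> cmod (c 0) + tail 0" for x
    using wS[of x 0] norm_triangle_sub[of "w x" "c 0"] by (simp add: S)
  have per: "w (x + 2 * pi) = w x" for x by (simp add: w_def d_def cis_int_shift)
  have coeff: "integral ?T (\<lambda>x. cis (- (of_int k * x)) * w x) = 2 * pi * c k" for k
  proof -
    obtain J0 where J0: "{k} \<subseteq> low J0" using finite_subset_low[of "{k}"] by blast
    have le: "cmod (integral ?T (\<lambda>x. cis (- (of_int k * x)) * w x) - 2 * pi * c k) \<le> tail J * (2 * pi)" if J: "J \<ge> J0" for J
    proof -
      have "\<bar>k\<bar> < 2 ^ J0" using J0 by (simp add: low_def)
      also have "(2 :: int) ^ J0 \<le> 2 ^ J" using J by (intro power_increasing) auto
      finally have kJ: "k \<in> low J" by (simp add: low_def)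
      have "((\<lambda>x. \<Sum>j\<in>low J. c j * cis (of_int (j - k) * x)) has_integral
          (\<Sum>j\<in>low J. c j * (if j - k = 0 then 2 * pi else 0))) ?T"
        by (intro has_integral_sum has_integral_mult_right has_integral_cis finite_low)
      moreover have "(\<lambda>x. \<Sum>j\<in>low J. c j * cis (of_int (j - k) * x)) = (\<lambda>x. cis (- (of_int k * x)) * S J x)"
        unfolding S_def sum_distrib_left
        by (intro ext sum.cong refl) (simp add: cis_mult algebra_simps)
      moreover have "(\<Sum>j\<in>low J. c j * (if j - k = 0 then 2 * pi else 0)) = 2 * pi * c k"
      proof -
        have "(\<Sum>j\<in>low J. c j * (if j - k = 0 then 2 * pi else 0)) = (\<Sum>j\<in>low J. if j = k then 2 * pi * c k else 0)"
          by (intro sum.cong refl) auto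
        thus ?thesis using kJ by (simp add: finite_low)
      qed
      ultimately have hS: "((\<lambda>x. cis (- (of_int k * x)) * S J x) has_integral 2 * pi * c k) ?T" by simp
      have "(\<lambda>x. cis (- (of_int k * x)) * w x) integrable_on ?T"
        by (intro integrable_continuous_real continuous_intros continuous_on_subset[OF wc]) auto
      from has_integral_diff[OF integrable_integral[OF this] hS]
      have "cmod (integral ?T (\<lambda>x. cis (- (of_int k * x)) * w x) - 2 * pi * c k) \<le> tail J * (2 * pi - 0)"
      proof (rule has_integral_norm_le)
        show "0 \<le> tail J" using wS[of 0 J] norm_ge_zero order_trans by blast
        show "cmod (cis (- (of_int k * x)) * w x - cis (- (of_int k * x)) * S J x) \<le> tail J" for x
          unfolding right_diff_distrib[symmetric] norm_mult using wS[of x J] by simp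
      qed simp
      thus ?thesis by simp
    qed
    have "(\<lambda>J. tail J * (2 * pi)) \<longlonglongrightarrow> 0 * (2 * pi)" by (intro tendsto_intros tail0)
    hence "cmod (integral ?T (\<lambda>x. cis (- (of_int k * x)) * w x) - 2 * pi * c k) \<le> 0 * (2 * pi)"
    proof (rule tendsto_lowerbound)
      show "\<forall>\<^sub>F J in sequentially. cmod (integral ?T (\<lambda>x. cis (- (of_int k * x)) * w x) - 2 * pi * c k) \<le> tail J * (2 * pi)"
        using eventually_ge_at_top[of J0] by (rule eventually_mono) (rule le)
    qed simp
    thus ?thesis by simp
  qed
  show thesis
    by (rule that[of w]) (use wc hol bd per coeff in auto)
qed

section \<open>Identification of the sum of the blocks with the solution\<close>

lemma periodic_int_multiple:
  fixes f :: "real \<Rightarrow> 'a"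
  assumes "\<And>x. f (x + p) = f x"
  shows "f (x + of_int n * p) = f x"
proof -
  have nat: "f (x + of_nat m * p) = f x" for m x
  proof (induction m)
    case (Suc m)
    have "f (x + of_nat (Suc m) * p) = f ((x + of_nat m * p) + p)" by (simp add: algebra_simps)
    thus ?case using assms Suc by simp
  qed simp
  show ?thesis
  proof (cases "n \<ge> 0")
    case True
    thus ?thesis using nat[of x "nat n"] by simp
  next
    case False
    have "f ((x + of_int n * p) + of_nat (nat (- n)) * p) = f (x + of_int n * p)" by (rule nat)
    thus ?thesis using False by simp
  qed
qed

lemma AE_periodic:
  assumes ae: "AE x in lebesgue. x \<in> {0..2 * pi} \<longrightarrow> P x" and per: "\<And>x. P (x + 2 * pi) = P x"
  shows "AE x in lebesgue. P (x :: real)"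
proof -
  obtain N where N: "N \<in> null_sets lebesgue" "{x. \<not> (x \<in> {0..2 * pi} \<longrightarrow> P x)} \<subseteq> N"
    using ae unfolding eventually_ae_filter by auto
  define U where "U = (\<Union>n :: int. (+) (of_int n * (2 * pi)) ` N)"
  have "negligible N" using N(1) by (simp add: negligible_iff_null_sets)
  hence "negligible U"
    unfolding U_def by (intro negligible_countable_Union) (auto intro: negligible_translation)
  hence "U \<in> null_sets lebesgue" by (simp add: negligible_iff_null_sets)
  moreover have "x \<in> U" if "\<not> P x" for x
  proof -
    define n where "n = \<lfloor>x / (2 * pi)\<rfloor>"
    define y where "y = x - of_int n * (2 * pi)"
    have p: "2 * pi > 0" by simp
    have "y \<in> {0..2 * pi}"
      using floor_divide_lower[OF p, of x] floor_divide_upper[OF p, of x]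
      by (simp add: y_def n_def algebra_simps)
    moreover have "P x = P y"
      using periodic_int_multiple[of P "2 * pi" y n] per by (simp add: y_def)
    ultimately have "y \<in> N" using N(2) that by auto
    moreover have "x = of_int n * (2 * pi) + y" by (simp add: y_def)
    ultimately show ?thesis by (auto simp: U_def)
  qed
  ultimately show ?thesis
    unfolding eventually_ae_filter by (intro bexI[of _ U]) auto
qed

text \<open>Uniqueness of Fourier coefficients settles one period, and periodicity carries the
  equality to the line. Passing to the real part is harmless since \<open>f\<close> is real.\<close>

lemma fourier_representative:
  fixes w :: "real \<Rightarrow> complex"
  assumes f: "torus_L2 f" and w: "continuous_on UNIV w" "\<And>x. w (x + 2 * pi) = w x"
    and coeff: "\<And>k. integral {0..2 * pi} (\<lambda>x. cis (- (of_int k * x)) * w x) = 2 * pi * fourier_coeff f k"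
  shows "continuous_representative f (\<lambda>x. Re (w x))"
proof -
  let ?T = "{0..2 * pi}"
  have fi: "set_integrable lebesgue ?T f"
    using f L2_imp_set_integrable[of f] by (simp add: torus_L2_def)
  hence fc: "set_integrable lebesgue ?T (\<lambda>x. complex_of_real (f x))"
    by (simp add: set_integrable_def scaleR_conv_of_real flip: of_real_mult)
  have wT: "continuous_on ?T w" using w(1) by (rule continuous_on_subset) simp
  have wi: "set_integrable lebesgue ?T w" by (rule absolutely_integrable_continuous_real[OF wT])
  have "AE x in lebesgue. x \<in> ?T \<longrightarrow> Re (complex_of_real (f x) - w x) = 0"
  proof (rule fourier_uniqueness)
    show "set_integrable lebesgue ?T (\<lambda>x. complex_of_real (f x) - w x)"
      by (rule set_integral_diff(1)[OF fc wi])
    fix k :: int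
    have "(LINT x:?T|lebesgue. cis (of_int k * x) * (complex_of_real (f x) - w x))
        = (LINT x:?T|lebesgue. cis (of_int k * x) * complex_of_real (f x)) - (LINT x:?T|lebesgue. cis (of_int k * x) * w x)"
      unfolding right_diff_distrib
      by (rule set_integral_diff(2)[OF set_integrable_cis_mult[OF fc] set_integrable_cis_mult[OF wi]])
    also have "(LINT x:?T|lebesgue. cis (of_int k * x) * complex_of_real (f x)) = 2 * pi * fourier_coeff f (- k)"
      by (simp add: fourier_coeff_cis)
    also have "(LINT x:?T|lebesgue. cis (of_int k * x) * w x) = integral ?T (\<lambda>x. cis (- (of_int (- k) * x)) * w x)"
      by (subst set_integral_continuous) (auto intro!: continuous_intros wT)
    also have "\<dots> = 2 * pi * fourier_coeff f (- k)" by (rule coeff)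
    finally show "(LINT x:?T|lebesgue. cis (of_int k * x) * (complex_of_real (f x) - w x)) = 0" by simp
  qed
  hence "AE x in lebesgue. x \<in> ?T \<longrightarrow> Re (w x) = f x" by (rule eventually_mono) auto
  hence "AE x in lebesgue. Re (w x) = f x"
    by (rule AE_periodic) (use f w(2) in \<open>simp add: torus_L2_def torus_fun_def\<close>)
  thus ?thesis unfolding continuous_representative_def by (auto intro!: continuous_intros w(1))
qed

lemma fourier_coeff_cong_AE:
  assumes "AE x in lebesgue. f x = g x" and f: "f \<in> borel_measurable lebesgue"
  shows "fourier_coeff f k = fourier_coeff g k"
proof -
  have [measurable]: "f \<in> borel_measurable lebesgue" "g \<in> borel_measurable lebesgue"
    using f borel_measurable_AE[OF f assms(1)] by auto
  have "(\<lambda>x. cis (- (of_int k * x))) \<in> borel_measurable borel"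
    by (intro borel_measurable_continuous_onI continuous_intros)
  hence [measurable]: "(\<lambda>x. cis (- (of_int k * x))) \<in> borel_measurable lebesgue"
    by (intro measurable_completion) simp
  have [measurable]: "{0..2 * pi} \<in> sets lebesgue" by simp
  have "(LINT x:{0..2 * pi}|lebesgue. cis (- (of_int k * x)) * of_real (f x))
      = (LINT x:{0..2 * pi}|lebesgue. cis (- (of_int k * x)) * of_real (g x))"
    unfolding set_lebesgue_integral_def
  proof (rule integral_cong_AE)
    show "AE x in lebesgue. indicator {0..2 * pi} x *\<^sub>R (cis (- (of_int k * x)) * complex_of_real (f x))
        = indicator {0..2 * pi} x *\<^sub>R (cis (- (of_int k * x)) * complex_of_real (g x))"
      using assms(1) by (rule eventually_mono) simp
  qed measurable
  thus ?thesis by (simp add: fourier_coeff_cis)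
qed

section \<open>Sobolev regularity and the dimension of the graph\<close>

lemma integral_periodic_shift:
  fixes F :: "real \<Rightarrow> complex"
  assumes F: "continuous_on UNIV F" and per: "\<And>x. F (x + p) = F x" and h: "0 \<le> h" "h \<le> p"
  shows "integral {0..p} (\<lambda>x. F (x + h)) = integral {0..p} F"
proof -
  have int: "F integrable_on {a..b}" for a b
    by (intro integrable_continuous_real continuous_on_subset[OF F]) auto
  have shift: "integral {a..b} (F \<circ> ((+) c)) = integral {a + c..b + c} F" for a b c
  proof (rule integral_unique)
    show "((F \<circ> ((+) c)) has_integral integral {a + c..b + c} F) {a..b}"
      unfolding has_integral_shift_Icc_real by (rule integrable_integral[OF int])
  qed
  have "integral {0..p} (F \<circ> ((+) h)) = integral {h..p + h} F" using shift[of 0 p h] by simp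
  also have "\<dots> = integral {h..p} F + integral {p..p + h} F"
    by (rule Henstock_Kurzweil_Integration.integral_combine[symmetric]) (use h int in auto)
  also have "integral {p..p + h} F = integral {0..h} (F \<circ> ((+) p))" using shift[of 0 h p] by (simp add: add.commute)
  also have "F \<circ> ((+) p) = F" using per by (auto simp: add.commute)
  also have "integral {h..p} F + integral {0..h} F = integral {0..p} F"
    using Henstock_Kurzweil_Integration.integral_combine[of 0 h p F] h int by (simp add: add.commute)
  finally show ?thesis by (simp add: o_def add.commute)
qed

text \<open>The \<open>L\<^sup>2\<close> modulus of continuity is bounded by the product of the \<open>L\<^sup>1\<close> modulus, which is
  controlled by the dimension of the graph, and the uniform modulus; Bessel's inequality
  transfers the bound to a dyadic block.\<close>

lemma dyadic_energy_le:
  fixes w :: "real \<Rightarrow> real"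
  assumes w: "continuous_on UNIV w" and per: "\<And>x. w (x + 2 * pi) = w x"
    and H: "H \<ge> 0" "\<And>x y. \<bar>w x - w y\<bar> \<le> H * \<bar>x - y\<bar> powr \<theta>" and \<theta>: "0 < \<theta>"
    and dim: "upper_minkowski_dim (torus_graph w) < ereal d" and d: "d \<ge> 1"
  shows "\<exists>K\<ge>0. \<forall>\<^sub>F j in sequentially.
    (\<Sum>k\<in>dyadic j. (cmod (fourier_coeff w k))\<^sup>2) \<le> K * 2 powr (- (2 - d + \<theta>) * real j)"
proof -
  let ?T = "{0..2 * pi}"
  let ?\<beta> = "2 - d + \<theta>"
  define K where "K = pi\<^sup>2 * (H * (8 + H)) * (1 / 2) powr ?\<beta>"
  have K0: "K \<ge> 0" using H by (simp add: K_def)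
  have step: "(\<Sum>k\<in>dyadic j. (cmod (fourier_coeff w k))\<^sup>2) \<le> pi\<^sup>2 * (H * (8 + H)) * h powr ?\<beta>"
    if h: "h = (1 / 2) ^ Suc j"
      and L1: "integral {0..2 * pi - h} (\<lambda>x. \<bar>w (x + h) - w x\<bar>) \<le> 8 * h powr (2 - d)" for j h
  proof -
    have "(1 / 2 :: real) ^ Suc j \<le> 1" by (rule power_le_one) auto
    hence h0: "0 < h" "h \<le> 1" by (simp_all add: h)
    have hp: "h \<le> 2 * pi" using h0 pi_gt3 by linarith
    define f where "f x = w (x + h) - w x" for x
    have wh: "continuous_on UNIV (\<lambda>x. w (x + h))"
      by (rule continuous_on_compose2[OF w]) (auto intro!: continuous_intros)
    have fc: "continuous_on UNIV f" unfolding f_def by (intro continuous_intros wh w)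
    have fT: "continuous_on A f" for A using fc by (rule continuous_on_subset) simp
    have fH: "\<bar>f x\<bar> \<le> H * h powr \<theta>" for x using H(2)[of "x + h" x] h0 by (simp add: f_def)
    have coeff: "fourier_coeff f k = (cis (of_int k * h) - 1) * fourier_coeff w k" for k
    proof -
      let ?F = "\<lambda>x. cis (- (of_int k * x)) * complex_of_real (w x)"
      have Fc: "continuous_on UNIV ?F" by (intro continuous_intros w)
      have Fp: "?F (x + 2 * pi) = ?F x" for x
        using cis_int_shift[of "- k" x] per by simp
      have "integral ?T (\<lambda>x. cis (- (of_int k * x)) * of_real (f x))
          = integral ?T (\<lambda>x. cis (of_int k * h) * ?F (x + h) - ?F x)"
      proof (rule integral_cong)
        fix x
        have "cis (of_int k * h) * cis (- (of_int k * (x + h))) = cis (- (of_int k * x))"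
          by (simp add: cis_mult algebra_simps)
        thus "cis (- (of_int k * x)) * of_real (f x) = cis (of_int k * h) * ?F (x + h) - ?F x"
          by (simp add: f_def right_diff_distrib mult.assoc[symmetric])
      qed
      also have "\<dots> = cis (of_int k * h) * integral ?T (\<lambda>x. ?F (x + h)) - integral ?T ?F"
      proof (subst integral_diff)
        have "continuous_on ?T (\<lambda>x. ?F (x + h))"
          by (rule continuous_on_compose2[OF Fc]) (auto intro!: continuous_intros)
        thus "(\<lambda>x. cis (of_int k * h) * ?F (x + h)) integrable_on ?T"
          by (intro integrable_continuous_real continuous_on_mult_left)
        show "?F integrable_on ?T"
          by (intro integrable_continuous_real continuous_on_subset[OF Fc]) auto
      qed (simp only: integral_mult_right)
      also have "integral ?T (\<lambda>x. ?F (x + h)) = integral ?T ?F"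
        using h0 hp by (intro integral_periodic_shift[OF Fc Fp]) auto
      finally show ?thesis
        using continuous_on_subset[OF w, of ?T]
        by (simp add: fourier_coeff_continuous fT left_diff_distrib diff_divide_distrib)
    qed
    \<comment> \<open>With h = 2^(-j - 1), every \<open>k\<close> of the block has |k| h / 2 between
      1/4 and 1/2, where the sine is bounded below. The translation by h is thus visible to the
      whole block.\<close>
    have low: "1 / pi\<^sup>2 \<le> (cmod (cis (of_int k * h) - 1))\<^sup>2" if k: "k \<in> dyadic j" for k
    proof -
      have k1: "(2 :: real) ^ j \<le> \<bar>of_int k\<bar>" "\<bar>of_int k\<bar> \<le> (2 :: real) ^ Suc j"
      proof -
        have "2 ^ j \<le> \<bar>k\<bar>" "\<bar>k\<bar> \<le> 2 ^ Suc j" using k by (auto simp: dyadic_def)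
        hence "real_of_int (2 ^ j) \<le> real_of_int \<bar>k\<bar>" "real_of_int \<bar>k\<bar> \<le> real_of_int (2 ^ Suc j)"
          by (simp_all only: of_int_le_iff)
        thus "(2 :: real) ^ j \<le> \<bar>of_int k\<bar>" "\<bar>of_int k\<bar> \<le> (2 :: real) ^ Suc j" by simp_all
      qed
      define y where "y = \<bar>of_int k\<bar> * h / 2"
      have h2: "2 ^ j * h = 1 / 2" "2 ^ Suc j * h = 1" by (simp_all add: h power_one_over)
      have "2 ^ j * h \<le> \<bar>of_int k\<bar> * h" "\<bar>of_int k\<bar> * h \<le> 2 ^ Suc j * h"
        using k1 h0 by (intro mult_right_mono; simp)+
      hence y: "1 / 4 \<le> y" "y \<le> 1 / 2" unfolding h2 y_def by linarith+
      have "2 / pi * (1 / 4) \<le> 2 / pi * y" using y by (intro mult_left_mono) auto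
      also have "\<dots> \<le> sin y" using y pi_gt3 by (intro sin_ge_linear) auto
      finally have siny: "1 / pi \<le> 2 * sin y" by simp
      have "cmod (cis (of_int k * h) - 1) = 2 * \<bar>sin (of_int k * h / 2)\<bar>"
        using norm_1_minus_cis[of "of_int k * h"] by (simp add: norm_minus_commute)
      also have "\<bar>sin (of_int k * h / 2)\<bar> = \<bar>sin y\<bar>"
        by (cases "k \<ge> 0") (auto simp: y_def abs_if)
      also have "\<dots> = sin y" using siny pi_gt_zero by (smt (verit) divide_pos_pos)
      finally have "1 / pi \<le> cmod (cis (of_int k * h) - 1)" using siny by simp
      hence "(1 / pi)\<^sup>2 \<le> (cmod (cis (of_int k * h) - 1))\<^sup>2" by (intro power_mono) auto
      thus ?thesis by (simp add: power_one_over)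
    qed
    have fa: "(\<lambda>x. \<bar>f x\<bar>) integrable_on {a..b}" for a b
      by (intro integrable_continuous_real continuous_intros fT)
    have hd: "h \<le> h powr (2 - d)"
      using powr_mono'[of "2 - d" 1 h] d h0 by simp
    have ht1: "h powr \<theta> \<le> 1" using h0 \<theta> powr_mono2[of \<theta> h 1] by simp
    \<comment> \<open>On the last strip of length h the translate leaves the period spanned by the
      graph. The uniform modulus bounds this part by H h, which is at most H h^(2 - d) since d >=
      1.\<close>
    have rest: "integral {2 * pi - h..2 * pi} (\<lambda>x. \<bar>f x\<bar>) \<le> H * h powr (2 - d)"
    proof -
      have "integral {2 * pi - h..2 * pi} (\<lambda>x. \<bar>f x\<bar>) \<le> integral {2 * pi - h..2 * pi} (\<lambda>x. H * h powr \<theta>)"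
        by (intro integral_le fa fH) auto
      also have "\<dots> = h * (H * h powr \<theta>)" using h0 by simp
      also have "\<dots> \<le> h powr (2 - d) * (H * 1)"
        using hd ht1 H(1) h0 by (intro mult_mono mult_left_mono) auto
      finally show ?thesis by (simp add: mult.commute)
    qed
    have "integral {0..2 * pi - h} (\<lambda>x. \<bar>f x\<bar>) + integral {2 * pi - h..2 * pi} (\<lambda>x. \<bar>f x\<bar>) = integral ?T (\<lambda>x. \<bar>f x\<bar>)"
      by (rule Henstock_Kurzweil_Integration.integral_combine) (use h0 hp fa in auto)
    hence L1': "integral ?T (\<lambda>x. \<bar>f x\<bar>) \<le> (8 + H) * h powr (2 - d)"
      using L1 rest by (simp add: f_def distrib_right)
    have "integral ?T (\<lambda>x. (f x)\<^sup>2) \<le> integral ?T (\<lambda>x. H * h powr \<theta> * \<bar>f x\<bar>)"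
    proof (rule integral_le)
      show "(\<lambda>x. (f x)\<^sup>2) integrable_on ?T" by (intro integrable_continuous_real continuous_intros fT)
      show "(\<lambda>x. H * h powr \<theta> * \<bar>f x\<bar>) integrable_on ?T" by (intro integrable_continuous_real continuous_intros fT)
      show "(f x)\<^sup>2 \<le> H * h powr \<theta> * \<bar>f x\<bar>" for x
        using mult_right_mono[OF fH[of x], of "\<bar>f x\<bar>"] by (simp add: power2_eq_square)
    qed
    also have "\<dots> = H * h powr \<theta> * integral ?T (\<lambda>x. \<bar>f x\<bar>)" by simp
    also have "\<dots> \<le> H * h powr \<theta> * ((8 + H) * h powr (2 - d))"
      using L1' H(1) by (intro mult_left_mono) auto
    also have "\<dots> = H * (8 + H) * h powr ?\<beta>" by (simp add: powr_add mult_ac)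
    finally have L2: "integral ?T (\<lambda>x. (f x)\<^sup>2) \<le> H * (8 + H) * h powr ?\<beta>" .
    have "(\<Sum>k\<in>dyadic j. (cmod (fourier_coeff w k))\<^sup>2) / pi\<^sup>2
        = (\<Sum>k\<in>dyadic j. 1 / pi\<^sup>2 * (cmod (fourier_coeff w k))\<^sup>2)"
      by (simp add: sum_divide_distrib)
    also have "\<dots> \<le> (\<Sum>k\<in>dyadic j. (cmod (fourier_coeff f k))\<^sup>2)"
      unfolding coeff norm_mult power_mult_distrib by (intro sum_mono mult_right_mono low) auto
    also have "\<dots> \<le> integral ?T (\<lambda>x. (f x)\<^sup>2) / (2 * pi)"
      by (rule bessel_inequality[OF fT finite_dyadic])
    also have "\<dots> \<le> integral ?T (\<lambda>x. (f x)\<^sup>2) / 1"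
      using pi_gt3 by (intro divide_left_mono integral_nonneg integrable_continuous_real continuous_intros fT) auto
    also have "\<dots> \<le> H * (8 + H) * h powr ?\<beta>" using L2 by simp
    finally show ?thesis by (simp add: pos_divide_le_eq mult_ac)
  qed
  have lim: "filterlim (\<lambda>j. (1 / 2 :: real) ^ Suc j) (at_right 0) sequentially"
    unfolding filterlim_at by (intro conjI LIMSEQ_Suc LIMSEQ_power_zero always_eventually) auto
  have "\<forall>\<^sub>F j in sequentially. integral {0..2 * pi - (1 / 2) ^ Suc j} (\<lambda>x. \<bar>w (x + (1 / 2) ^ Suc j) - w x\<bar>)
      \<le> 8 * ((1 / 2) ^ Suc j) powr (2 - d)"
    using upper_minkowski_dim_less_imp_translation[OF w dim] lim unfolding filterlim_iff by blast
  hence "\<forall>\<^sub>F j in sequentially. (\<Sum>k\<in>dyadic j. (cmod (fourier_coeff w k))\<^sup>2) \<le> K * 2 powr (- ?\<beta> * real j)"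
  proof (rule eventually_mono)
    fix j assume "integral {0..2 * pi - (1 / 2) ^ Suc j} (\<lambda>x. \<bar>w (x + (1 / 2) ^ Suc j) - w x\<bar>)
      \<le> 8 * ((1 / 2) ^ Suc j) powr (2 - d)"
    from step[OF refl this]
    have "(\<Sum>k\<in>dyadic j. (cmod (fourier_coeff w k))\<^sup>2) \<le> pi\<^sup>2 * (H * (8 + H)) * ((1 / 2) ^ Suc j) powr ?\<beta>" .
    also have "((1 / 2 :: real) ^ Suc j) powr ?\<beta> = (1 / 2) powr ?\<beta> * ((1 / 2) ^ j) powr ?\<beta>"
      unfolding power_Suc by (rule powr_mult)
    also have "((1 / 2 :: real) ^ j) powr ?\<beta> = 2 powr (- ?\<beta> * real j)"
    proof -
      have "(1 / 2 :: real) ^ j = 2 powr (- real j)"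
        by (simp add: powr_minus powr_realpow power_one_over inverse_eq_divide)
      moreover have "- real j * ?\<beta> = - ?\<beta> * real j" by (rule mult_minus_left[THEN trans]) (simp only: mult_minus_left mult.commute)
      ultimately show ?thesis by (simp only: powr_powr)
    qed
    finally show "(\<Sum>k\<in>dyadic j. (cmod (fourier_coeff w k))\<^sup>2) \<le> K * 2 powr (- ?\<beta> * real j)"
      by (simp add: K_def mult.assoc)
  qed
  thus ?thesis using K0 by blast
qed

lemma summable_on_dyadic:
  fixes a :: "int \<Rightarrow> real"
  assumes a: "\<And>k. a k \<ge> 0" and s: "s > 0"
    and le: "\<forall>\<^sub>F j in sequentially. (\<Sum>k\<in>dyadic j. a k) \<le> K * 2 powr (- s * real j)"
  shows "a summable_on UNIV"
proof (rule nonneg_bdd_above_summable_on)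
  define B where "B j = (\<Sum>k\<in>dyadic j. a k)" for j
  have B0: "B j \<ge> 0" for j using a by (simp add: B_def sum_nonneg)
  have K0: "summable (\<lambda>j. \<bar>K\<bar> * ((real j + 1) * 2 powr (- s * real j)))"
    using s by (intro summable_mult summable_linear_geometric) simp
  have B: "summable B"
  proof (rule summable_comparison_test_ev[OF _ K0])
    show "\<forall>\<^sub>F j in sequentially. norm (B j) \<le> \<bar>K\<bar> * ((real j + 1) * 2 powr (- s * real j))"
      using le
    proof (rule eventually_mono)
      fix j assume "(\<Sum>k\<in>dyadic j. a k) \<le> K * 2 powr (- s * real j)"
      also have "\<dots> \<le> \<bar>K\<bar> * ((real j + 1) * 2 powr (- s * real j))"
        by (intro mult_mono) (auto simp: mult_le_cancel_right1)
      finally show "norm (B j) \<le> \<bar>K\<bar> * ((real j + 1) * 2 powr (- s * real j))"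
        using B0[of j] by (simp add: B_def)
    qed
  qed
  show "bdd_above (sum a ` {F. F \<subseteq> UNIV \<and> finite F})"
  proof (rule bdd_aboveI)
    fix y assume "y \<in> sum a ` {F. F \<subseteq> UNIV \<and> finite F}"
    then obtain F where F: "finite F" "y = sum a F" by blast
    obtain J where J: "F \<subseteq> low J" using finite_subset_low[OF F(1)] by blast
    have "y \<le> (\<Sum>k\<in>low J. a k)" unfolding F(2) using J a by (intro sum_mono2 finite_low) auto
    also have "\<dots> = a 0 + (\<Sum>j<J. B j)" by (simp add: sum_low B_def)
    also have "\<dots> \<le> a 0 + suminf B" using B B0 by (intro add_left_mono sum_le_suminf) auto
    finally show "y \<le> a 0 + suminf B" .
  qed
qed (use a in auto)

text \<open>Here \<open>b\<close> stands for the coefficients of the datum. On a block its energy is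
  that of \<open>w\<close> up to the smoothing error 2^j 2^(-3 j) = 2^(-2 j), which is absorbed
  because 2 - d + \<theta> < 2 by d >= 1 and \<theta> < 1. The Sobolev weight costs 2^(2 \<sigma>
  j), and geometric decay remains.\<close>

lemma sobolev_of_graph_dimension:
  fixes w :: "real \<Rightarrow> real"
  assumes w: "continuous_on UNIV w" "\<And>x. w (x + 2 * pi) = w x"
    and H: "H \<ge> 0" "\<And>x y. \<bar>w x - w y\<bar> \<le> H * \<bar>x - y\<bar> powr \<theta>" and \<theta>: "0 < \<theta>" "\<theta> < 1"
    and dim: "upper_minkowski_dim (torus_graph w) < ereal d" and d: "d \<ge> 1"
    and \<sigma>: "0 \<le> \<sigma>" "2 * \<sigma> < 2 - d + \<theta>"
    and C: "\<And>k. k \<noteq> 0 \<Longrightarrow> cmod (b k) \<le> cmod (fourier_coeff w k) + C * \<bar>of_int k\<bar> powr (- 3 / 2)"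
  shows "(\<lambda>k. japanese_bracket k powr (2 * \<sigma>) * (cmod (b k))\<^sup>2) summable_on UNIV"
proof -
  let ?\<beta> = "2 - d + \<theta>"
  obtain K where K: "K \<ge> 0" "\<forall>\<^sub>F j in sequentially.
    (\<Sum>k\<in>dyadic j. (cmod (fourier_coeff w k))\<^sup>2) \<le> K * 2 powr (- ?\<beta> * real j)"
    using dyadic_energy_le[OF w H \<theta>(1) dim d] by blast
  show ?thesis
  proof (rule summable_on_dyadic)
    show "?\<beta> - 2 * \<sigma> > 0" using \<sigma> by simp
    show "japanese_bracket k powr (2 * \<sigma>) * (cmod (b k))\<^sup>2 \<ge> 0" for k by simp
    show "\<forall>\<^sub>F j in sequentially. (\<Sum>k\<in>dyadic j. japanese_bracket k powr (2 * \<sigma>) * (cmod (b k))\<^sup>2)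
        \<le> (2 powr (4 * \<sigma>) * (2 * K + 4 * C\<^sup>2)) * 2 powr (- (?\<beta> - 2 * \<sigma>) * real j)"
      using K(2)
    proof (rule eventually_mono)
      fix j assume en: "(\<Sum>k\<in>dyadic j. (cmod (fourier_coeff w k))\<^sup>2) \<le> K * 2 powr (- ?\<beta> * real j)"
      have term_le: "japanese_bracket k powr (2 * \<sigma>) * (cmod (b k))\<^sup>2
          \<le> 2 powr (2 * \<sigma> * (real j + 2)) * (2 * (cmod (fourier_coeff w k))\<^sup>2 + 2 * C\<^sup>2 * 2 powr (- 3 * real j))"
        if k: "k \<in> dyadic j" for k
      proof (rule mult_mono)
        have k0: "k \<noteq> 0" by (rule dyadic_nonzero[OF k])
        have "\<bar>k\<bar> \<le> 2 ^ Suc j" using k by (simp add: dyadic_def)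
        hence "real_of_int \<bar>k\<bar> \<le> real_of_int (2 ^ Suc j)" by (simp only: of_int_le_iff)
        hence k1: "\<bar>real_of_int k\<bar> \<le> 2 ^ Suc j" by simp
        have "japanese_bracket k \<le> 1 + \<bar>of_int k\<bar>"
          unfolding japanese_bracket_def using sqrt_sum_squares_le_sum_abs[of 1 "of_int k"] by simp
        also have "\<dots> \<le> 2 ^ Suc j + 2 ^ Suc j"
          using k1 by (intro add_mono) (auto simp: one_le_power simp del: power_Suc)
        also have "\<dots> = 2 powr (real j + 2)" by (simp add: powr_add powr_realpow)
        finally have "japanese_bracket k powr (2 * \<sigma>) \<le> (2 powr (real j + 2)) powr (2 * \<sigma>)"
          using \<sigma> by (intro powr_mono2) (auto simp: japanese_bracket_def)
        thus "japanese_bracket k powr (2 * \<sigma>) \<le> 2 powr (2 * \<sigma> * (real j + 2))"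
          by (simp add: powr_powr mult.commute)
        have sq: "(x + y)\<^sup>2 \<le> 2 * x\<^sup>2 + 2 * y\<^sup>2" for x y :: real
          using zero_le_power2[of "x - y"] by (simp add: power2_eq_square algebra_simps)
        have "(cmod (b k))\<^sup>2 \<le> (cmod (fourier_coeff w k) + C * \<bar>of_int k\<bar> powr (- 3 / 2))\<^sup>2"
          using C[OF k0] by (intro power_mono) auto
        also have "\<dots> \<le> 2 * (cmod (fourier_coeff w k))\<^sup>2 + 2 * (C * \<bar>of_int k\<bar> powr (- 3 / 2))\<^sup>2"
          by (rule sq)
        also have "(C * \<bar>of_int k\<bar> powr (- 3 / 2))\<^sup>2 \<le> C\<^sup>2 * 2 powr (- 3 * real j)"
        proof -
          have "(\<bar>real_of_int k\<bar> powr (- 3 / 2))\<^sup>2 \<le> (2 powr (- 3 / 2 * real j))\<^sup>2"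
            by (intro power_mono dyadic_powr_le[OF k]) auto
          also have "\<dots> = 2 powr (- 3 * real j)" by (simp add: powr_power)
          finally show ?thesis by (simp add: power_mult_distrib mult_left_mono)
        qed
        finally show "(cmod (b k))\<^sup>2 \<le> 2 * (cmod (fourier_coeff w k))\<^sup>2 + 2 * C\<^sup>2 * 2 powr (- 3 * real j)"
          by simp
      qed auto
      have "(\<Sum>k\<in>dyadic j. japanese_bracket k powr (2 * \<sigma>) * (cmod (b k))\<^sup>2)
          \<le> (\<Sum>k\<in>dyadic j. 2 powr (2 * \<sigma> * (real j + 2)) * (2 * (cmod (fourier_coeff w k))\<^sup>2 + 2 * C\<^sup>2 * 2 powr (- 3 * real j)))"
        by (rule sum_mono[OF term_le])
      also have "\<dots> = 2 powr (2 * \<sigma> * (real j + 2)) * (2 * (\<Sum>k\<in>dyadic j. (cmod (fourier_coeff w k))\<^sup>2)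
          + real (card (dyadic j)) * (2 * C\<^sup>2 * 2 powr (- 3 * real j)))"
        by (simp add: sum_distrib_left[symmetric] sum.distrib)
      also have "\<dots> \<le> 2 powr (2 * \<sigma> * (real j + 2)) * (2 * (K * 2 powr (- ?\<beta> * real j)) + 4 * C\<^sup>2 * 2 powr (- ?\<beta> * real j))"
      proof (intro mult_left_mono add_mono en)
        have "real (card (dyadic j)) * (2 * C\<^sup>2 * 2 powr (- 3 * real j)) = 4 * C\<^sup>2 * (2 powr real j * 2 powr (- 3 * real j))"
          by (simp add: card_dyadic powr_realpow)
        also have "2 powr real j * 2 powr (- 3 * real j) = 2 powr (- 2 * real j)"
          by (simp add: powr_add[symmetric])
        also have "\<dots> \<le> 2 powr (- ?\<beta> * real j)"
          using d \<theta> by (intro powr_mono mult_right_mono) auto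
        finally show "real (card (dyadic j)) * (2 * C\<^sup>2 * 2 powr (- 3 * real j)) \<le> 4 * C\<^sup>2 * 2 powr (- ?\<beta> * real j)"
          by (simp add: mult_left_mono)
      qed auto
      also have "\<dots> = (2 * K + 4 * C\<^sup>2) * (2 powr (2 * \<sigma> * (real j + 2)) * 2 powr (- ?\<beta> * real j))"
        by (simp add: algebra_simps)
      also have "2 powr (2 * \<sigma> * (real j + 2)) * 2 powr (- ?\<beta> * real j) = 2 powr (4 * \<sigma>) * 2 powr (- (?\<beta> - 2 * \<sigma>) * real j)"
        unfolding powr_add[symmetric] by (simp add: algebra_simps)
      finally show "(\<Sum>k\<in>dyadic j. japanese_bracket k powr (2 * \<sigma>) * (cmod (b k))\<^sup>2)
        \<le> (2 powr (4 * \<sigma>) * (2 * K + 4 * C\<^sup>2)) * 2 powr (- (?\<beta> - 2 * \<sigma>) * real j)"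
        by (simp add: mult_ac)
    qed
  qed
qed

section \<open>Bounds for the dimension of the graph\<close>

lemma upper_minkowski_dim_le_31_16:
  fixes w :: "real \<Rightarrow> real"
  assumes "\<And>\<theta>. 0 < \<theta> \<Longrightarrow> \<theta> < 1 / 16 \<Longrightarrow> \<exists>H\<ge>0. \<forall>x y. \<bar>w x - w y\<bar> \<le> H * \<bar>x - y\<bar> powr \<theta>"
  shows "upper_minkowski_dim (torus_graph w) \<le> ereal (31 / 16)"
proof (rule ereal_le_epsilon2)
  fix e :: real assume e: "0 < e"
  \<comment> \<open>The exponent approaches 1/16 as \<open>e\<close> tends to 0; the maximum keeps
    it positive for large \<open>e\<close>.\<close>
  define \<theta> where "\<theta> = max (1 / 32) (1 / 16 - e)"
  have \<theta>: "0 < \<theta>" "\<theta> < 1 / 16" using e by (auto simp: \<theta>_def max_def)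
  obtain H where "H \<ge> 0" "\<And>x y. \<bar>w x - w y\<bar> \<le> H * \<bar>x - y\<bar> powr \<theta>" using assms[OF \<theta>] by blast
  hence "upper_minkowski_dim (torus_graph w) \<le> ereal (2 - \<theta>)"
    using \<theta> by (intro upper_minkowski_dim_holder) auto
  also have "\<dots> \<le> ereal (31 / 16) + ereal e" by (simp add: \<theta>_def)
  finally show "upper_minkowski_dim (torus_graph w) \<le> ereal (31 / 16) + ereal e" .
qed

text \<open>Were the dimension smaller, \<open>sobolev_of_graph_dimension\<close> would put
  \<open>g\<close> into a Sobolev space of order above its index. At the threshold r = 17/32 the
  value 33/16 - 2 r is 1, so below it there is room for an exponent d >= 1.\<close>

lemma graph_dimension_ge:
  fixes w :: "real \<Rightarrow> real"
  assumes g: "torus_fun g" "set_integrable lebesgue {0..2 * pi} g"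
    and idx: "sobolev_index g < ereal (17 / 32)"
    and w: "continuous_on UNIV w" "\<And>x. w (x + 2 * pi) = w x"
    and hol: "\<And>\<theta>. 0 < \<theta> \<Longrightarrow> \<theta> < 1 / 16 \<Longrightarrow> \<exists>H\<ge>0. \<forall>x y. \<bar>w x - w y\<bar> \<le> H * \<bar>x - y\<bar> powr \<theta>"
    and C: "\<And>k. k \<noteq> 0 \<Longrightarrow> cmod (fourier_coeff g k) \<le> cmod (fourier_coeff w k) + C * \<bar>of_int k\<bar> powr (- 3 / 2)"
  shows "ereal (33 / 16) - 2 * sobolev_index g \<le> upper_minkowski_dim (torus_graph w)"
proof (rule ccontr)
  let ?D = "upper_minkowski_dim (torus_graph w)"
  assume "\<not> ?thesis"
  hence less: "?D < ereal (33 / 16) - 2 * sobolev_index g" by simp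
  have D: "?D \<le> ereal (31 / 16)" by (rule upper_minkowski_dim_le_31_16[OF hol])
  obtain r where r: "sobolev_index g \<le> ereal r" "r < 17 / 32" "?D < ereal (33 / 16 - 2 * r)"
  proof (cases "sobolev_index g")
    case (real r)
    show thesis by (rule that[of r]) (use real idx less in auto)
  next
    case PInf
    thus thesis using idx by simp
  next
    \<comment> \<open>An index of minus infinity makes the claimed lower bound infinite; r = 0 then
      serves, because the dimension is at most 31/16 < 33/16.\<close>
    case MInf
    have "?D < ereal (33 / 16 - 2 * 0)" using D by (rule le_less_trans) simp
    thus thesis using MInf by (intro that[of 0]) auto
  qed
  have "?D < min (ereal (33 / 16 - 2 * r)) (ereal 2)"
    using r(3) le_less_trans[OF D, of "ereal 2"] by simp
  then obtain d' where d': "?D < ereal d'" "ereal d' < min (ereal (33 / 16 - 2 * r)) (ereal 2)"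
    using ereal_dense2 by blast
  \<comment> \<open>Raising the exponent to 1 keeps it below 33/16 - 2 r precisely because r <
    17/32.\<close>
  define d where "d = max d' 1"
  have d: "?D < ereal d" "d \<ge> 1" "d < 2" "d < 33 / 16 - 2 * r"
    using d' r(2) by (auto simp: d_def max_def not_le intro: less_le_trans)
  \<comment> \<open>The midpoint between \<open>max r 0\<close> and (33/16 - d) / 2, the supremum of
    the orders within reach of Hoelder exponents below 1/16.\<close>
  define \<sigma> where "\<sigma> = (max r 0 + (33 / 16 - d) / 2) / 2"
  have \<sigma>: "r < \<sigma>" "0 \<le> \<sigma>" "2 * \<sigma> < 33 / 16 - d"
  proof -
    have m: "2 * max r 0 < 33 / 16 - d" using d by (auto simp: max_def)
    moreover have "r \<le> max r 0" "0 \<le> max r 0" by simp_all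
    moreover have "4 * \<sigma> = 2 * max r 0 + (33 / 16 - d)" by (simp add: \<sigma>_def)
    ultimately show "r < \<sigma>" "0 \<le> \<sigma>" "2 * \<sigma> < 33 / 16 - d" by linarith+
  qed
  \<comment> \<open>The midpoint of the admissible range: \<theta> has to exceed 2 \<sigma> - 2 + d,
    which is below 1/16 by the choice of \<sigma>.\<close>
  define \<theta> where "\<theta> = (max 0 (2 * \<sigma> - 2 + d) + 1 / 16) / 2"
  have \<theta>: "0 < \<theta>" "\<theta> < 1 / 16" "2 * \<sigma> < 2 - d + \<theta>" using \<sigma> by (auto simp: \<theta>_def max_def field_simps)
  obtain H where H: "H \<ge> 0" "\<And>x y. \<bar>w x - w y\<bar> \<le> H * \<bar>x - y\<bar> powr \<theta>" using hol[OF \<theta>(1,2)] by blast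
  have "(\<lambda>k. japanese_bracket k powr (2 * \<sigma>) * (cmod (fourier_coeff g k))\<^sup>2) summable_on UNIV"
    by (rule sobolev_of_graph_dimension[OF w H \<theta>(1) _ d(1,2) \<sigma>(2) \<theta>(3) C]) (use \<theta> in auto)
  hence "in_sobolev \<sigma> g" using g by (simp add: in_sobolev_def)
  hence "ereal \<sigma> \<le> sobolev_index g" unfolding sobolev_index_def by (intro Sup_upper) auto
  thus False using r(1) \<sigma>(1) by (metis ereal_less_eq(3) not_le order_trans)
qed

lemma kawahara_representative:
  assumes \<alpha>: "\<alpha> \<le> 1" and bv: "torus_BV g" and sol: "kawahara_solution \<alpha> g u"
    and good: "weyl_good \<alpha> t"
  obtains w C where "continuous_representative (u t) w" "\<And>x. w (x + 2 * pi) = w x"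
    "\<exists>B. \<forall>x. \<bar>w x\<bar> \<le> B"
    "\<And>\<theta>. 0 < \<theta> \<Longrightarrow> \<theta> < 1 / 16 \<Longrightarrow> \<exists>H\<ge>0. \<forall>x y. \<bar>w x - w y\<bar> \<le> H * \<bar>x - y\<bar> powr \<theta>"
    "\<And>k. k \<noteq> 0 \<Longrightarrow> cmod (fourier_coeff g k) \<le> cmod (fourier_coeff w k) + C * \<bar>of_int k\<bar> powr (- 3 / 2)"
proof -
  obtain B where B: "\<And>x. x \<in> {0..2 * pi} \<Longrightarrow> \<bar>g x\<bar> \<le> B" using torus_BV_bounded[OF bv] by blast
  have "kawahara_forward_solution \<alpha> g u" using sol by (simp add: kawahara_solution_def)
  have g: "square_integrable g"
    by (rule forward_solution_data(2)[OF B \<open>kawahara_forward_solution \<alpha> g u\<close>])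
  let ?c = "Re (fourier_coeff g 0)"
  obtain C where "\<forall>k. k \<noteq> 0 \<longrightarrow> cmod (fourier_coeff (u t) k
      - cis (lin_phase \<alpha> ?c t k) * fourier_coeff g k) \<le> C * \<bar>of_int k\<bar> powr (- 3 / 2)"
    using solution_smoothing(2)[OF \<alpha> bv sol, of t] ..
  hence C: "\<And>k. k \<noteq> 0 \<Longrightarrow> cmod (fourier_coeff (u t) k
      - cis (lin_phase \<alpha> ?c t k) * fourier_coeff g k) \<le> C * \<bar>of_int k\<bar> powr (- 3 / 2)" by blast
  have u: "torus_L2 (u t)" by (rule solution_smoothing(1)[OF \<alpha> bv sol])
  obtain E where E: "E \<ge> 0"
    "\<And>j x. cmod (\<Sum>k\<in>dyadic j. fourier_coeff (u t) k * cis (of_int k * x)) \<le> E * (real j + 1) * 2 powr (- 1 / 16 * real j)"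
    "\<And>j x y. cmod (\<Sum>k\<in>dyadic j. fourier_coeff (u t) k * (cis (of_int k * x) - cis (of_int k * y)))
       \<le> E * (real j + 1) * 2 powr (15 / 16 * real j) * \<bar>x - y\<bar>"
    by (rule solution_block_bounds[OF bv g good C], assumption) (rule that; blast)
  obtain w :: "real \<Rightarrow> complex" where w: "continuous_on UNIV w"
    "\<And>\<theta>. 0 < \<theta> \<Longrightarrow> \<theta> < 1 / 16 \<Longrightarrow> \<exists>H\<ge>0. \<forall>x y. cmod (w x - w y) \<le> H * \<bar>x - y\<bar> powr \<theta>"
    "\<exists>B. \<forall>x. cmod (w x) \<le> B"
    "\<And>x. w (x + 2 * pi) = w x"
    "\<And>k. integral {0..2 * pi} (\<lambda>x. cis (- (of_int k * x)) * w x) = 2 * pi * fourier_coeff (u t) k"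
    by (rule block_synthesis[OF E]) (rule that; (assumption | blast | simp))
  have rep: "continuous_representative (u t) (\<lambda>x. Re (w x))"
    by (rule fourier_representative[OF u w(1,4,5)])
  have ae: "AE x in lebesgue. u t x = Re (w x)"
    using rep unfolding continuous_representative_def by (auto elim: eventually_mono)
  have cw: "fourier_coeff (u t) k = fourier_coeff (\<lambda>x. Re (w x)) k" for k
    by (rule fourier_coeff_cong_AE[OF ae]) (use u in \<open>simp add: torus_L2_def\<close>)
  show thesis
  proof (rule that[of "\<lambda>x. Re (w x)" C])
    show "continuous_representative (u t) (\<lambda>x. Re (w x))" by (rule rep)
    show "Re (w (x + 2 * pi)) = Re (w x)" for x by (simp add: w(4))
    show "\<exists>B. \<forall>x. \<bar>Re (w x)\<bar> \<le> B" using w(3) abs_Re_le_cmod order_trans by blast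
    show "\<exists>H\<ge>0. \<forall>x y. \<bar>Re (w x) - Re (w y)\<bar> \<le> H * \<bar>x - y\<bar> powr \<theta>" if \<theta>: "0 < \<theta>" "\<theta> < 1 / 16" for \<theta>
    proof -
      obtain H where H: "H \<ge> 0" "\<And>x y. cmod (w x - w y) \<le> H * \<bar>x - y\<bar> powr \<theta>" using w(2)[OF \<theta>] by blast
      have "\<bar>Re (w x) - Re (w y)\<bar> \<le> H * \<bar>x - y\<bar> powr \<theta>" for x y
        using abs_Re_le_cmod[of "w x - w y"] H(2)[of x y] by simp
      thus ?thesis using H(1) by blast
    qed
    fix k :: int assume k: "k \<noteq> 0"
    \<comment> \<open>The linear flow multiplies each coefficient by a unimodular number, so bounds
      on moduli pass from the solution back to the datum.\<close>
    have "cmod (fourier_coeff g k) = cmod (cis (lin_phase \<alpha> ?c t k) * fourier_coeff g k)"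
      by (simp add: norm_mult)
    also have "\<dots> \<le> cmod (fourier_coeff (u t) k) + C * \<bar>of_int k\<bar> powr (- 3 / 2)"
      using norm_triangle_sub[of "cis (lin_phase \<alpha> ?c t k) * fourier_coeff g k" "fourier_coeff (u t) k"] C[OF k]
      by (simp add: norm_minus_commute)
    finally show "cmod (fourier_coeff g k) \<le> cmod (fourier_coeff (\<lambda>x. Re (w x)) k) + C * \<bar>of_int k\<bar> powr (- 3 / 2)"
      by (simp add: cw)
  qed
qed

theorem theorem1p2:
  fixes \<alpha> :: real and g :: "real \<Rightarrow> real" and u :: "real \<Rightarrow> real \<Rightarrow> real"
  assumes "\<alpha> \<in> {-1, 0, 1}"
    and "torus_BV g"
    and "kawahara_solution \<alpha> g u"
    and "sobolev_index g < ereal (17/32)"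
  shows "(AE t in lebesgue. t \<notin> {pi * q | q. q \<in> \<rat>} \<longrightarrow>
            (\<exists>w. continuous_representative (u t) w \<and>
                 upper_minkowski_dim (torus_graph w)
                   \<in> {ereal (33/16) - 2 * sobolev_index g .. ereal (31/16)})) \<and>
         (AE t in lebesgue. t \<notin> {pi * q | q. q \<in> \<rat>} \<longrightarrow>
            (\<exists>w. continuous_representative (\<lambda>x. \<bar>u t x\<bar>\<^sup>2) w \<and>
                 upper_minkowski_dim (torus_graph w) \<le> ereal (31/16)))"
proof -
  have \<alpha>: "\<alpha> \<le> 1" using assms(1) by auto
  have good: "(\<exists>w. continuous_representative (u t) w \<and>
                 upper_minkowski_dim (torus_graph w)
                   \<in> {ereal (33/16) - 2 * sobolev_index g .. ereal (31/16)}) \<and>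
      (\<exists>w. continuous_representative (\<lambda>x. \<bar>u t x\<bar>\<^sup>2) w \<and>
                 upper_minkowski_dim (torus_graph w) \<le> ereal (31/16))" if good: "weyl_good \<alpha> t" for t
  proof -
    obtain w C where w: "continuous_representative (u t) w" "\<And>x. w (x + 2 * pi) = w x"
      "\<exists>B. \<forall>x. \<bar>w x\<bar> \<le> B"
      "\<And>\<theta>. 0 < \<theta> \<Longrightarrow> \<theta> < 1 / 16 \<Longrightarrow> \<exists>H\<ge>0. \<forall>x y. \<bar>w x - w y\<bar> \<le> H * \<bar>x - y\<bar> powr \<theta>"
      "\<And>k. k \<noteq> 0 \<Longrightarrow> cmod (fourier_coeff g k) \<le> cmod (fourier_coeff w k) + C * \<bar>of_int k\<bar> powr (- 3 / 2)"
      by (rule kawahara_representative[OF \<alpha> assms(2,3) good]) (rule that; blast)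
    have wc: "continuous_on UNIV w" using w(1) by (simp add: continuous_representative_def)
    obtain B where B: "\<And>x. x \<in> {0..2 * pi} \<Longrightarrow> \<bar>g x\<bar> \<le> B" using torus_BV_bounded[OF assms(2)] by blast
    have "kawahara_forward_solution \<alpha> g u" using assms(3) by (simp add: kawahara_solution_def)
    have "square_integrable g"
      by (rule forward_solution_data(2)[OF B \<open>kawahara_forward_solution \<alpha> g u\<close>])
    hence gi: "set_integrable lebesgue {0..2 * pi} g"
      using L2_imp_set_integrable by (auto simp: square_integrable_def)
    have gp: "torus_fun g" using assms(2) by (simp add: torus_BV_def)
    have "ereal (33 / 16) - 2 * sobolev_index g \<le> upper_minkowski_dim (torus_graph w)"
      by (rule graph_dimension_ge[OF gp gi assms(4) wc w(2,4,5)])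
    moreover have "upper_minkowski_dim (torus_graph w) \<le> ereal (31 / 16)"
      by (rule upper_minkowski_dim_le_31_16[OF w(4)])
    moreover have "continuous_representative (\<lambda>x. \<bar>u t x\<bar>\<^sup>2) (\<lambda>x. (w x)\<^sup>2)"
      using w(1) unfolding continuous_representative_def
      by (auto intro!: continuous_intros elim: eventually_mono)
    moreover have "upper_minkowski_dim (torus_graph (\<lambda>x. (w x)\<^sup>2)) \<le> ereal (31 / 16)"
    proof (rule upper_minkowski_dim_le_31_16)
      fix \<theta> :: real assume \<theta>: "0 < \<theta>" "\<theta> < 1 / 16"
      obtain H where H: "H \<ge> 0" "\<And>x y. \<bar>w x - w y\<bar> \<le> H * \<bar>x - y\<bar> powr \<theta>" using w(4)[OF \<theta>] by blast
      \<comment> \<open>Boundedness of \<open>w\<close> lets its square inherit every Hoelder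
        exponent.\<close>
      obtain M where M: "\<And>x. \<bar>w x\<bar> \<le> M" using w(3) by blast
      have M0: "M \<ge> 0" using M[of 0] by linarith
      have "\<bar>(w x)\<^sup>2 - (w y)\<^sup>2\<bar> \<le> (2 * M * H) * \<bar>x - y\<bar> powr \<theta>" for x y
      proof -
        have "\<bar>(w x)\<^sup>2 - (w y)\<^sup>2\<bar> = \<bar>w x + w y\<bar> * \<bar>w x - w y\<bar>"
          by (simp add: power2_eq_square square_diff_square_factored abs_mult)
        also have "\<dots> \<le> (2 * M) * (H * \<bar>x - y\<bar> powr \<theta>)"
          using M[of x] M[of y] M0 by (intro mult_mono H(2)) auto
        finally show ?thesis by (simp add: mult.assoc)
      qed
      thus "\<exists>H\<ge>0. \<forall>x y. \<bar>(w x)\<^sup>2 - (w y)\<^sup>2\<bar> \<le> H * \<bar>x - y\<bar> powr \<theta>"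
        using M0 H(1) by (intro exI[of _ "2 * M * H"]) auto
    qed
    ultimately show ?thesis using w(1) by auto
  qed
  show ?thesis
    \<comment> \<open>Both exceptional sets lie in the one null set of times that are not
      \<open>weyl_good\<close>.\<close>
    by (intro conjI; rule eventually_mono[OF weyl_good_ae[of \<alpha>]]; use good in blast)
qed

end
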